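(* Let $H$ be a fixed reflexive triangle-free graph. Then the problem $\operatorname{Recol}(H)$, restricted to instances $(G,\phi,\psi)$ in which $G$ is reflexive, can be solved in time polynomial in $|V(G)|$.
   Context: Graphs are undirected and may have loops; a graph is reflexive if every vertex has a loop. A homomorphism ($H$-colouring) $\phi:G\to H$ is a map $V(G)\to V(H)$ such that $\phi(u)\phi(v)\in E(H)$ whenever $uv\in E(G)$. A recolouring between two $H$-colourings $\phi,\psi$ of $G$ is a sequence $\phi=\phi_0,\phi_1,\dots,\phi_t=\psi$ of $H$-colourings of $G$ in which consecutive colourings differ on exactly one vertex $v$, with the additional requirement that if $v$ has a loop in $G$ then $\phi_{i}(v)$ is adjacent to $\phi_{i-1}(v)$ in $H$. An instance $(G,\phi,\psi)$ of $\operatorname{Recol}(H)$ consists of a graph $G$ and two $H$-colourings $\phi,\psi$ of $G$; the question is whether there is a recolouring between $\phi$ and $\psi$. A graph is triangle-free if it has no cycle of length $3$ (loops are ignored). *)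

theory Defs
  imports Main "HOL-Library.FuncSet" "HOL-Computational_Algebra.Polynomial"
begin

section \<open>Graphs, colourings and recolourings\<close>

record 'a graph =
  verts :: "'a set"
  edges :: "('a \<times> 'a) set"

text \<open>Undirected edges are represented by symmetric pairs; a pair \<open>(v, v)\<close> is a loop.\<close>

definition graph :: "'a graph \<Rightarrow> bool" where
  "graph G \<longleftrightarrow> finite (verts G) \<and> edges G \<subseteq> verts G \<times> verts G \<and> sym (edges G)"

definition reflexive :: "'a graph \<Rightarrow> bool" where
  "reflexive G \<longleftrightarrow> (\<forall>v\<in>verts G. (v, v) \<in> edges G)"

definition triangle_free :: "'a graph \<Rightarrow> bool" where
  "triangle_free G \<longleftrightarrow>
     \<not> (\<exists>x y z. x \<noteq> y \<and> y \<noteq> z \<and> x \<noteq> z \<and>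
          (x, y) \<in> edges G \<and> (y, z) \<in> edges G \<and> (z, x) \<in> edges G)"

text \<open>Colourings are extensional functions, so that equality of functions is equality of maps
  on the vertex set.\<close>

definition colourings :: "'v graph \<Rightarrow> 'a graph \<Rightarrow> ('v \<Rightarrow> 'a) set" where
  "colourings G H =
     {\<phi> \<in> verts G \<rightarrow>\<^sub>E verts H. \<forall>u v. (u, v) \<in> edges G \<longrightarrow> (\<phi> u, \<phi> v) \<in> edges H}"

definition recolouring_step ::
  "'v graph \<Rightarrow> 'a graph \<Rightarrow> ('v \<Rightarrow> 'a) \<Rightarrow> ('v \<Rightarrow> 'a) \<Rightarrow> bool" where
  "recolouring_step G H \<phi> \<psi> \<longleftrightarrow>
     (\<exists>v\<in>verts G. \<phi> v \<noteq> \<psi> v \<and> (\<forall>u\<in>verts G. u \<noteq> v \<longrightarrow> \<phi> u = \<psi> u) \<and>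
        ((v, v) \<in> edges G \<longrightarrow> (\<phi> v, \<psi> v) \<in> edges H))"

definition recolouring ::
  "'v graph \<Rightarrow> 'a graph \<Rightarrow> ('v \<Rightarrow> 'a) \<Rightarrow> ('v \<Rightarrow> 'a) \<Rightarrow> ('v \<Rightarrow> 'a) list \<Rightarrow> bool" where
  "recolouring G H \<phi> \<psi> \<phi>s \<longleftrightarrow>
     \<phi>s \<noteq> [] \<and> hd \<phi>s = \<phi> \<and> last \<phi>s = \<psi> \<and> set \<phi>s \<subseteq> colourings G H \<and>
     (\<forall>i. Suc i < length \<phi>s \<longrightarrow> recolouring_step G H (\<phi>s ! i) (\<phi>s ! Suc i))"

type_synonym ('v, 'a) recol_inst = "'v graph \<times> ('v \<Rightarrow> 'a) \<times> ('v \<Rightarrow> 'a)"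

definition recol_instances :: "'a graph \<Rightarrow> ('v, 'a) recol_inst set" where
  "recol_instances H =
     {(G, \<phi>, \<psi>). graph G \<and> \<phi> \<in> colourings G H \<and> \<psi> \<in> colourings G H}"

definition recol :: "'a graph \<Rightarrow> ('v, 'a) recol_inst \<Rightarrow> bool" where
  "recol H = (\<lambda>(G, \<phi>, \<psi>). \<exists>\<phi>s. recolouring G H \<phi> \<psi> \<phi>s)"


section \<open>Deterministic random access programs and their running time\<close>

text \<open>
  The machine model is a structured random access machine. Its memory consists of arrays of
  natural numbers that are indexed by natural numbers and identified by name; a program mentions
  only finitely many names, and a scalar variable is cell \<open>0\<close> of an array. Every elementary
  operation costs one time unit. The only arithmetic operations are addition and (truncated)
  subtraction, so one operation lengthens the binary representation of the largest stored
  number by at most one bit; hence, as for the usual unit-cost random access machine without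
  multiplication, polynomial time in this model is polynomial time on Turing machines.
\<close>

type_synonym memory = "string \<Rightarrow> nat \<Rightarrow> nat"

datatype aexp =
    Const nat
  | Get string aexp
  | Add aexp aexp
  | Sub aexp aexp

datatype bexp =
    Less aexp aexp
  | Equal aexp aexp
  | Not bexp
  | And bexp bexp

datatype com =
    Skip
  | Put string aexp aexp
  | Seq com com
  | If bexp com com
  | While bexp com

fun aval :: "aexp \<Rightarrow> memory \<Rightarrow> nat" where
  "aval (Const n) s = n"
| "aval (Get x a) s = s x (aval a s)"
| "aval (Add a b) s = aval a s + aval b s"
| "aval (Sub a b) s = aval a s - aval b s"

fun acost :: "aexp \<Rightarrow> nat" where
  "acost (Const n) = 1"
| "acost (Get x a) = acost a + 1"
| "acost (Add a b) = acost a + acost b + 1"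
| "acost (Sub a b) = acost a + acost b + 1"

fun bval :: "bexp \<Rightarrow> memory \<Rightarrow> bool" where
  "bval (Less a b) s \<longleftrightarrow> aval a s < aval b s"
| "bval (Equal a b) s \<longleftrightarrow> aval a s = aval b s"
| "bval (Not b) s \<longleftrightarrow> \<not> bval b s"
| "bval (And b c) s \<longleftrightarrow> bval b s \<and> bval c s"

fun bcost :: "bexp \<Rightarrow> nat" where
  "bcost (Less a b) = acost a + acost b + 1"
| "bcost (Equal a b) = acost a + acost b + 1"
| "bcost (Not b) = bcost b + 1"
| "bcost (And b c) = bcost b + bcost c + 1"

text \<open>\<open>exec c s t s'\<close>: started in memory \<open>s\<close>, the program \<open>c\<close> halts after \<open>t\<close> time units in
  memory \<open>s'\<close>. The command \<open>Put x a b\<close> is the array assignment \<open>x[a] := b\<close>.\<close>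

inductive exec :: "com \<Rightarrow> memory \<Rightarrow> nat \<Rightarrow> memory \<Rightarrow> bool" where
  Skip: "exec Skip s 1 s"
| Put: "exec (Put x a b) s (acost a + acost b + 1) (s(x := (s x)(aval a s := aval b s)))"
| Seq: "\<lbrakk>exec c1 s t1 s'; exec c2 s' t2 s''\<rbrakk> \<Longrightarrow> exec (Seq c1 c2) s (t1 + t2) s''"
| IfTrue: "\<lbrakk>bval b s; exec c1 s t s'\<rbrakk> \<Longrightarrow> exec (If b c1 c2) s (bcost b + 1 + t) s'"
| IfFalse: "\<lbrakk>\<not> bval b s; exec c2 s t s'\<rbrakk> \<Longrightarrow> exec (If b c1 c2) s (bcost b + 1 + t) s'"
| WhileFalse: "\<not> bval b s \<Longrightarrow> exec (While b c) s (bcost b + 1) s"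
| WhileTrue: "\<lbrakk>bval b s; exec c s t1 s'; exec (While b c) s' t2 s''\<rbrakk>
    \<Longrightarrow> exec (While b c) s (bcost b + 1 + t1 + t2) s''"

inductive_cases exec_SkipE: "exec Skip s t s'"
inductive_cases exec_PutE: "exec (Put x a b) s t s'"
inductive_cases exec_SeqE: "exec (Seq c1 c2) s t s'"
inductive_cases exec_IfE: "exec (If b c1 c2) s t s'"
inductive_cases exec_WhileE: "exec (While b c) s t s'"

lemma exec_deterministic:
  "exec c s t s' \<Longrightarrow> exec c s u s'' \<Longrightarrow> t = u \<and> s' = s''"
proof (induction arbitrary: u s'' rule: exec.induct)
  case (Skip s)
  then show ?case by (rule exec_SkipE) simp
next
  case (Put x a b s)
  then show ?case by (rule exec_PutE) simp
next
  case (Seq c1 s t1 s1 c2 t2 s2)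
  from Seq.prems show ?case
    by (rule exec_SeqE) (metis Seq.IH)
next
  case (IfTrue b s c1 t s1 c2)
  from IfTrue.prems show ?case
    by (rule exec_IfE) (simp_all add: IfTrue)
next
  case (IfFalse b s c2 t s1 c1)
  from IfFalse.prems show ?case
    by (rule exec_IfE) (simp_all add: IfFalse)
next
  case (WhileFalse b s c)
  from WhileFalse.prems show ?case
    by (rule exec_WhileE) (simp_all add: WhileFalse.hyps)
next
  case (WhileTrue b s c t1 s1 t2 s2)
  from WhileTrue.prems show ?case
  proof (rule exec_WhileE)
    fix v1 m v2
    assume u: "u = Suc (bcost b + v1 + v2)"
      and "bval b s" and "exec c s v1 m" and w: "exec (While b c) m v2 s''"
    with WhileTrue.IH(1) have "t1 = v1" "s1 = m" by blast+
    with WhileTrue.IH(2) w u show ?thesis by auto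
  qed (use WhileTrue.hyps(1) in simp)
qed

text \<open>The input word is stored in the array \<open>''in''\<close>; all other cells are initially \<open>0\<close>.\<close>

definition initial :: "nat list \<Rightarrow> memory" where
  "initial w = (\<lambda>x i. if x = ''in'' \<and> i < length w then w ! i else 0)"

text \<open>
  \<open>poly_time_solvable Inst yes enc sz\<close>: on the instances in \<open>Inst\<close>, one program decides the
  property \<open>yes\<close> in time polynomial in the parameter \<open>sz\<close>. The relation \<open>enc I w\<close> says that
  the word \<open>w\<close> is an encoding of the instance \<open>I\<close>; the program has to work for every encoding.
\<close>

definition poly_time_solvable ::
  "'i set \<Rightarrow> ('i \<Rightarrow> bool) \<Rightarrow> ('i \<Rightarrow> nat list \<Rightarrow> bool) \<Rightarrow> ('i \<Rightarrow> nat) \<Rightarrow> bool" where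
  "poly_time_solvable Inst yes enc sz \<longleftrightarrow>
     (\<exists>(c :: com) (p :: nat poly). \<forall>I\<in>Inst. \<forall>w. enc I w \<longrightarrow>
        (\<exists>t s'. exec c (initial w) t s' \<and> t \<le> poly p (sz I) \<and>
                s' ''out'' 0 = (if yes I then 1 else 0)))"


section \<open>Encoding of instances\<close>

text \<open>With the vertices of \<open>G\<close> listed as \<open>v\<^sub>0, \<dots>, v\<^sub>n\<^sub>-\<^sub>1\<close> in any order, the word consists of \<open>n\<close>,
  the adjacency matrix of \<open>G\<close> row by row, and the codes (under \<open>\<kappa>\<close>) of the colours
  \<open>\<phi> v\<^sub>i\<close> and then \<open>\<psi> v\<^sub>i\<close>.\<close>

definition encodes :: "('a \<Rightarrow> nat) \<Rightarrow> ('v, 'a) recol_inst \<Rightarrow> nat list \<Rightarrow> bool" where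
  "encodes \<kappa> = (\<lambda>(G, \<phi>, \<psi>) w. \<exists>vs. distinct vs \<and> set vs = verts G \<and>
     w = length vs #
         concat (map (\<lambda>u. map (\<lambda>v. if (u, v) \<in> edges G then 1 else 0) vs) vs) @
         map (\<lambda>v. \<kappa> (\<phi> v)) vs @ map (\<lambda>v. \<kappa> (\<psi> v)) vs)"

end

theory Submission
  imports Defs
begin

text \<open>
  Since \<open>H\<close> is triangle-free, a vertex \<open>v\<close> of a reflexive graph can move from \<open>a\<close> to \<open>b\<close> only if
  all its neighbours have colour \<open>a\<close> or \<open>b\<close>; hence moves preserve the homotopy class of the image
  of every closed walk. A recolouring from \<open>\<phi>\<close> to \<open>\<psi>\<close> thus yields reduced walks \<open>S v\<close> from \<open>\<phi> v\<close> to
  \<open>\<psi> v\<close> such that \<open>S u\<close> is homotopic to \<open>\<phi> u\<close>, \<open>S v\<close>, \<open>\<psi> u\<close> for all edges \<open>u v\<close>. Conversely,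
  given such a system, move any unblocked vertex along its walk. If all remaining vertices are blocked,
  following the blocking vertices leads to a cycle whose vertices can never move at all. So a system
  is realised unless it asks a frozen vertex to move.

  It remains to find a system, which is determined by the walk \<open>Q\<close> of one root \<open>q\<close> per component. If
  there are frozen vertices, take \<open>q\<close> frozen and \<open>Q\<close> trivial. Otherwise \<open>Q\<close> has to satisfy
  \<open>\<phi>(C) Q = Q \<psi>(C)\<close> for the fundamental cycles \<open>C\<close> through \<open>q\<close>. If all \<open>\<phi>(C)\<close> are trivial, any \<open>Q\<close>
  will do. If some \<open>w = \<phi>(C)\<close> is not, then \<open>Q = w\<^sup>t R\<close> with \<open>R\<close> composed of a piece of \<open>\<phi>(C)\<close> and a piece
  of \<open>\<psi>(C)\<close>, and \<open>t\<close> can be bounded linearly: if a large \<open>t\<close> is a solution, then all loops commute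
  with \<open>w\<close> and \<open>t = 0\<close> is one, too. The program tries all these polynomially many candidates.
\<close>

section \<open>Reduced words\<close>

text \<open>The program recognises neither frozen vertices nor solutions of the conjugacy equations.
  Every vertex takes its turn as root, and a candidate \<open>Q\<close> is tested by running the
  greedy procedure on a copy of the colouring; the result is kept only if the whole component
  reaches its target. Soundness then comes for free, because only legal moves are made. All the
  topology serves completeness: some candidate on the list succeeds whenever a recolouring exists.
  The obstacle is that the walk of a root may wind around a cycle arbitrarily often, so nothing
  bounds the length of a given recolouring; it must be replaced by another one whose root walk has
  polynomial length. The cases in which fundamental cycles suggest no candidate (a frozen root, or
  only trivial images) are served by a fixed finite list of words that depends on \<open>H\<close>
  alone.\<close>

fun cpush :: "'c \<Rightarrow> 'c list \<Rightarrow> 'c list" where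
  "cpush x [] = [x]"
| "cpush x (y # ys) =
     (if x = y then y # ys else if ys \<noteq> [] \<and> hd ys = x then ys else x # y # ys)"

text \<open>The letters are vertices, not edges, so a walk has two kinds of cancellation:
  \<open>x x\<close> becomes \<open>x\<close> (standing still on a loop) and \<open>x y x\<close>
  becomes \<open>x\<close> (turning back). Pushing letter after letter onto a reduced word carries
  out both.\<close>

definition nf :: "'c list \<Rightarrow> 'c list" where
  "nf xs = foldr cpush xs []"

fun reduced :: "'c list \<Rightarrow> bool" where
  "reduced [] \<longleftrightarrow> True"
| "reduced [x] \<longleftrightarrow> True"
| "reduced (x # y # zs) \<longleftrightarrow> x \<noteq> y \<and> (zs \<noteq> [] \<longrightarrow> hd zs \<noteq> x) \<and> reduced (y # zs)"

text \<open>Walks up to homotopy. Backtracking and repetition are the only moves, so this notion does not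
  depend on the edge set of the graph in which the walk is taken.\<close>

definition homot :: "'c list \<Rightarrow> 'c list \<Rightarrow> bool" (infix "\<approx>" 50) where
  "xs \<approx> ys \<longleftrightarrow> nf xs = nf ys"

lemma nf_Nil [simp]: "nf [] = []" by (simp add: nf_def)
lemma nf_Cons: "nf (x # xs) = cpush x (nf xs)" by (simp add: nf_def)
lemma nf_append: "nf (xs @ ys) = foldr cpush xs (nf ys)" by (simp add: nf_def)

lemma cpush_neq_Nil [simp]: "cpush x xs \<noteq> []"
  by (cases xs) auto

lemma hd_cpush [simp]: "hd (cpush x xs) = x"
  by (cases xs) auto

lemma reduced_ConsD: "reduced (x # xs) \<Longrightarrow> reduced xs"
  by (cases xs) auto

lemma reduced_cpush: "reduced xs \<Longrightarrow> reduced (cpush x xs)"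
  by (cases xs) (auto dest: reduced_ConsD)

lemma reduced_nf [simp]: "reduced (nf xs)"
  by (induction xs) (auto simp: nf_Cons reduced_cpush)

lemma cpush_reduced: "reduced (x # xs) \<Longrightarrow> cpush x xs = x # xs"
  by (cases xs) auto

lemma nf_reduced: "reduced xs \<Longrightarrow> nf xs = xs"
proof (induction xs)
  case (Cons x xs)
  then show ?case using reduced_ConsD[OF Cons.prems] by (simp add: nf_Cons cpush_reduced)
qed simp

lemma nf_nf [simp]: "nf (nf xs) = nf xs"
  by (simp add: nf_reduced)

lemma cpush_idem: "cpush x (cpush x r) = cpush x r"
proof -
  obtain t where "cpush x r = x # t" by (metis cpush_neq_Nil hd_cpush list.collapse)
  then show ?thesis by simp
qed

lemma cpush_backtrack: "reduced r \<Longrightarrow> cpush x (cpush y (cpush x r)) = cpush x r"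
proof -
  assume "reduced r"
  then have red: "reduced (cpush x r)" by (rule reduced_cpush)
  obtain t where t: "cpush x r = x # t" by (metis cpush_neq_Nil hd_cpush list.collapse)
  show ?thesis using red unfolding t by (cases t) (auto simp: neq_Nil_conv)
qed

lemma foldr_cpush_reduced: "reduced r \<Longrightarrow> reduced (foldr cpush xs r)"
  by (induction xs) (auto intro: reduced_cpush)

text \<open>Words act on reduced words by pushing, and a cancellation inside the acting word does
  not change the action. This takes the place of a confluence argument: it makes \<open>nf\<close>
  compatible with concatenation.\<close>

lemma foldr_cpush_cpush:
  assumes "reduced r"
  shows "foldr cpush (cpush x zs) r = cpush x (foldr cpush zs r)"
proof (cases zs)
  case Nil
  then show ?thesis by simp
next
  case (Cons y ys)
  show ?thesis
  proof (cases "x \<noteq> y \<and> ys \<noteq> [] \<and> hd ys = x")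
    case True
    then obtain w where "ys = x # w" by (cases ys) auto
    then show ?thesis
      using True Cons foldr_cpush_reduced[OF assms, of w] by (simp add: cpush_backtrack)
  next
    case False
    then show ?thesis using Cons by (auto simp: cpush_idem)
  qed
qed

lemma foldr_cpush_nf: "reduced r \<Longrightarrow> foldr cpush (nf xs) r = foldr cpush xs r"
  by (induction xs) (auto simp: nf_Cons foldr_cpush_cpush)

lemma nf_append_nf_left: "nf (nf xs @ ys) = nf (xs @ ys)"
  by (simp add: nf_append foldr_cpush_nf)

lemma nf_append_nf_right: "nf (xs @ nf ys) = nf (xs @ ys)"
  by (simp add: nf_append)

section \<open>Homotopy as a congruence: reversal and cancellation\<close>

lemma homot_refl [simp]: "xs \<approx> xs" by (simp add: homot_def)
lemma homot_sym: "xs \<approx> ys \<Longrightarrow> ys \<approx> xs" by (simp add: homot_def)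
lemma homot_trans [trans]: "xs \<approx> ys \<Longrightarrow> ys \<approx> zs \<Longrightarrow> xs \<approx> zs" by (simp add: homot_def)
lemma homot_nf: "nf xs \<approx> xs" by (simp add: homot_def)
lemma homot_nf': "xs \<approx> nf xs" by (simp add: homot_def)

lemma homot_append: "xs \<approx> xs' \<Longrightarrow> ys \<approx> ys' \<Longrightarrow> xs @ ys \<approx> xs' @ ys'"
  unfolding homot_def by (metis nf_append_nf_left nf_append_nf_right)

lemma homot_append_left: "ys \<approx> ys' \<Longrightarrow> xs @ ys \<approx> xs @ ys'"
  by (simp add: homot_append)

lemma homot_append_right: "xs \<approx> xs' \<Longrightarrow> xs @ ys \<approx> xs' @ ys"
  by (simp add: homot_append)

lemma homot_Cons: "xs \<approx> ys \<Longrightarrow> x # xs \<approx> x # ys"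
  using homot_append_left[of xs ys "[x]"] by simp

lemma homot_stutter: "x # x # xs \<approx> x # xs"
  by (simp add: homot_def nf_Cons cpush_idem)

lemma homot_backtrack: "x # y # x # xs \<approx> x # xs"
  by (simp add: homot_def nf_Cons cpush_backtrack)

lemma homot_stutter_append: "us @ x # x # xs \<approx> us @ x # xs"
  by (simp add: homot_append_left homot_stutter)

lemma homot_backtrack_append: "us @ x # y # x # xs \<approx> us @ x # xs"
  by (simp add: homot_append_left homot_backtrack)

lemma nf_eq_Nil_iff [simp]: "nf xs = [] \<longleftrightarrow> xs = []"
  by (cases xs) (auto simp: nf_Cons)

lemma hd_nf [simp]: "hd (nf xs) = hd xs"
  by (cases xs) (auto simp: nf_Cons)

lemma last_cpush: "xs \<noteq> [] \<Longrightarrow> last (cpush x xs) = last xs"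
  by (cases xs) auto

lemma last_nf [simp]: "last (nf xs) = last xs"
  by (induction xs) (auto simp: nf_Cons last_cpush)

lemma homot_hd: "xs \<approx> ys \<Longrightarrow> hd xs = hd ys"
  unfolding homot_def by (metis hd_nf)

lemma homot_last: "xs \<approx> ys \<Longrightarrow> last xs = last ys"
  unfolding homot_def by (metis last_nf)

text \<open>Being reduced concerns windows of two and of three vertices, so only the windows across
  the joint are new.\<close>

lemma reduced_append_iff:
  "reduced (xs @ ys) \<longleftrightarrow> reduced xs \<and> reduced ys \<and>
     (xs \<noteq> [] \<and> ys \<noteq> [] \<longrightarrow> last xs \<noteq> hd ys \<and>
        (tl ys \<noteq> [] \<longrightarrow> last xs \<noteq> hd (tl ys)) \<and>
        (butlast xs \<noteq> [] \<longrightarrow> last (butlast xs) \<noteq> hd ys))"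
proof (induction xs rule: reduced.induct)
  case 1
  then show ?case by simp
next
  case (2 x)
  then show ?case by (cases ys) auto
next
  case (3 x y zs)
  then show ?case by (cases zs) auto
qed

lemma reduced_rev_aux: "reduced xs \<Longrightarrow> reduced (rev xs)"
proof (induction xs)
  case (Cons x xs)
  then have "reduced xs" "reduced (rev xs)" by (auto dest: reduced_ConsD)
  with Cons.prems show ?case
    by (cases xs; cases "tl xs") (auto simp: reduced_append_iff butlast_append)
qed simp

lemma reduced_rev [simp]: "reduced (rev xs) \<longleftrightarrow> reduced xs"
  using reduced_rev_aux[of xs] reduced_rev_aux[of "rev xs"] by auto

lemma rev_cpush: "rev (cpush x r) \<approx> rev r @ [x]"
proof (cases r)
  case (Cons y ys)
  show ?thesis
  proof (cases "x = y")
    case True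
    then show ?thesis using Cons homot_stutter_append[of "rev ys" x "[]"]
      by (simp add: homot_sym)
  next
    case False
    show ?thesis
    proof (cases "ys \<noteq> [] \<and> hd ys = x")
      case True
      then obtain w where "ys = x # w" by (cases ys) auto
      then show ?thesis using Cons False homot_backtrack_append[of "rev w" x y "[]"]
        by (simp add: homot_sym)
    qed (use False Cons in auto)
  qed
qed simp

lemma rev_nf_homot: "rev (nf xs) \<approx> rev xs"
proof (induction xs)
  case (Cons x xs)
  have "rev (nf (x # xs)) \<approx> rev (nf xs) @ [x]" by (simp add: nf_Cons rev_cpush)
  also have "rev (nf xs) @ [x] \<approx> rev xs @ [x]" by (rule homot_append_right) (rule Cons)
  finally show ?case by simp
qed simp

lemma nf_rev: "nf (rev xs) = rev (nf xs)"
  using rev_nf_homot[of xs] by (simp add: homot_def nf_reduced)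

lemma homot_rev: "xs \<approx> ys \<Longrightarrow> rev xs \<approx> rev ys"
  by (simp add: homot_def nf_rev)

lemma homot_append_rev: "xs \<noteq> [] \<Longrightarrow> xs @ rev xs \<approx> [hd xs]"
proof (induction xs)
  case (Cons x xs)
  show ?case
  proof (cases "xs = []")
    case True
    then show ?thesis using homot_stutter[of x "[]"] by simp
  next
    case False
    have "(x # xs) @ rev (x # xs) = [x] @ (xs @ rev xs) @ [x]" by simp
    also have "\<dots> \<approx> [x] @ [hd xs] @ [x]"
      using Cons.IH[OF False] by (intro homot_append) auto
    also have "\<dots> \<approx> [x]" using homot_backtrack[of x "hd xs" "[]"] by simp
    finally show ?thesis by simp
  qed
qed simp

lemma homot_rev_append: "xs \<noteq> [] \<Longrightarrow> rev xs @ xs \<approx> [last xs]"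
  using homot_append_rev[of "rev xs"] by (simp add: hd_rev)

lemma homot_hd_Cons: "xs \<noteq> [] \<Longrightarrow> hd xs = x \<Longrightarrow> x # xs \<approx> xs"
  by (cases xs) (auto simp: homot_stutter)

lemma homot_last_snoc: "xs \<noteq> [] \<Longrightarrow> last xs = x \<Longrightarrow> xs @ [x] \<approx> xs"
  using homot_rev[OF homot_hd_Cons[of "rev xs" x]] by (simp add: hd_rev)

text \<open>Walks up to homotopy form a groupoid with \<open>rev\<close> as inverse. The conditions
  on first and last vertices express composability; the vertex doubled at a joint is a
  stutter.\<close>

lemma homot_cancel_left:
  assumes "xs @ ys \<approx> xs @ zs" "xs \<noteq> []" "ys \<noteq> []" "zs \<noteq> []" "hd ys = last xs" "hd zs = last xs"
  shows "ys \<approx> zs"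
proof -
  have *: "vs \<approx> rev xs @ xs @ vs" if "vs \<noteq> []" "hd vs = last xs" for vs
  proof -
    have "vs \<approx> [last xs] @ vs" using homot_hd_Cons[OF that] by (simp add: homot_sym)
    also have "\<dots> \<approx> (rev xs @ xs) @ vs"
      by (rule homot_append_right, rule homot_sym, rule homot_rev_append, fact assms)
    finally show ?thesis by simp
  qed
  have "ys \<approx> rev xs @ xs @ ys" using * assms by simp
  also have "\<dots> \<approx> rev xs @ xs @ zs" using assms(1) by (rule homot_append_left)
  also have "\<dots> \<approx> zs" using * assms by (simp add: homot_sym)
  finally show ?thesis .
qed

lemma homot_cancel_right:
  assumes "ys @ xs \<approx> zs @ xs" "xs \<noteq> []" "ys \<noteq> []" "zs \<noteq> []" "last ys = hd xs" "last zs = hd xs"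
  shows "ys \<approx> zs"
proof -
  have "rev ys \<approx> rev zs"
    using homot_rev[OF assms(1)] assms(2-)
    by (intro homot_cancel_left[of "rev xs" "rev ys" "rev zs"]) (auto simp: hd_rev last_rev)
  from homot_rev[OF this] show ?thesis by simp
qed

text \<open>The vertex that remains of \<open>xs\<close> and its reverse is absorbed by the word in
  front of it. In \<open>homot_cancel_mid'\<close> the word behind absorbs it, which allows
  \<open>us\<close> to be empty.\<close>

lemma homot_cancel_mid:
  assumes "xs \<noteq> []" "us \<noteq> []" "last us = hd xs"
  shows "us @ xs @ rev xs @ vs \<approx> us @ vs"
proof -
  have "us @ (xs @ rev xs) @ vs \<approx> us @ [hd xs] @ vs"
    using assms by (intro homot_append homot_append_rev) auto
  also have "\<dots> = (us @ [hd xs]) @ vs" by simp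
  also have "\<dots> \<approx> us @ vs" using assms by (intro homot_append_right homot_last_snoc) auto
  finally show ?thesis by simp
qed

lemma homot_cancel_mid':
  assumes "xs \<noteq> []" "vs \<noteq> []" "hd vs = hd xs"
  shows "us @ xs @ rev xs @ vs \<approx> us @ vs"
proof -
  have "us @ (xs @ rev xs) @ vs \<approx> us @ [hd xs] @ vs"
    using assms by (intro homot_append homot_append_rev) auto
  also have "\<dots> \<approx> us @ vs"
    using assms homot_hd_Cons[of vs "hd xs"] by (intro homot_append_left) auto
  finally show ?thesis by simp
qed

section \<open>Length, edges and prefixes under reduction\<close>

lemma length_cpush: "length r \<le> length (cpush x r) + 1" "length (cpush x r) \<le> length r + 1"
  by (cases r; auto)+

lemma length_nf_le: "length (nf xs) \<le> length xs"
proof (induction xs)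
  case (Cons x xs)
  then show ?case using length_cpush(2)[of x "nf xs"] by (simp add: nf_Cons)
qed simp

text \<open>One push changes the length by at most one, so a factor cannot shrink a reduced word by
  more than its own length.\<close>

lemma length_nf_append_left: "length (nf ys) \<le> length (nf (xs @ ys)) + length xs"
proof (induction xs)
  case (Cons x xs)
  then show ?case using length_cpush(1)[of "nf (xs @ ys)" x] by (simp add: nf_Cons)
qed simp

lemma length_nf_append_right: "length (nf xs) \<le> length (nf (xs @ ys)) + length ys"
  using length_nf_append_left[of "rev xs" "rev ys"]
  by (simp add: nf_rev flip: rev_append)

lemma successively_nf: "successively R xs \<Longrightarrow> successively R (nf xs)"
proof (induction xs)
  case (Cons x xs)
  show ?case
  proof (cases xs)
    case Nil
    then show ?thesis by (simp add: nf_Cons)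
  next
    case (Cons y ys)
    with Cons.prems Cons.IH have R: "R x y" and IH: "successively R (nf xs)" by auto
    obtain zs where zs: "nf xs = y # zs"
      using Cons hd_nf[of xs] nf_eq_Nil_iff[of xs]
      by (metis hd_Cons_tl list.distinct(1) list.sel(1))
    show ?thesis using R IH unfolding nf_Cons zs by (cases zs) auto
  qed
qed simp

text \<open>Mirror image of \<open>cpush\<close>: a stack in memory grows at its end, so the program
  reduces from left to right. \<open>foldl_pushr\<close> shows that it arrives at the same normal
  form.\<close>

definition pushr :: "'c list \<Rightarrow> 'c \<Rightarrow> 'c list" where
  "pushr xs x = (if xs \<noteq> [] \<and> last xs = x then xs
     else if length xs > 1 \<and> xs ! (length xs - 2) = x then butlast xs else xs @ [x])"

lemma pushr_rev: "pushr (rev xs) x = rev (cpush x xs)"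
  by (cases xs; cases "tl xs") (auto simp: pushr_def nth_append butlast_append)

lemma foldl_pushr: "reduced xs \<Longrightarrow> foldl pushr xs ys = nf (xs @ ys)"
proof (induction ys arbitrary: xs)
  case Nil
  then show ?case by (simp add: nf_reduced)
next
  case (Cons y ys)
  have 1: "pushr xs y = nf (xs @ [y])"
  proof -
    have "pushr xs y = rev (cpush y (nf (rev xs)))"
      using pushr_rev[of "rev xs" y] Cons.prems by (simp add: nf_reduced)
    also have "\<dots> = nf (xs @ [y])" by (metis nf_Cons nf_rev rev.simps(2) rev_rev_ident)
    finally show ?thesis .
  qed
  have "foldl pushr xs (y # ys) = nf (nf (xs @ [y]) @ ys)"
    using Cons.IH[of "nf (xs @ [y])"] 1 by simp
  then show ?case by (simp add: nf_append_nf_left)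
qed

lemma prefix_pushr:
  assumes "p \<noteq> []" "pushr xs x = p @ r"
  shows "p = pushr xs x \<or> (\<exists>r'. xs = p @ r')"
proof (cases "r = []")
  case False
  then have r: "r = butlast r @ [last r]" by simp
  have "pushr xs x = xs \<or> xs = pushr xs x @ [last xs] \<or> pushr xs x = xs @ [x]"
    by (cases "xs = []") (auto simp: pushr_def simp flip: append_butlast_last_id)
  then consider "pushr xs x = xs" | "xs = pushr xs x @ [last xs]" | "pushr xs x = xs @ [x]"
    by blast
  then show ?thesis
  proof cases
    case 3
    then have "(p @ butlast r) @ [last r] = xs @ [x]" using assms(2) r by simp
    then have "xs = p @ butlast r" by simp
    then show ?thesis by blast
  qed (use assms in \<open>metis append_assoc\<close>)+
qed (use assms in auto)

text \<open>Each push alters the stack only at its end and by at most one vertex, so a prefix of the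
  final stack has been the whole stack at some moment. In \<open>conj_form\<close> this locates
  pieces of a reduced power inside the unreduced one.\<close>

lemma prefix_nf:
  assumes "p \<noteq> []" "nf xs = p @ r"
  shows "\<exists>i. 0 < i \<and> i \<le> length xs \<and> p = nf (take i xs)"
  using assms
proof (induction xs arbitrary: r rule: rev_induct)
  case Nil
  then show ?case by simp
next
  case (snoc x xs)
  have "nf (xs @ [x]) = pushr (nf xs) x"
    using foldl_pushr[of "nf xs" "[x]"] by (simp add: nf_append_nf_left)
  with snoc.prems prefix_pushr[of p "nf xs" x r]
  consider "p = nf (xs @ [x])" | r' where "nf xs = p @ r'" by auto
  then show ?case
  proof cases
    case 1
    then show ?thesis by (intro exI[of _ "length (xs @ [x])"]) auto
  next
    case 2
    from snoc.IH[OF snoc.prems(1) this] obtain i where "0 < i" "i \<le> length xs" "p = nf (take i xs)"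
      by blast
    then show ?thesis by (intro exI[of _ i]) auto
  qed
qed

section \<open>Simultaneous conjugacy of loops\<close>

text \<open>In a product of two reduced words, only an end of \<open>X\<close> can cancel against
  the beginning of \<open>Y\<close>. Here \<open>p\<close> is the vertex at which the two walks
  part, and \<open>A @ p # D\<close> is what remains of the product.\<close>

lemma product_split:
  assumes "reduced X" "reduced Y" "X \<noteq> []" "Y \<noteq> []" "last X = hd Y"
  shows "\<exists>A p B D. X = A @ p # B \<and> Y = rev B @ p # D \<and> reduced (A @ p # D)"
  using assms
proof (induction X arbitrary: Y rule: rev_induct)
  case (snoc x X)
  then obtain Y0 where Y: "Y = x # Y0" by (cases Y) auto
  \<comment> \<open>The shared end vertex goes into \<open>B\<close> as long as the vertices next to
    it agree, too.\<close>
  show ?case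
  proof (cases "X \<noteq> [] \<and> Y0 \<noteq> [] \<and> last X = hd Y0")
    case True
    have "reduced X" "reduced Y0"
      using snoc.prems Y reduced_ConsD[of x Y0] by (auto simp: reduced_append_iff)
    from snoc.IH[OF this] True obtain A p B D
      where *: "X = A @ p # B" "Y0 = rev B @ p # D" "reduced (A @ p # D)" by blast
    show ?thesis
      by (rule exI[of _ A], rule exI[of _ p], rule exI[of _ "B @ [x]"], rule exI[of _ D])
         (simp add: * Y)
  next
    case False
    have "reduced (X @ [x])" "reduced (x # Y0)" using snoc.prems Y by auto
    with False have "reduced (X @ x # Y0)"
      by (auto simp: reduced_append_iff)
    then show ?thesis
      by (intro exI[of _ X] exI[of _ x] exI[of _ "[]"] exI[of _ Y0]) (simp add: Y)
  qed
qed simp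

lemma homot_detour: "us @ q # vs @ rev vs @ q # ts \<approx> us @ q # ts"
proof (cases vs)
  case Nil
  then show ?thesis by (simp add: homot_stutter_append)
next
  case (Cons v vs')
  have "(us @ [q]) @ (vs @ rev vs) @ (q # ts) \<approx> (us @ [q]) @ [v] @ (q # ts)"
    using homot_append_rev[of vs] Cons by (intro homot_append) auto
  also have "\<dots> \<approx> us @ q # ts" using homot_backtrack_append[of us q v ts] by simp
  finally show ?thesis by simp
qed

text \<open>The power zero is the empty word and not the trivial loop at the base point of
  \<open>w\<close>, whence the separate treatment of exponent zero below.\<close>

definition wpow :: "'c list \<Rightarrow> nat \<Rightarrow> 'c list" where
  "wpow w m = concat (replicate m w)"

lemma wpow_0 [simp]: "wpow w 0 = []" by (simp add: wpow_def)
lemma wpow_Suc: "wpow w (Suc m) = w @ wpow w m" by (simp add: wpow_def)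
lemma wpow_add: "wpow w (m + k) = wpow w m @ wpow w k"
  by (simp add: wpow_def replicate_add)
lemma wpow_Suc_right: "wpow w (Suc m) = wpow w m @ w"
  using wpow_add[of w m 1] by (simp add: wpow_Suc)
lemma length_wpow [simp]: "length (wpow w m) = m * length w"
  by (induction m) (auto simp: wpow_Suc)
lemma rev_wpow: "rev (wpow w m) = wpow (rev w) m"
  by (induction m) (simp_all add: wpow_Suc wpow_Suc_right flip: wpow_Suc)
lemma wpow_eq_Nil_iff [simp]: "wpow w m = [] \<longleftrightarrow> m = 0 \<or> w = []"
  by (induction m) (auto simp: wpow_Suc)
lemma hd_wpow: "w \<noteq> [] \<Longrightarrow> 0 < m \<Longrightarrow> hd (wpow w m) = hd w"
  by (cases m) (auto simp: wpow_Suc)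
lemma last_wpow: "w \<noteq> [] \<Longrightarrow> 0 < m \<Longrightarrow> last (wpow w m) = last w"
  by (cases m) (auto simp: wpow_Suc_right simp flip: wpow_Suc)

text \<open>The last copy of \<open>w\<close> is cut so that a non-empty piece remains
  (\<open>i\<close> may be \<open>length w\<close> but not zero); the piece then has a last vertex
  at which two walks can meet.\<close>

lemma take_wpow:
  assumes "0 < r" "r \<le> length (wpow w m)"
  shows "\<exists>k i. 0 < i \<and> i \<le> length w \<and> take r (wpow w m) = wpow w k @ take i w"
  using assms
proof (induction m arbitrary: r)
  case (Suc m)
  show ?case
  proof (cases "r \<le> length w")
    case True
    then show ?thesis using Suc.prems
      by (intro exI[of _ 0] exI[of _ r]) (auto simp: wpow_Suc)
  next
    case False
    have "0 < r - length w" "r - length w \<le> length (wpow w m)"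
      using False Suc.prems by auto
    from Suc.IH[OF this] obtain k i where "0 < i" "i \<le> length w"
      "take (r - length w) (wpow w m) = wpow w k @ take i w"
      by blast
    then show ?thesis using False
      by (intro exI[of _ "Suc k"] exI[of _ i]) (auto simp: wpow_Suc)
  qed
qed simp

section \<open>Cyclic reduction of loops\<close>

definition loop_at :: "'c \<Rightarrow> 'c list \<Rightarrow> bool" where
  "loop_at x w \<longleftrightarrow> w \<noteq> [] \<and> hd w = x \<and> last w = x"

lemma loop_at_rev [simp]: "loop_at x (rev w) \<longleftrightarrow> loop_at x w"
  by (auto simp: loop_at_def hd_rev last_rev)

text \<open>If the second vertex equals the last but one, the loop starts and ends with the same
  edge in opposite directions. Moving this edge to the tail \<open>L\<close> leaves a shorter loop,
  until the core \<open>c\<close> is cyclically reduced. The \<open>+ 2\<close> counts the vertices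
  that the core shares with the two copies of the tail.\<close>

lemma closed_decomp:
  assumes "reduced w" "loop_at x w" "w \<noteq> [x]"
  shows "\<exists>L c. w \<approx> L @ c @ rev L \<and> L \<noteq> [] \<and> hd L = x \<and> reduced c \<and> loop_at (last L) c \<and>
     length c > 2 \<and> c ! 1 \<noteq> c ! (length c - 2) \<and> 2 * length L + length c = length w + 2"
  using assms
proof (induction "length w" arbitrary: w x rule: less_induct)
  case less
  then obtain w1 where w1: "w = x # w1" "w1 \<noteq> []" "last w1 = x"
    by (cases w) (auto simp: loop_at_def split: if_splits)
  then obtain v where v: "w = x # v @ [x]" by (metis append_butlast_last_id)
  have vne: "v \<noteq> []" using v less.prems by (intro notI) auto
  show ?case
  proof (cases "hd v = last v")
    case False
    have "w \<approx> [x] @ w @ rev [x]"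
      using homot_hd_Cons[of "w @ [x]" x] homot_last_snoc[of w x] less.prems
      by (auto simp: loop_at_def v) (meson homot_sym homot_trans)
    moreover have "w ! 1 = hd v" using v vne by (simp add: hd_conv_nth nth_append)
    moreover have "w ! (length w - 2) = last v"
      using v vne by (cases v rule: rev_cases) (auto simp: nth_append)
    ultimately show ?thesis using less.prems False vne v
      by (intro exI[of _ "[x]"] exI[of _ w]) auto
  next
    case True
    have red: "reduced v"
      using less.prems(1) v by (auto simp: reduced_append_iff dest: reduced_ConsD)
    have "v \<noteq> [hd v]"
    proof
      assume "v = [hd v]"
      then have "w = [x, hd v, x]" using v by simp
      with less.prems(1) show False by simp
    qed
    from less.hyps[OF _ red _ this] True vne v obtain L c where Lc:
      "v \<approx> L @ c @ rev L" "L \<noteq> []" "hd L = hd v" "reduced c" "loop_at (last L) c"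
      "length c > 2" "c ! 1 \<noteq> c ! (length c - 2)" "2 * length L + length c = length v + 2"
      by (auto simp: loop_at_def)
    have "w \<approx> [x] @ (L @ c @ rev L) @ [x]"
      unfolding v using homot_Cons[OF homot_append_right[OF Lc(1), of "[x]"], of x] by simp
    then show ?thesis using Lc v
      by (intro exI[of _ "x # L"] exI[of _ c]) auto
  qed
qed

lemma reduced_nth: "reduced xs \<Longrightarrow> Suc i < length xs \<Longrightarrow> xs ! i \<noteq> xs ! Suc i"
proof (induction xs arbitrary: i rule: reduced.induct)
  case (3 x y zs)
  then show ?case by (cases i) auto
qed auto

lemma reduced_nth2: "reduced xs \<Longrightarrow> Suc (Suc i) < length xs \<Longrightarrow> xs ! i \<noteq> xs ! Suc (Suc i)"
proof (induction xs arbitrary: i rule: reduced.induct)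
  case (3 x y zs)
  then show ?case by (cases i) (auto simp: hd_conv_nth)
qed auto

lemma reduced_map_upt:
  assumes "\<And>i. z i \<noteq> z (Suc i)" "\<And>i. z i \<noteq> z (Suc (Suc i))"
  shows "reduced (map z [a..<b])"
proof (induction "b - a" arbitrary: a)
  case (Suc m)
  then have IH: "reduced (map z [Suc a..<b])" and ab: "a < b" by auto
  show ?case
  proof (cases "Suc a < b")
    case True
    then show ?thesis using IH ab assms(1) assms(2)[of a, symmetric]
      by (cases "Suc (Suc a) < b") (simp_all add: upt_conv_Cons)
  qed (use ab in \<open>simp add: upt_conv_Cons\<close>)
qed simp

text \<open>By \<open>turn\<close> the loop does not backtrack at its base point either, so running
  around it for ever gives a reduced periodic ray \<open>z\<close>.\<close>

locale cyclic_word =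
  fixes c :: "'c list"
  assumes len: "2 < length c" and red: "reduced c" and closed: "hd c = last c"
    and turn: "c ! 1 \<noteq> c ! (length c - 2)"
begin

text \<open>The period: the last vertex of \<open>c\<close> repeats the first.\<close>

definition "d = length c - 1"

definition z :: "nat \<Rightarrow> 'c" where "z i = c ! (i mod d)"

definition seg :: "nat \<Rightarrow> nat \<Rightarrow> 'c list" where "seg a b = map z [a..<Suc b]"

lemma d_gt: "1 < d" using len by (simp add: d_def)

lemma ends: "c ! d = c ! 0"
  using closed len last_conv_nth[of c] hd_conv_nth[of c] by (cases "c = []") (auto simp: d_def)

lemma z_le: "i \<le> d \<Longrightarrow> z i = c ! i"
  using ends by (cases "i = d") (auto simp: z_def)

lemma z_periodic: "z (i + d) = z i" by (simp add: z_def)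

lemma z_mod: "z (i mod d + j) = z (i + j)"
  by (simp add: z_def mod_simps)

lemma z_neq: "z i \<noteq> z (Suc i)" "z i \<noteq> z (Suc (Suc i))"
proof -
  let ?r = "i mod d"
  have r: "?r < d" using d_gt by simp
  have z0: "z i = c ! ?r" by (simp add: z_def)
  have z1: "z (Suc i) = c ! Suc ?r" using z_mod[of i 1] z_le[of "Suc ?r"] r by simp
  show "z i \<noteq> z (Suc i)"
    using reduced_nth[OF red, of ?r] r z0 z1 by (simp add: d_def)
  show "z i \<noteq> z (Suc (Suc i))"
  proof (cases "Suc ?r < d")
    case True
    then have "z (Suc (Suc i)) = c ! Suc (Suc ?r)"
      using z_mod[of i 2] z_le[of "Suc (Suc ?r)"] by simp
    then show ?thesis using reduced_nth2[OF red, of ?r] True z0 by (simp add: d_def)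
  next
    case False
    \<comment> \<open>The window of three vertices passes the base point; this is the case covered
      by \<open>turn\<close>.\<close>
    with r have rd: "?r = d - 1" by simp
    have "z (Suc (Suc i)) = z (1 + d)"
      using z_mod[of i 2] rd d_gt by (simp add: numeral_2_eq_2)
    then have "z (Suc (Suc i)) = c ! 1" using z_periodic[of 1] z_le[of 1] d_gt by simp
    moreover have "z i = c ! (length c - 2)" using z0 rd len by (simp add: d_def numeral_2_eq_2)
    ultimately show ?thesis using turn by simp
  qed
qed

lemma reduced_z: "reduced (map z [a..<b])"
  by (rule reduced_map_upt) (rule z_neq)+

lemma seg_not_Nil [simp]: "a \<le> b \<Longrightarrow> seg a b \<noteq> []" by (simp add: seg_def)

lemma hd_seg: "a \<le> b \<Longrightarrow> hd (seg a b) = z a"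
  by (simp add: seg_def upt_conv_Cons del: upt_Suc)

lemma last_seg: "a \<le> b \<Longrightarrow> last (seg a b) = z b"
  by (simp add: seg_def)

lemma seg_append:
  assumes "a \<le> b" "b \<le> e"
  shows "seg a b @ seg b e \<approx> seg a e"
proof -
  have "seg a b = map z [a..<b] @ [z b]" using assms by (simp add: seg_def)
  moreover have "seg b e = z b # map z [Suc b..<Suc e]"
    using assms by (simp add: seg_def upt_conv_Cons del: upt_Suc)
  moreover have "[a..<Suc e] = [a..<b] @ b # [Suc b..<Suc e]"
    using assms upt_add_eq_append[of a b "Suc e - b"] by (simp add: upt_conv_Cons del: upt_Suc)
  ultimately show ?thesis
    by (simp add: seg_def homot_stutter_append del: upt_Suc)
qed

lemma seg_shift:
  assumes "\<And>i. i \<le> m \<Longrightarrow> z (a + i) = z (b + i)"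
  shows "seg a (a + m) = seg b (b + m)"
  unfolding seg_def using assms by (intro nth_equalityI) (auto simp del: upt_Suc)

lemma seg_periodic: "seg (d + a) (d + b) = seg a b"
  unfolding seg_def
  by (intro nth_equalityI) (auto simp del: upt_Suc simp: z_def mod_simps add.assoc)

lemma c_seg: "c = seg 0 d"
  unfolding seg_def
  by (intro nth_equalityI) (use len z_le in \<open>auto simp del: upt_Suc simp: d_def\<close>)

lemma wpow_c: "0 < t \<Longrightarrow> wpow c t \<approx> seg 0 (t * d)"
proof (induction t)
  case (Suc t)
  show ?case
  proof (cases "t = 0")
    case True
    then show ?thesis using c_seg by (simp add: wpow_Suc)
  next
    case False
    have "wpow c (Suc t) = c @ wpow c t" by (rule wpow_Suc)
    also have "\<dots> \<approx> c @ seg 0 (t * d)" using Suc False by (intro homot_append_left) auto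
    also have "\<dots> = seg 0 d @ seg d (d + t * d)"
      using seg_periodic[of 0 "t * d"] c_seg by simp
    also have "\<dots> \<approx> seg 0 (Suc t * d)" using seg_append[of 0 d "d + t * d"] by simp
    finally show ?thesis .
  qed
qed simp

text \<open>If conjugating \<open>g\<close> by a long power of \<open>c\<close> gives a short word, then \<open>g\<close> maps a long part of
  the periodic ray \<open>z\<close> to itself with a shift, which forces \<open>g\<close> to commute with \<open>c\<close>.\<close>

lemma commute_core:
  assumes g: "reduced g" "loop_at (z 0) g"
    and short: "length (nf (rev (seg 0 N) @ g @ seg 0 N)) \<le> K"
    and N: "K + length g + d \<le> N"
  shows "c @ g \<approx> g @ c"
proof -
  have redN: "reduced (seg 0 N)" by (simp add: seg_def reduced_z del: upt_Suc)
  have lenN: "length (seg 0 N) = Suc N" by (simp add: seg_def)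
  have nthN: "seg 0 N ! i = z i" if "i \<le> N" for i
    using that by (simp add: seg_def nth_append del: upt_Suc)
  \<comment> \<open>\<open>g\<close> cancels the first \<open>s\<close> steps of the ray and keeps
    \<open>l\<close> steps of its own. So the reduced form \<open>Y\<close> of \<open>g\<close>
    followed by the ray runs along \<open>A\<close> and continues with the ray from position
    \<open>s\<close>.\<close>
  from product_split[OF g(1) redN] g(2) obtain A p B D where 1:
    "g = A @ p # B" "seg 0 N = rev B @ p # D" "reduced (A @ p # D)"
    by (auto simp: loop_at_def hd_seg)
  define s l where "s = length B" and "l = length A"
  have sN: "s \<le> N" and lg: "length g = l + s + 1" and lenD: "length D = N - s"
    using arg_cong[OF 1(2), of length] 1(1) lenN by (auto simp: s_def l_def)
  have p: "p = z s" using nthN[of s] sN 1(2) by (simp add: nth_append s_def)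
  have revB: "rev B = map z [0..<s]"
  proof (rule nth_equalityI)
    show "length (rev B) = length (map z [0..<s])" by (simp add: s_def)
    fix i assume i: "i < length (rev B)"
    then have "(rev B @ p # D) ! i = z i" using nthN[of i] sN 1(2) by (simp add: s_def)
    then show "rev B ! i = map z [0..<s] ! i" using i by (simp add: nth_append s_def)
  qed
  have pD: "(p # D) ! i = z (s + i)" if "s + i \<le> N" for i
    using nthN[OF that] 1(2) by (simp add: nth_append s_def)
  define Y where "Y = A @ p # D"
  have Y: "Y \<approx> g @ seg 0 N"
  proof -
    have "g @ seg 0 N = A @ p # B @ rev B @ p # D" using 1 by simp
    also have "\<dots> \<approx> A @ p # D" by (rule homot_detour)
    finally show ?thesis by (simp add: Y_def homot_sym)
  qed
  have Yne: "Y \<noteq> []" and redY: "reduced Y" using 1(3) by (auto simp: Y_def)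
  have hdY: "hd Y = z 0"
    using homot_hd[OF Y] g(2) by (simp add: loop_at_def)
  from product_split[of "rev (seg 0 N)" Y] redN redY Yne hdY obtain A2 q B2 D2 where 2:
    "rev (seg 0 N) = A2 @ q # B2" "Y = rev B2 @ q # D2" "reduced (A2 @ q # D2)"
    by (auto simp: last_rev hd_seg)
  have "rev (seg 0 N) @ g @ seg 0 N \<approx> rev (seg 0 N) @ Y"
    by (rule homot_append_left) (rule homot_sym, fact Y)
  also have "\<dots> = A2 @ q # B2 @ rev B2 @ q # D2" using 2 by simp
  also have "\<dots> \<approx> A2 @ q # D2" by (rule homot_detour)
  finally have "nf (rev (seg 0 N) @ g @ seg 0 N) = A2 @ q # D2"
    using 2(3) by (simp add: homot_def nf_reduced)
  \<comment> \<open>The conjugate is short, so almost all of the reversed ray cancels against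
    \<open>Y\<close>. Hence \<open>Y\<close> coincides with the ray up to a position
    \<open>e\<close> that is at least \<open>l + d\<close>.\<close>
  with short have lenA2: "length A2 < K" by simp
  define e where "e = length B2"
  have segN2: "seg 0 N = rev B2 @ q # rev A2" using arg_cong[OF 2(1), of rev] by simp
  then have eN: "N = e + length A2" using lenN by (simp add: e_def)
  have eY: "Y ! i = z i" if "i \<le> e" for i
  proof -
    have "Y ! i = (rev B2 @ [q]) ! i" using that 2(2) by (auto simp: nth_append e_def)
    also have "\<dots> = seg 0 N ! i" using that segN2 by (auto simp: nth_append e_def)
    finally show ?thesis using nthN[of i] that eN by simp
  qed
  have le: "l + d \<le> e" using N lenA2 eN lg by simp
  have eLen: "e < length Y" using 2(2) by (simp add: e_def)
  have A: "A = map z [0..<l]"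
  proof (rule nth_equalityI)
    fix i assume "i < length A"
    then show "A ! i = map z [0..<l] ! i"
      using eY[of i] le by (simp add: l_def Y_def nth_append)
  qed (simp add: l_def)
  \<comment> \<open>Position \<open>l + j\<close> of \<open>Y\<close> is read in two ways: it shows
    the ray itself, and also the ray continued from \<open>s\<close>.\<close>
  have shift: "z (l + j) = z (s + j)" if "j \<le> d" for j
  proof -
    have "l + j < length Y" using le eLen that by simp
    then have "s + j \<le> N" using lenD sN by (simp add: Y_def l_def)
    then have "Y ! (l + j) = z (s + j)" using pD by (simp add: Y_def l_def nth_append)
    then show ?thesis using eY[of "l + j"] le that by simp
  qed
  have zsl: "z s = z l" using shift[of 0] by simp
  have g_eq: "g \<approx> seg 0 l @ rev (seg 0 s)"
  proof -
    have "B = rev (map z [0..<s])" using revB by (metis rev_rev_ident)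
    then have "g = map z [0..<l] @ z l # rev (map z [0..<s])" using 1(1) A p zsl by simp
    then show ?thesis using zsl by (simp add: seg_def homot_stutter_append homot_sym)
  qed
  \<comment> \<open>Appending \<open>seg 0 s\<close> cancels the second half of \<open>g\<close>.
    Both products then become the first \<open>d + l\<close> steps of the ray, the product
    \<open>g @ c\<close> by the shift property.\<close>
  have "(c @ g) @ seg 0 s \<approx> c @ (seg 0 l @ rev (seg 0 s)) @ seg 0 s"
    using homot_append_left[OF homot_append_right[OF g_eq, of "seg 0 s"], of c] by simp
  also have "\<dots> = c @ seg 0 l @ rev (seg 0 s) @ rev (rev (seg 0 s)) @ []" by simp
  also have "\<dots> \<approx> c @ seg 0 l @ []"
    using homot_cancel_mid[of "rev (seg 0 s)" "c @ seg 0 l" "[]"] zsl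
    by (simp add: last_seg hd_rev)
  also have "\<dots> = seg 0 d @ seg d (d + l)" using c_seg seg_periodic[of 0 l] by simp
  also have "\<dots> \<approx> seg 0 (d + l)" by (rule seg_append) auto
  finally have L: "(c @ g) @ seg 0 s \<approx> seg 0 (d + l)" .
  have "(g @ c) @ seg 0 s = g @ seg 0 d @ seg d (d + s)"
    using c_seg seg_periodic[of 0 s] by simp
  also have "\<dots> \<approx> (seg 0 l @ rev (seg 0 s)) @ seg 0 (d + s)"
    using g_eq seg_append[of 0 d "d + s"] by (intro homot_append) auto
  also have "\<dots> \<approx> (seg 0 l @ rev (seg 0 s)) @ seg 0 s @ seg s (s + d)"
    using seg_append[of 0 s "s + d"] by (intro homot_append_left) (simp add: homot_sym add.commute)
  also have "\<dots> = seg 0 l @ rev (seg 0 s) @ rev (rev (seg 0 s)) @ seg s (s + d)" by simp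
  also have "\<dots> \<approx> seg 0 l @ seg s (s + d)"
    by (rule homot_cancel_mid) (auto simp: last_seg hd_rev zsl)
  also have "seg s (s + d) = seg l (l + d)" by (rule seg_shift) (simp add: shift)
  also have "seg 0 l @ seg l (l + d) \<approx> seg 0 (d + l)"
    using seg_append[of 0 l "l + d"] by (simp add: add.commute)
  finally have R: "(g @ c) @ seg 0 s \<approx> seg 0 (d + l)" .
  have c0: "hd c = z 0" "last c = z 0" "c \<noteq> []"
    using c_seg hd_seg[of 0 d] closed len by auto
  show ?thesis
  proof (rule homot_cancel_right)
    show "(c @ g) @ seg 0 s \<approx> (g @ c) @ seg 0 s"
      using L homot_sym[OF R] by (rule homot_trans)
  qed (use g c0 in \<open>auto simp: loop_at_def hd_seg\<close>)
qed

end

lemma wpow_conj: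
  assumes "w \<approx> L @ c @ rev L" "L \<noteq> []" "loop_at (last L) c" "0 < t"
  shows "wpow w t \<approx> L @ wpow c t @ rev L"
  using \<open>0 < t\<close>
proof (induction t)
  case (Suc t)
  show ?case
  proof (cases "t = 0")
    case False
    have "wpow w (Suc t) \<approx> (L @ c @ rev L) @ L @ wpow c t @ rev L"
      using Suc.IH False assms(1) by (auto simp only: wpow_Suc intro: homot_append)
    also have "\<dots> = (L @ c) @ rev L @ rev (rev L) @ wpow c t @ rev L" by simp
    also have "\<dots> \<approx> (L @ c) @ wpow c t @ rev L"
      using assms by (intro homot_cancel_mid) (auto simp: loop_at_def hd_rev)
    finally show ?thesis by (simp add: wpow_Suc)
  qed (use assms in \<open>simp add: wpow_Suc\<close>)
qed simp

lemma decomp_cyclic: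
  assumes "loop_at x w" "nf w \<noteq> [x]"
  obtains L c where "w \<approx> L @ c @ rev L" "L \<noteq> []" "hd L = x" "loop_at (last L) c" "cyclic_word c"
    "2 * length L + length c \<le> length w + 2"
proof -
  have "loop_at x (nf w)" using assms(1) by (auto simp: loop_at_def)
  from closed_decomp[OF reduced_nf this assms(2)] obtain L c where *:
     "nf w \<approx> L @ c @ rev L" "L \<noteq> []" "hd L = x" "reduced c" "loop_at (last L) c"
     "length c > 2" "c ! 1 \<noteq> c ! (length c - 2)" "2 * length L + length c = length (nf w) + 2"
    by blast
  show ?thesis
  proof (rule that)
    show "w \<approx> L @ c @ rev L" using homot_nf' *(1) by (rule homot_trans)
    show "cyclic_word c" using * by unfold_locales (auto simp: loop_at_def)
    show "2 * length L + length c \<le> length w + 2" using * length_nf_le[of w] by simp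
  qed (use * in auto)
qed

text \<open>Powers of the cyclically reduced core do not cancel and so grow linearly; the two tails
  can shorten them only by a constant.\<close>

lemma length_nf_wpow:
  assumes "loop_at x w" "nf w \<noteq> [x]"
  shows "t \<le> length (nf (wpow w t)) + length w + 2"
proof (cases "t = 0")
  case False
  obtain L c where *: "w \<approx> L @ c @ rev L" "L \<noteq> []" "loop_at (last L) c" "cyclic_word c"
    "2 * length L + length c \<le> length w + 2"
    using decomp_cyclic[OF assms] by metis
  interpret cyclic_word c by fact
  have "t \<le> t * d" using d_gt by simp
  moreover have "nf (wpow c t) = seg 0 (t * d)"
    using wpow_c[of t] False by (simp add: homot_def nf_reduced seg_def reduced_z del: upt_Suc)
  then have "length (nf (wpow c t)) = t * d + 1" by (simp add: seg_def)
  moreover have "length (nf (wpow w t)) = length (nf (L @ wpow c t @ rev L))"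
    using wpow_conj[OF *(1-3)] False by (simp add: homot_def)
  ultimately show ?thesis
    using length_nf_append_left[of "wpow c t @ rev L" L] length_nf_append_right[of "wpow c t" "rev L"] *(5)
    unfolding length_rev by linarith
qed simp

text \<open>\<open>g2\<close> is \<open>g\<close> seen from the base point of the core, where
  \<open>commute_core\<close> applies. The term \<open>2 * length w + 4\<close> pays for the period
  and for four copies of the tail: two in \<open>g2\<close> and two around the conjugated
  word.\<close>

lemma commute_of_short:
  assumes w: "loop_at x w" "nf w \<noteq> [x]" and g: "loop_at x g"
    and short: "length (nf (rev (wpow w t) @ g @ wpow w t)) \<le> K"
    and t: "K + length g + 2 * length w + 4 \<le> t"
  shows "w @ g \<approx> g @ w"
proof -
  obtain L c where *: "w \<approx> L @ c @ rev L" "L \<noteq> []" "hd L = x" "loop_at (last L) c" "cyclic_word c"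
    "2 * length L + length c \<le> length w + 2"
    using decomp_cyclic[OF w] by metis
  interpret cyclic_word c by fact
  define N where "N = t * d"
  have tN: "t * 1 \<le> N" unfolding N_def using d_gt by (intro mult_le_mono) auto
  define g2 where "g2 = nf (rev L @ g @ L)"
  have g2: "g2 \<approx> rev L @ g @ L" unfolding g2_def by (rule homot_nf)
  have z0: "z 0 = last L" using z_le[of 0] *(4) len by (metis (no_types) hd_conv_nth loop_at_def zero_le)
  have loop2: "loop_at (z 0) g2"
    using g * by (auto simp: loop_at_def g2_def z0 hd_append hd_rev last_append)
  have len2: "length g2 \<le> length g + 2 * length L"
    unfolding g2_def using length_nf_le[of "rev L @ g @ L"] by simp
  have pw: "wpow w t \<approx> L @ seg 0 N @ rev L"
  proof -
    have "wpow w t \<approx> L @ wpow c t @ rev L" using * t by (intro wpow_conj) auto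
    also have "\<dots> \<approx> L @ seg 0 N @ rev L"
      unfolding N_def using t by (intro homot_append_left homot_append_right wpow_c) auto
    finally show ?thesis .
  qed
  have zN: "z N = z 0" by (simp add: z_def N_def)
  have "L @ (rev (seg 0 N) @ g2 @ seg 0 N) @ rev L \<approx>
      L @ (rev (seg 0 N) @ (rev L @ g @ L) @ seg 0 N) @ rev L"
    using g2 by (intro homot_append) auto
  also have "\<dots> = rev (L @ seg 0 N @ rev L) @ g @ (L @ seg 0 N @ rev L)" by simp
  also have "\<dots> \<approx> rev (wpow w t) @ g @ wpow w t"
    by (intro homot_append homot_rev homot_refl homot_sym[OF pw])
  finally have "length (nf (L @ (rev (seg 0 N) @ g2 @ seg 0 N) @ rev L)) \<le> K"
    using short by (simp add: homot_def)
  then have "length (nf (rev (seg 0 N) @ g2 @ seg 0 N)) \<le> K + 2 * length L"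
    using length_nf_append_left[of "(rev (seg 0 N) @ g2 @ seg 0 N) @ rev L" L]
      length_nf_append_right[of "rev (seg 0 N) @ g2 @ seg 0 N" "rev L"]
    by simp
  then have comm: "c @ g2 \<approx> g2 @ c"
    using len2 t *(6) tN len
    by (intro commute_core[where N = N and K = "K + 2 * length L"] loop2) (auto simp: g2_def d_def)
  have L2: "us @ L @ rev L @ vs \<approx> us @ vs" if "us \<noteq> []" "last us = x" for us vs
    using that * by (intro homot_cancel_mid) auto
  have L3: "us @ L @ rev L @ vs \<approx> us @ vs" if "vs \<noteq> []" "hd vs = x" for us vs
    using that * by (intro homot_cancel_mid') auto
  have "w @ g \<approx> (L @ c @ rev L) @ g"
    using *(1) by (rule homot_append_right)
  also have "\<dots> \<approx> ((L @ c @ rev L) @ g) @ L @ rev L @ []"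
    using L2[of "(L @ c @ rev L) @ g" "[]"] g by (simp add: homot_sym loop_at_def)
  also have "\<dots> = (L @ c) @ (rev L @ g @ L) @ rev L" by simp
  also have "\<dots> \<approx> (L @ c) @ g2 @ rev L"
    by (intro homot_append homot_refl homot_sym[OF g2])
  also have "\<dots> = L @ (c @ g2) @ rev L" by simp
  also have "\<dots> \<approx> L @ (g2 @ c) @ rev L" by (intro homot_append_left homot_append_right comm)
  also have "\<dots> \<approx> L @ ((rev L @ g @ L) @ c) @ rev L" using g2 by (intro homot_append) auto
  also have "\<dots> = [] @ L @ rev L @ (g @ L @ c @ rev L)" by simp
  also have "\<dots> \<approx> [] @ (g @ L @ c @ rev L)" using g by (intro L3) (auto simp: loop_at_def)
  also have "\<dots> \<approx> g @ w"
    using *(1) homot_append_left homot_sym by fastforce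
  finally show ?thesis .
qed

section \<open>The shape of a conjugating walk\<close>

lemma conj_rev:
  assumes "loop_at x w" "loop_at y w'" "R \<noteq> []" "hd R = x" "last R = y" "w @ R \<approx> R @ w'"
  shows "rev w @ R \<approx> R @ rev w'"
proof -
  have "rev w @ R \<approx> (rev w @ R) @ w' @ rev w' @ []"
    using homot_cancel_mid[of w' "rev w @ R" "[]"] assms by (simp add: loop_at_def homot_sym)
  also have "\<dots> = rev w @ (R @ w') @ rev w'" by simp
  also have "\<dots> \<approx> rev w @ (w @ R) @ rev w'"
    by (intro homot_append homot_refl homot_sym[OF assms(6)])
  also have "\<dots> = [] @ rev w @ rev (rev w) @ (R @ rev w')" by simp
  also have "\<dots> \<approx> [] @ (R @ rev w')"
    using assms by (intro homot_cancel_mid') (auto simp: loop_at_def hd_rev)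
  finally show ?thesis by simp
qed

lemma conj_wpow:
  assumes "w @ R \<approx> R @ w'"
  shows "wpow w t @ R \<approx> R @ wpow w' t"
proof (induction t)
  case (Suc t)
  have "wpow w (Suc t) @ R = w @ (wpow w t @ R)" by (simp add: wpow_Suc)
  also have "\<dots> \<approx> w @ (R @ wpow w' t)" using Suc by (rule homot_append_left)
  also have "\<dots> = (w @ R) @ wpow w' t" by simp
  also have "\<dots> \<approx> (R @ w') @ wpow w' t" using assms by (rule homot_append_right)
  finally show ?case by (simp add: wpow_Suc)
qed simp

text \<open>Compare the normal forms of \<open>w^m Q\<close> and \<open>Q w'^m\<close> for large
  \<open>m\<close>. The part of \<open>Q\<close> that survives in front of \<open>w'^m\<close> is
  also a beginning of the reduced \<open>w^m\<close>; the part that cancels is, reversed, a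
  beginning of the reduced \<open>w'^m\<close>. By \<open>prefix_nf\<close> both are homotopic to
  full copies followed by one partial copy.\<close>

lemma conj_form:
  assumes w: "loop_at x w" "nf w \<noteq> [x]" and w': "loop_at y w'"
    and Q: "Q \<noteq> []" "hd Q = x" "last Q = y" and conj: "w @ Q \<approx> Q @ w'"
  obtains k l i j where "0 < i" "i \<le> length w" "0 < j" "j \<le> length w'"
    "last (take i w) = last (take j w')"
    "Q \<approx> wpow w k @ take i w @ rev (take j w') @ wpow (rev w') l"
proof -
  define X where "X = nf Q"
  \<comment> \<open>With this \<open>m\<close> the normal form of the power is at least twice as
    long as \<open>X\<close>: fewer than \<open>length X\<close> of its vertices cancel, and what
    remains covers \<open>A @ [p]\<close>.\<close>
  define m where "m = 2 * length X + length w + 2"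
  define G Y where "G = nf (wpow w m)" and "Y = nf (wpow w' m)"
  have m: "0 < m" by (simp add: m_def)
  have lenG: "2 * length X \<le> length G"
    using length_nf_wpow[OF w, of m] by (simp add: G_def m_def)
  have ne: "w \<noteq> []" "w' \<noteq> []" using w w' by (auto simp: loop_at_def)
  have G0: "G \<noteq> []" "last G = x" and Y0: "Y \<noteq> []" "hd Y = y"
    and X0: "X \<noteq> []" "hd X = x" "last X = y"
    using m ne w w' Q by (auto simp: G_def Y_def X_def hd_wpow last_wpow loop_at_def)
  from product_split[of X Y] X0 Y0 obtain A p B D where 1:
    "X = A @ p # B" "Y = rev B @ p # D" "reduced (A @ p # D)"
    by (auto simp: X_def Y_def)
  from product_split[of G X] X0 G0 obtain A' p' B' D' where 2:
    "G = A' @ p' # B'" "X = rev B' @ p' # D'" "reduced (A' @ p' # D')"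
    by (auto simp: X_def G_def)
  have split: "nf (us @ q # vs @ rev vs @ q # ts) = us @ q # ts"
    if "reduced (us @ q # ts)" for us vs ts :: "'a list" and q
    using homot_detour[of us q vs ts] that by (simp add: homot_def nf_reduced)
  have "wpow w m @ Q \<approx> Q @ wpow w' m" using conj by (rule conj_wpow)
  then have "nf (G @ X) = nf (X @ Y)"
    by (simp add: homot_def G_def X_def Y_def nf_append_nf_left nf_append_nf_right)
  moreover have "nf (X @ Y) = A @ p # D" using split[OF 1(3), of B] 1 by simp
  moreover have "nf (G @ X) = A' @ p' # D'" using split[OF 2(3), of B'] 2 by simp
  ultimately have eq: "A @ p # D = A' @ p' # D'" by simp
  have "length G = length A' + 1 + length B'" "length B' < length X" "length A < length X"
    using 1(1) 2(1) arg_cong[OF 2(2), of length] by simp_all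
  then have "length (A @ [p]) \<le> length A'" using lenG by simp
  moreover have "(A @ [p]) @ D = A' @ (p' # D')" using eq by simp
  ultimately obtain E where "A' = (A @ [p]) @ E"
    by (metis append_eq_append_conv_if append_take_drop_id)
  then have "G = (A @ [p]) @ (E @ p' # B')" using 2(1) by simp
  then obtain r where r: "0 < r" "r \<le> length (wpow w m)" "A @ [p] = nf (take r (wpow w m))"
    using prefix_nf[of "A @ [p]" "wpow w m"] by (auto simp: G_def)
  have "Y = (rev B @ [p]) @ D" using 1(2) by simp
  then obtain r' where r': "0 < r'" "r' \<le> length (wpow w' m)" "rev B @ [p] = nf (take r' (wpow w' m))"
    using prefix_nf[of "rev B @ [p]" "wpow w' m"] by (auto simp: Y_def)
  from take_wpow[OF r(1,2)] obtain k i where i: "0 < i" "i \<le> length w"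
    "take r (wpow w m) = wpow w k @ take i w" by blast
  from take_wpow[OF r'(1,2)] obtain l j where j: "0 < j" "j \<le> length w'"
    "take r' (wpow w' m) = wpow w' l @ take j w'" by blast
  have Ap: "A @ [p] \<approx> wpow w k @ take i w"
    using r(3) i(3) by (simp add: homot_nf)
  have Bp: "rev B @ [p] \<approx> wpow w' l @ take j w'"
    using r'(3) j(3) by (simp add: homot_nf)
  have "last (take i w) = p" "last (take j w') = p"
    using homot_last[OF Ap] homot_last[OF Bp] i j ne by (auto simp: last_append)
  moreover have "Q \<approx> (A @ [p]) @ rev (rev B @ [p])"
  proof -
    have "Q \<approx> A @ p # B" using homot_nf'[of Q] 1(1) by (simp add: X_def)
    also have "\<dots> \<approx> A @ p # p # B" by (rule homot_sym, rule homot_stutter_append)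
    finally show ?thesis by simp
  qed
  then have "Q \<approx> (wpow w k @ take i w) @ rev (wpow w' l @ take j w')"
    using homot_append[OF Ap homot_rev[OF Bp]] by (rule homot_trans)
  ultimately show ?thesis
    using that[of i j k l] i j by (simp add: rev_wpow)
qed

lemma wpow_cancel:
  assumes "loop_at y w'" "R \<noteq> []" "last R = y" "l \<le> k"
  shows "R @ wpow w' k @ wpow (rev w') l \<approx> R @ wpow w' (k - l)"
proof (cases "l = 0")
  case False
  define M where "M = R @ wpow w' (k - l)"
  have "wpow w' k = wpow w' (k - l) @ wpow w' l"
    using assms(4) wpow_add[of w' "k - l" l] by simp
  then have "R @ wpow w' k @ wpow (rev w') l = M @ wpow w' l @ rev (wpow w' l) @ []"
    by (simp add: M_def rev_wpow)
  also have "\<dots> \<approx> M @ []"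
    using assms False
    by (intro homot_cancel_mid) (auto simp: M_def loop_at_def last_append last_wpow hd_wpow)
  finally show ?thesis by (simp add: M_def)
qed simp

lemma wpow_cancel':
  assumes "loop_at y w'" "R \<noteq> []" "last R = y" "k \<le> l"
  shows "R @ wpow w' k @ wpow (rev w') l \<approx> R @ wpow (rev w') (l - k)"
proof (cases "k = 0")
  case False
  have "wpow (rev w') l = wpow (rev w') k @ wpow (rev w') (l - k)"
    using assms(4) wpow_add[of "rev w'" "k" "l - k"] by simp
  then have "R @ wpow w' k @ wpow (rev w') l = R @ wpow w' k @ rev (wpow w' k) @ wpow (rev w') (l - k)"
    by (simp add: rev_wpow)
  also have "\<dots> \<approx> R @ wpow (rev w') (l - k)"
    using assms False
    by (intro homot_cancel_mid) (auto simp: loop_at_def hd_wpow)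
  finally show ?thesis .
qed simp

text \<open>A solution \<open>Q\<close> of the simultaneous conjugacy equations has the form \<open>w\<^sup>t R\<close> with \<open>R\<close> from a
  small set. If \<open>|t|\<close> is large, then every equation forces its loop to commute with \<open>w\<close>, so
  that \<open>R\<close> itself is a solution.\<close>

lemma conj_power_bounded:
  assumes w: "loop_at x w" "nf w \<noteq> [x]"
    and R: "R \<noteq> []" "hd R = x" "last R = y" "length R \<le> 2 * L"
    and len: "length w \<le> L"
    and loops: "\<And>g h. (g, h) \<in> X \<Longrightarrow> loop_at x g \<and> loop_at y h \<and> length g \<le> L \<and> length h \<le> L"
    and sol: "\<And>g h. (g, h) \<in> X \<Longrightarrow> g @ wpow w t @ R \<approx> wpow w t @ R @ h"
    and t: "8 * L + 4 \<le> t"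
    and X: "(g, h) \<in> X"
  shows "g @ R \<approx> R @ h"
proof -
  have g: "loop_at x g" "length g \<le> L" and h: "loop_at y h" "length h \<le> L" using loops[OF X] by auto
  have t0: "0 < t" using t by simp
  have wt: "wpow w t \<noteq> []" "hd (wpow w t) = x" "last (wpow w t) = x"
    using w t0 by (auto simp: loop_at_def hd_wpow last_wpow)
  have "rev (wpow w t) @ g @ wpow w t \<approx> (rev (wpow w t) @ g @ wpow w t) @ R @ rev R @ []"
    using homot_cancel_mid[of R "rev (wpow w t) @ g @ wpow w t" "[]"] R wt
    by (simp add: homot_sym)
  also have "\<dots> = rev (wpow w t) @ (g @ wpow w t @ R) @ rev R" by simp
  also have "\<dots> \<approx> rev (wpow w t) @ (wpow w t @ R @ h) @ rev R"
    by (intro homot_append_left homot_append_right sol[OF X])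
  also have "\<dots> = [] @ rev (wpow w t) @ rev (rev (wpow w t)) @ (R @ h @ rev R)" by simp
  also have "\<dots> \<approx> [] @ (R @ h @ rev R)"
    using R wt by (intro homot_cancel_mid') (auto simp: hd_rev)
  \<comment> \<open>Two copies of \<open>R\<close> and one of \<open>h\<close> make
    \<open>5 * L\<close>. With \<open>length g\<close> and \<open>2 * length w + 4\<close> from
    \<open>commute_of_short\<close> this adds up to the threshold \<open>8 * L + 4\<close>.\<close>
  finally have "length (nf (rev (wpow w t) @ g @ wpow w t)) \<le> 5 * L"
    using length_nf_le[of "R @ h @ rev R"] R h by (simp add: homot_def)
  then have comm: "w @ g \<approx> g @ w"
    using t g len by (intro commute_of_short[OF w g(1)]) auto
  have "wpow w t @ g @ R = (wpow w t @ g) @ R" by simp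
  also have "\<dots> \<approx> (g @ wpow w t) @ R"
    using conj_wpow[OF comm] by (rule homot_append_right)
  also have "\<dots> \<approx> wpow w t @ R @ h" using sol[OF X] by simp
  finally show ?thesis
    by (rule homot_cancel_left) (use wt R g h in \<open>auto simp: loop_at_def\<close>)
qed

text \<open>By \<open>conj_form\<close>, \<open>Q\<close> is \<open>w^k R w'^(-l)\<close>, and
  \<open>R\<close> itself carries \<open>w\<close> to \<open>w'\<close>. So only the difference
  \<open>k - l\<close> matters and one of the exponents can be made zero; a negative difference is
  treated with the reversed loops.\<close>

theorem simultaneous_conjugacy:
  assumes w: "loop_at x w" "nf w \<noteq> [x]" and ww': "(w, w') \<in> X"
    and Q: "Q \<noteq> []" "hd Q = x" "last Q = y"
    and loops: "\<And>g h. (g, h) \<in> X \<Longrightarrow> loop_at x g \<and> loop_at y h \<and> length g \<le> L \<and> length h \<le> L"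
    and sol: "\<And>g h. (g, h) \<in> X \<Longrightarrow> g @ Q \<approx> Q @ h"
  shows "\<exists>k l i j. k \<le> 8 * L + 4 \<and> l \<le> 8 * L + 4 \<and> 0 < i \<and> i \<le> length w \<and> 0 < j \<and> j \<le> length w' \<and>
    last (take i w) = last (take j w') \<and>
    (let Q' = wpow w k @ take i w @ rev (take j w') @ wpow (rev w') l
     in hd Q' = x \<and> last Q' = y \<and> (\<forall>(g, h)\<in>X. g @ Q' \<approx> Q' @ h))"
proof -
  have w': "loop_at y w'" and lens: "length w \<le> L" "length w' \<le> L" using loops[OF ww'] by auto
  obtain k l i j where ij: "0 < i" "i \<le> length w" "0 < j" "j \<le> length w'"
    "last (take i w) = last (take j w')"
    and Qf: "Q \<approx> wpow w k @ take i w @ rev (take j w') @ wpow (rev w') l"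
    using conj_form[OF w w' Q sol[OF ww']] by metis
  define R where "R = take i w @ rev (take j w')"
  have ne: "w \<noteq> []" "w' \<noteq> []" using w w' by (auto simp: loop_at_def)
  have R: "R \<noteq> []" "hd R = x" "last R = y" "length R \<le> 2 * L"
    using ij ne w w' lens by (auto simp: R_def loop_at_def hd_append last_append last_rev)
  have Qf': "Q \<approx> wpow w k @ R @ wpow (rev w') l" using Qf by (simp add: R_def)
  \<comment> \<open>The powers on either side are cancelled from the equation
    \<open>w Q = Q w'\<close>.\<close>
  have wR: "w @ R \<approx> R @ w'"
  proof -
    have 1: "wpow w k @ (w @ R @ wpow (rev w') l) \<approx> wpow w k @ (R @ wpow (rev w') l @ w')"
    proof -
      have "wpow w k @ (w @ R @ wpow (rev w') l) = w @ (wpow w k @ R @ wpow (rev w') l)"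
        using wpow_Suc[of w k] wpow_Suc_right[of w k] by simp
      also have "\<dots> \<approx> w @ Q" by (intro homot_append_left homot_sym[OF Qf'])
      also have "\<dots> \<approx> Q @ w'" by (rule sol[OF ww'])
      also have "\<dots> \<approx> (wpow w k @ R @ wpow (rev w') l) @ w'" using Qf' by (rule homot_append_right)
      finally show ?thesis by simp
    qed
    have 2: "w @ R @ wpow (rev w') l \<approx> R @ wpow (rev w') l @ w'"
    proof (cases "k = 0")
      case False
      show ?thesis
        by (rule homot_cancel_left[OF 1])
           (use False w R in \<open>auto simp: loop_at_def last_wpow\<close>)
    qed (use 1 in simp)
    show ?thesis
    proof (cases l)
      case 0
      then show ?thesis using 2 by simp
    next
      case (Suc l')
      have "R @ wpow (rev w') l @ w' = (R @ wpow (rev w') l') @ rev w' @ rev (rev w') @ []"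
        using Suc wpow_Suc_right[of "rev w'" l'] by simp
      also have "\<dots> \<approx> (R @ wpow (rev w') l') @ []"
        using R w' ne by (intro homot_cancel_mid)
          (auto simp: loop_at_def hd_rev last_append last_wpow last_rev)
      also have "\<dots> = R @ [] @ wpow (rev w') l'" by simp
      also have "\<dots> \<approx> R @ (w' @ rev w') @ wpow (rev w') l'"
        using homot_cancel_mid[of w' R "wpow (rev w') l'"] R w'
        by (simp add: loop_at_def homot_sym)
      also have "\<dots> = (R @ w') @ wpow (rev w') l" using Suc by (simp add: wpow_Suc)
      finally have "(w @ R) @ wpow (rev w') l \<approx> (R @ w') @ wpow (rev w') l"
        using 2 homot_trans by fastforce
      then show ?thesis
        by (rule homot_cancel_right)
           (use Suc w w' R in \<open>auto simp: loop_at_def last_append hd_wpow hd_rev\<close>)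
    qed
  qed
  have Qk: "Q \<approx> R @ wpow w' k @ wpow (rev w') l"
  proof -
    have "wpow w k @ R @ wpow (rev w') l \<approx> (R @ wpow w' k) @ wpow (rev w') l"
      using homot_append_right[OF conj_wpow[OF wR, of k], of "wpow (rev w') l"] by simp
    then show ?thesis using homot_trans[OF Qf'] by simp
  qed
  have small: ?thesis if Q': "Q' \<approx> wpow w k' @ R @ wpow (rev w') l'" "k' \<le> 8 * L + 4" "l' \<le> 8 * L + 4"
    and s: "\<And>g h. (g, h) \<in> X \<Longrightarrow> g @ Q' \<approx> Q' @ h" for k' l' Q'
  proof (intro exI conjI)
    let ?Q = "wpow w k' @ take i w @ rev (take j w') @ wpow (rev w') l'"
    have e: "Q' \<approx> ?Q" using Q'(1) by (simp add: R_def)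
    have eq: "?Q = wpow w k' @ R @ wpow (rev w') l'" by (simp add: R_def)
    have "hd ?Q = x" "last ?Q = y"
      unfolding eq using R w w' ne
      by (auto simp: hd_append last_append hd_wpow last_wpow loop_at_def last_rev hd_rev)
    moreover have "g @ ?Q \<approx> ?Q @ h" if "(g, h) \<in> X" for g h
    proof -
      have "g @ ?Q \<approx> g @ Q'" by (intro homot_append_left homot_sym[OF e])
      also have "\<dots> \<approx> Q' @ h" by (rule s[OF that])
      also have "\<dots> \<approx> ?Q @ h" using e by (rule homot_append_right)
      finally show ?thesis .
    qed
    ultimately show "let Q' = ?Q in hd Q' = x \<and> last Q' = y \<and> (\<forall>(g, h)\<in>X. g @ Q' \<approx> Q' @ h)"
      by (auto simp: Let_def)
  qed (use ij that in auto)
  have large: ?thesis if "\<And>g h. (g, h) \<in> X \<Longrightarrow> g @ R \<approx> R @ h"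
    by (rule small[of R 0 0]) (use that in auto)
  show ?thesis
  proof (cases "l \<le> k")
    case True
    have Qt: "Q \<approx> wpow w (k - l) @ R"
    proof -
      have "R @ wpow w' k @ wpow (rev w') l \<approx> R @ wpow w' (k - l)"
        using w' R True by (intro wpow_cancel) auto
      also have "\<dots> \<approx> wpow w (k - l) @ R" by (rule homot_sym[OF conj_wpow[OF wR]])
      finally show ?thesis by (rule homot_trans[OF Qk])
    qed
    show ?thesis
    proof (cases "k - l \<le> 8 * L + 4")
      case True
      show ?thesis by (rule small[of Q "k - l" 0]) (use Qt True sol in auto)
    next
      case False
      have s: "g @ wpow w (k - l) @ R \<approx> wpow w (k - l) @ R @ h" if "(g, h) \<in> X" for g h
      proof -
        have "g @ wpow w (k - l) @ R \<approx> g @ Q" by (intro homot_append_left homot_sym[OF Qt])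
        also have "\<dots> \<approx> Q @ h" by (rule sol[OF that])
        also have "\<dots> \<approx> (wpow w (k - l) @ R) @ h" using Qt by (rule homot_append_right)
        finally show ?thesis by simp
      qed
      show ?thesis
        by (rule large, rule conj_power_bounded[OF w R lens(1) loops s]) (use False in auto)
    qed
  next
    case False
    have Qt0: "Q \<approx> R @ wpow (rev w') (l - k)"
      using homot_trans[OF Qk wpow_cancel'[OF w' R(1,3)]] False by simp
    have revR: "rev w @ R \<approx> R @ rev w'" using w w' R(1,2,3) wR by (intro conj_rev)
    have Qt: "Q \<approx> wpow (rev w) (l - k) @ R"
      using homot_trans[OF Qt0 homot_sym[OF conj_wpow[OF revR]]] .
    show ?thesis
    proof (cases "l - k \<le> 8 * L + 4")
      case True
      show ?thesis by (rule small[of Q 0 "l - k"]) (use Qt0 True sol in auto)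
    next
      case False
      have s: "g @ wpow (rev w) (l - k) @ R \<approx> wpow (rev w) (l - k) @ R @ h" if "(g, h) \<in> X" for g h
      proof -
        have "g @ wpow (rev w) (l - k) @ R \<approx> g @ Q" by (intro homot_append_left homot_sym[OF Qt])
        also have "\<dots> \<approx> Q @ h" by (rule sol[OF that])
        also have "\<dots> \<approx> (wpow (rev w) (l - k) @ R) @ h" using Qt by (rule homot_append_right)
        finally show ?thesis by simp
      qed
      have nt: "nf (rev w) \<noteq> [x]" using w(2) by (metis nf_rev rev_rev_ident rev_singleton_conv)
      show ?thesis
        by (rule large, rule conj_power_bounded[OF _ nt R _ loops s]) (use False w lens in auto)
    qed
  qed
qed

section \<open>Recolourings and systems of walks\<close>

locale recol_graph =
  fixes n :: nat and adj :: "nat \<Rightarrow> nat \<Rightarrow> bool" and E :: "(nat \<times> nat) set"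
  assumes adj_sym: "adj u v \<Longrightarrow> adj v u" and adj_refl: "v < n \<Longrightarrow> adj v v"
    and adj_less: "adj u v \<Longrightarrow> u < n"
    and E_sym: "(a, b) \<in> E \<Longrightarrow> (b, a) \<in> E" and E_refl: "(a, b) \<in> E \<Longrightarrow> (b, b) \<in> E"
begin

lemma adj_less2: "adj u v \<Longrightarrow> v < n"
  using adj_sym adj_less by blast

definition hom :: "(nat \<Rightarrow> nat) \<Rightarrow> bool" where
  "hom c \<longleftrightarrow> (\<forall>u v. adj u v \<longrightarrow> (c u, c v) \<in> E)"

text \<open>The colour of a neighbour must be adjacent to the old and to the new colour of
  \<open>v\<close>, which are adjacent to each other; without triangles it equals one of them. This
  condition is how triangle-freeness enters the argument.\<close>

definition can_move :: "(nat \<Rightarrow> nat) \<Rightarrow> nat \<Rightarrow> nat \<Rightarrow> bool" where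
  "can_move c v b \<longleftrightarrow> v < n \<and> (c v, b) \<in> E \<and> (\<forall>u. adj u v \<longrightarrow> c u = c v \<or> c u = b)"

definition move :: "(nat \<Rightarrow> nat) \<Rightarrow> (nat \<Rightarrow> nat) \<Rightarrow> bool" where
  "move c c' \<longleftrightarrow> (\<exists>v b. can_move c v b \<and> c' = c(v := b))"

text \<open>A move of \<open>v\<close> tolerates only one foreign colour around \<open>v\<close>,
  but each member sees two of them inside \<open>F\<close>. So no member can be the first to
  move.\<close>

definition frozen :: "(nat \<Rightarrow> nat) \<Rightarrow> nat set \<Rightarrow> bool" where
  "frozen c F \<longleftrightarrow> (\<forall>v\<in>F. \<exists>u\<in>F. \<exists>w\<in>F. adj u v \<and> adj w v \<and> c u \<noteq> c v \<and> c w \<noteq> c v \<and> c u \<noteq> c w)"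

definition walk :: "nat list \<Rightarrow> bool" where
  "walk xs \<longleftrightarrow> successively (\<lambda>a b. (a, b) \<in> E) xs"

text \<open>\<open>S v\<close> is, up to homotopy, the walk along which \<open>v\<close> is recoloured from \<open>c v\<close> to \<open>d v\<close>.
  Vertices of a frozen set can never be recoloured.\<close>

definition system :: "nat set \<Rightarrow> (nat \<Rightarrow> nat) \<Rightarrow> (nat \<Rightarrow> nat) \<Rightarrow> (nat \<Rightarrow> nat list) \<Rightarrow> bool" where
  "system K c d S \<longleftrightarrow> (\<forall>v\<in>K. S v \<noteq> [] \<and> hd (S v) = c v \<and> last (S v) = d v \<and> walk (S v) \<and>
     (\<forall>u. adj u v \<longrightarrow> S u \<approx> c u # S v @ [d u])) \<and>
     (\<forall>F\<subseteq>K. frozen c F \<longrightarrow> (\<forall>v\<in>F. S v \<approx> [c v]))"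

definition closed :: "nat set \<Rightarrow> bool" where
  "closed K \<longleftrightarrow> K \<subseteq> {..<n} \<and> (\<forall>u v. adj u v \<longrightarrow> v \<in> K \<longrightarrow> u \<in> K)"

section \<open>Moves, frozen sets and the systems that moves induce\<close>

lemma move_hom: "hom c \<Longrightarrow> move c c' \<Longrightarrow> hom c'"
  unfolding hom_def move_def can_move_def
  by (auto simp: fun_upd_def) (metis E_refl E_sym adj_sym)+

lemma moves_hom: "move\<^sup>*\<^sup>* c c' \<Longrightarrow> hom c \<Longrightarrow> hom c'"
  by (induction rule: rtranclp_induct) (auto intro: move_hom)

lemma can_move_sym: "can_move c v b \<Longrightarrow> can_move (c(v := b)) v (c v)"
  unfolding can_move_def by (auto intro: E_sym)

lemma move_sym: "move c c' \<Longrightarrow> move c' c"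
  unfolding move_def using can_move_sym by (metis fun_upd_idem_iff fun_upd_upd)

lemma moves_sym: "move\<^sup>*\<^sup>* c c' \<Longrightarrow> move\<^sup>*\<^sup>* c' c"
  by (metis move_sym sympI sympD symp_rtranclp)

lemma frozen_not_move: "frozen c F \<Longrightarrow> can_move c v b \<Longrightarrow> v \<notin> F"
  unfolding frozen_def can_move_def by metis

lemma frozen_cong: "frozen c F \<Longrightarrow> (\<And>v. v \<in> F \<Longrightarrow> c v = c' v) \<Longrightarrow> frozen c' F"
  unfolding frozen_def by metis

lemma frozen_moves: "move\<^sup>*\<^sup>* c c' \<Longrightarrow> frozen c F \<Longrightarrow> frozen c' F"
proof (induction rule: rtranclp_induct)
  case (step y z)
  then obtain v b where vb: "can_move y v b" "z = y(v := b)" by (auto simp: move_def)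
  then have "v \<notin> F" using frozen_not_move step by blast
  then show ?case using step vb by (intro frozen_cong[of y F z]) auto
qed

lemma homot_swap:
  assumes "x = a \<or> x = b"
  shows "us @ [a, b, x] \<approx> us @ [a, x]"
  using assms homot_stutter_append[of us a "[b]"] homot_stutter_append[of "us @ [a]" b "[]"]
    homot_backtrack_append[of us a b "[]"] homot_stutter_append[of us a "[]"]
  by (auto simp: homot_def)

text \<open>Each move appends the new colour to the walk of the moved vertex. The condition along an
  edge survives because the neighbour shows the old or the new colour, so that the extra step is a
  stutter or a backtrack.\<close>

theorem system_of_moves:
  assumes "move\<^sup>*\<^sup>* c d"
  shows "\<exists>S. system {..<n} c d S"
  using assms
proof (induction rule: rtranclp_induct)
  case base
  have "[c u] \<approx> c u # [c v] @ [c u]" for u v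
    using homot_backtrack[of "c u" "c v" "[]"] by (simp add: homot_sym)
  then show ?case by (intro exI[of _ "\<lambda>v. [c v]"]) (simp add: system_def walk_def)
next
  case (step d d')
  then obtain S where S: "system {..<n} c d S" by blast
  from step obtain w b where cm: "can_move d w b" and d': "d' = d(w := b)"
    by (auto simp: move_def)
  have w: "w < n" and dE: "(d w, b) \<in> E" and nb: "\<And>u. adj u w \<Longrightarrow> d u = d w \<or> d u = b"
    using cm by (auto simp: can_move_def)
  have Sv: "S v \<noteq> []" "hd (S v) = c v" "last (S v) = d v" "walk (S v)" if "v < n" for v
    using S that by (auto simp: system_def)
  have Sa: "S u \<approx> c u # S v @ [d u]" if "adj u v" for u v
    using S that adj_less2 by (auto simp: system_def)
  obtain W where W: "S w = W @ [d w]" using Sv[OF w] by (metis append_butlast_last_id)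
  define S' where "S' = S(w := S w @ [b])"
  have edge: "S' u \<approx> c u # S' v @ [d' u]" if uv: "adj u v" for u v
  proof -
    have lt: "u < n" "v < n" using uv adj_less adj_less2 by auto
    consider "u = w" "v = w" | "u \<noteq> w" "v = w" | "u = w" "v \<noteq> w" | "u \<noteq> w" "v \<noteq> w" by blast
    then show ?thesis
    proof cases
      case 1
      have "c w # S w @ [b, b] \<approx> S w @ [b, b]"
        using homot_hd_Cons[of "S w @ [b, b]" "c w"] Sv[OF w] by simp
      also have "\<dots> \<approx> S w @ [b]" by (rule homot_stutter_append)
      finally show ?thesis using 1 by (simp add: S'_def d' homot_sym)
    next
      case 2
      have "S u \<approx> c u # S w @ [d u]" using Sa uv 2 by simp
      also have "\<dots> \<approx> c u # W @ [d w, b, d u]"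
        using homot_swap[of "d u" "d w" b "c u # W"] nb uv 2 W by (auto intro: homot_sym)
      finally show ?thesis using 2 W by (simp add: S'_def d')
    next
      case 3
      then have "adj v w" using uv adj_sym by blast
      then have x: "d v = d w \<or> d v = b" using nb by blast
      have "S w @ [b] \<approx> c w # S v @ [d w, b]"
        using homot_append_right[OF Sa[OF uv], of "[b]"] 3 by simp
      also have "\<dots> \<approx> c w # S v @ [b]"
      proof -
        obtain V where V: "S v = V @ [d v]" using Sv[OF lt(2)] by (metis append_butlast_last_id)
        have "c w # V @ [d v, d w, b] \<approx> c w # V @ [d v, b]"
          using x homot_stutter_append[of "c w # V" "d w" "[b]"]
            homot_backtrack_append[of "c w # V" b "d w" "[]"]
            homot_stutter_append[of "c w # V" b "[]"]
          by (auto simp: homot_def)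
        then show ?thesis using V by simp
      qed
      finally show ?thesis using 3 by (simp add: S'_def d')
    next
      case 4
      then show ?thesis using Sa uv by (simp add: S'_def d')
    qed
  qed
  have fr: "S' v \<approx> [c v]" if "F \<subseteq> {..<n}" "frozen c F" "v \<in> F" for F v
  proof -
    have "w \<notin> F" using frozen_moves[OF step(1) that(2)] cm frozen_not_move by blast
    then show ?thesis using S that by (auto simp: S'_def system_def)
  qed
  have "walk (S w @ [b])"
    using Sv[OF w] dE by (simp add: walk_def successively_append_iff)
  then have "system {..<n} c d' S'"
    using edge fr Sv by (auto simp: system_def S'_def d')
  then show ?case by blast
qed

section \<open>Realising a system move by move\<close>

definition rsystem :: "nat set \<Rightarrow> (nat \<Rightarrow> nat) \<Rightarrow> (nat \<Rightarrow> nat) \<Rightarrow> (nat \<Rightarrow> nat list) \<Rightarrow> bool" where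
  "rsystem K c d S \<longleftrightarrow> system K c d S \<and> (\<forall>v\<in>K. reduced (S v))"

lemma walk_nf: "walk xs \<Longrightarrow> walk (nf xs)"
  by (simp add: walk_def successively_nf)

lemma rsystem_nf: "closed K \<Longrightarrow> system K c d S \<Longrightarrow> rsystem K c d (\<lambda>v. nf (S v))"
proof -
  assume K: "closed K" and S: "system K c d S"
  have "nf (S u) \<approx> c u # nf (S v) @ [d u]" if "adj u v" "v \<in> K" for u v
  proof -
    have "nf (S u) \<approx> c u # S v @ [d u]" using S that by (auto simp: system_def homot_def)
    also have "\<dots> \<approx> c u # nf (S v) @ [d u]"
      using homot_Cons[OF homot_append_right[OF homot_nf'[of "S v"], of "[d u]"], of "c u"] by simp
    finally show ?thesis .
  qed
  then show ?thesis using S by (auto simp: rsystem_def system_def walk_nf homot_def)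
qed

lemma system_mono:
  assumes "system K c d S" "K' \<subseteq> K"
  shows "system K' c d S"
  using assms unfolding system_def by (meson subset_iff subset_trans)

text \<open>The edge condition telescopes. Along a path it expresses one walk of the system through
  another, so that one root determines its whole component; along a closed walk it becomes a
  conjugacy equation.\<close>

lemma system_walk:
  assumes "system K c d S" "set xs \<subseteq> K" "successively adj xs" "xs \<noteq> []"
  shows "S (hd xs) \<approx> map c xs @ S (last xs) @ rev (map d xs)"
  using assms(2-)
proof (induction xs)
  case (Cons x xs)
  show ?case
  proof (cases xs)
    case Nil
    have "S x \<noteq> []" "hd (S x) = c x" "last (S x) = d x"
      using assms(1) Cons.prems by (auto simp: system_def)
    then have "c x # S x @ [d x] \<approx> S x"
      using homot_hd_Cons[of "S x @ [d x]" "c x"] homot_last_snoc[of "S x" "d x"]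
      by (auto intro: homot_trans)
    then show ?thesis using Nil by (simp add: homot_sym)
  next
    case (Cons y ys)
    have "S x \<approx> [c x] @ S y @ [d x]"
      using assms(1) Cons.prems Cons by (auto simp: system_def)
    also have "\<dots> \<approx> [c x] @ (map c xs @ S (last xs) @ rev (map d xs)) @ [d x]"
      using Cons.IH Cons.prems Cons by (intro homot_append_left homot_append_right) auto
    finally show ?thesis using Cons by simp
  qed
qed simp

lemma rsystem_nth:
  assumes "rsystem K c d S" "v \<in> K" "1 < length (S v)"
  obtains r where "S v = c v # S v ! 1 # r" "c v \<noteq> S v ! 1"
proof -
  have *: "reduced (S v)" "hd (S v) = c v" using assms by (auto simp: rsystem_def system_def)
  obtain x y r where "S v = x # y # r"
    using assms(3) by (cases "S v"; cases "tl (S v)") auto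
  with * that[of r] show ?thesis by simp
qed

text \<open>Counterpart of \<open>system_of_moves\<close> at the other end of the walk: a first step
  is removed instead of a last one added, with the same case analysis on the edges at
  \<open>v\<close>.\<close>

lemma rsystem_step:
  assumes K: "closed K" and S: "rsystem K c d S" and v: "v \<in> K" "1 < length (S v)"
    and nb: "\<And>u. adj u v \<Longrightarrow> c u = c v \<or> c u = S v ! 1"
  shows "can_move c v (S v ! 1)" "rsystem K (c(v := S v ! 1)) d (S(v := tl (S v)))"
proof -
  define b where "b = S v ! 1"
  from rsystem_nth[OF S v] obtain r where r: "S v = c v # b # r" "c v \<noteq> b" unfolding b_def by blast
  have sys: "system K c d S" and red: "\<And>u. u \<in> K \<Longrightarrow> reduced (S u)" using S by (auto simp: rsystem_def)
  have "walk (S v)" using sys v by (auto simp: system_def)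
  then have cb: "(c v, b) \<in> E" and wr: "walk (b # r)" using r by (auto simp: walk_def)
  have lt: "v < n" using K v by (auto simp: closed_def)
  show cm: "can_move c v (S v ! 1)"
    unfolding can_move_def b_def[symmetric] using cb lt nb b_def by blast
  define S' c' where "S' = S(v := tl (S v))" and "c' = c(v := b)"
  have Su: "S u \<noteq> []" "hd (S u) = c u" "last (S u) = d u" "walk (S u)" if "u \<in> K" for u
    using sys that by (auto simp: system_def)
  have Sa: "S u \<approx> c u # S x @ [d u]" if "adj u x" "x \<in> K" for u x
    using sys that by (auto simp: system_def)
  have edge: "S' u \<approx> c' u # S' x @ [d u]" if ux: "adj u x" "x \<in> K" for u x
  proof -
    have uK: "u \<in> K" using K ux by (auto simp: closed_def)
    consider "u = v" "x = v" | "u \<noteq> v" "x = v" | "u = v" "x \<noteq> v" | "u \<noteq> v" "x \<noteq> v" by blast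
    then show ?thesis
    proof cases
      case 1
      have "b # (b # r) @ [d v] \<approx> (b # r) @ [d v]" using homot_stutter by simp
      also have "\<dots> \<approx> b # r" using Su(3)[OF v(1)] r by (intro homot_last_snoc) auto
      finally show ?thesis using 1 r by (simp add: S'_def c'_def homot_sym)
    next
      case 2
      have cu: "c u = c v \<or> c u = b" using nb ux 2 b_def by simp
      have "S u \<approx> c u # c v # b # r @ [d u]" using Sa[OF ux] 2 r by simp
      also have "\<dots> \<approx> c u # b # r @ [d u]"
        using cu homot_stutter[of "c v" "b # r @ [d u]"] homot_backtrack[of b "c v" "r @ [d u]"]
          homot_stutter[of b "r @ [d u]"] by (auto simp: homot_def)
      finally show ?thesis using 2 r by (simp add: S'_def c'_def)
    next
      case 3
      have cx: "c x = c v \<or> c x = b" using nb ux adj_sym 3 b_def by blast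
      obtain t where t: "S x = c x # t" using Su[OF ux(2)] by (metis list.collapse)
      have "b # r \<approx> b # c v # b # r" by (rule homot_sym, rule homot_backtrack)
      also have "\<dots> \<approx> b # c v # S x @ [d v]" using homot_Cons[OF Sa[OF ux], of b] 3 r by simp
      also have "\<dots> \<approx> b # S x @ [d v]"
        using cx t homot_Cons[OF homot_stutter[of "c v" "t @ [d v]"], of b]
          homot_backtrack[of b "c v" "t @ [d v]"]
          homot_stutter[of b "t @ [d v]"] by (auto simp: homot_def)
      finally show ?thesis using 3 r by (simp add: S'_def c'_def)
    next
      case 4
      then show ?thesis using Sa ux by (simp add: S'_def c'_def)
    qed
  qed
  have fr: "S' u \<approx> [c' u]" if "F \<subseteq> K" "frozen c' F" "u \<in> F" for F u
  proof -
    \<comment> \<open>\<open>v\<close> could move back, so it lies in no frozen set of the new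
      colouring; a set that avoids \<open>v\<close> was frozen before as well.\<close>
    have "can_move c' v (c v)" using can_move_sym[OF cm] by (simp add: c'_def b_def)
    then have "v \<notin> F" using frozen_not_move that by blast
    moreover from this have "frozen c F" using that by (intro frozen_cong[of c' F c]) (auto simp: c'_def)
    ultimately show ?thesis using sys that by (auto simp: S'_def c'_def system_def)
  qed
  have "system K c' d S'"
    unfolding system_def
  proof (intro conjI ballI)
    fix x assume x: "x \<in> K"
    show "S' x \<noteq> []" "hd (S' x) = c' x" "last (S' x) = d x" "walk (S' x)"
      using Su[OF x] r wr by (auto simp: S'_def c'_def split: if_splits)
    show "\<forall>u. adj u x \<longrightarrow> S' u \<approx> c' u # S' x @ [d u]" using edge x by blast
  qed (use fr in blast)
  moreover have "reduced (S' x)" if "x \<in> K" for x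
    using red[OF that] r reduced_ConsD by (auto simp: S'_def)
  ultimately show "rsystem K (c(v := S v ! 1)) d (S(v := tl (S v)))"
    by (simp add: rsystem_def S'_def c'_def b_def)
qed

text \<open>\<open>S u\<close> is the reduced form of \<open>S v\<close> with \<open>c u\<close> in
  front and \<open>d u\<close> behind. The blocking colour \<open>c u\<close> differs from the first
  two vertices of \<open>S v\<close>, so nothing cancels at the front: the next step of
  \<open>u\<close> leads to the colour of \<open>v\<close>.\<close>

lemma blocker:
  assumes K: "closed K" and S: "rsystem K c d S" and v: "v \<in> K" "1 < length (S v)"
    and u: "adj u v" "c u \<noteq> c v" "c u \<noteq> S v ! 1"
  shows "u \<in> K" "1 < length (S u)" "S u ! 1 = c v"
proof -
  show uK: "u \<in> K" using K u v by (auto simp: closed_def)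
  from rsystem_nth[OF S v] obtain r where r: "S v = c v # S v ! 1 # r" "c v \<noteq> S v ! 1" by metis
  have "S u \<approx> c u # S v @ [d u]" "reduced (S u)" "reduced (S v)"
    using S u v uK by (auto simp: rsystem_def system_def)
  then have Su: "S u = cpush (c u) (pushr (S v) (d u))"
    using foldl_pushr[of "S v" "[d u]"] by (simp add: homot_def nf_reduced nf_Cons)
  \<comment> \<open>A push at the end may remove the second vertex, but never touches the
    first.\<close>
  have "\<exists>t. pushr (a # b # xs) x = a # t \<and> (t = [] \<or> hd t = b)" for a b x :: nat and xs
    by (cases xs) (auto simp: pushr_def)
  from this[of "c v" "S v ! 1" r "d u", folded r(1)] have "S u = c u # pushr (S v) (d u) \<and> hd (pushr (S v) (d u)) = c v \<and> pushr (S v) (d u) \<noteq> []"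
    using Su u by auto
  then show "1 < length (S u)" "S u ! 1 = c v" by (auto simp: hd_conv_nth)
qed

text \<open>If every vertex that still has to move is blocked, then the periodic points of a blocking map
  form a frozen set.\<close>

lemma progress:
  assumes K: "closed K" and S: "rsystem K c d S" and x: "x \<in> K" "1 < length (S x)"
  shows "\<exists>v\<in>K. 1 < length (S v) \<and> (\<forall>u. adj u v \<longrightarrow> c u = c v \<or> c u = S v ! 1)"
proof (rule ccontr)
  assume stuck: "\<not> ?thesis"
  define B where "B = {v \<in> K. 1 < length (S v)}"
  have "\<forall>v\<in>B. \<exists>u. adj u v \<and> c u \<noteq> c v \<and> c u \<noteq> S v ! 1" using stuck by (auto simp: B_def)
  then obtain g where g: "\<And>v. v \<in> B \<Longrightarrow> adj (g v) v \<and> c (g v) \<noteq> c v \<and> c (g v) \<noteq> S v ! 1"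
    by metis
  have gB: "g v \<in> B" "S (g v) ! 1 = c v" if "v \<in> B" for v
    using blocker[OF K S, of v "g v"] g[OF that] that by (auto simp: B_def)
  have iter: "(g ^^ m) v \<in> B" if "v \<in> B" for m v
    by (induction m) (use that gB in auto)
  have xB: "x \<in> B" using x by (simp add: B_def)
  have finB: "finite B" using K finite_subset[of B "{..<n}"] by (auto simp: B_def closed_def)
  have "\<not> inj_on (\<lambda>m. (g ^^ m) x) (UNIV :: nat set)"
  proof
    assume "inj_on (\<lambda>m. (g ^^ m) x) (UNIV :: nat set)"
    moreover have "(\<lambda>m. (g ^^ m) x) ` UNIV \<subseteq> B" using iter[OF xB] by auto
    ultimately have "finite (UNIV :: nat set)" using finB by (meson finite_imageD finite_subset)
    then show False by simp
  qed
  then obtain i' j' where "i' \<noteq> j'" "(g ^^ i') x = (g ^^ j') x" by (auto simp: inj_on_def)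
  then obtain i j where ij: "i < j" "(g ^^ i) x = (g ^^ j) x" by (metis linorder_neqE_nat)
  define F where "F = {v \<in> B. \<exists>m>0. (g ^^ m) v = v}"
  define y where "y = (g ^^ i) x"
  have "(g ^^ (j - i)) y = (g ^^ j) x" using ij(1) by (simp add: y_def flip: funpow_add comp_apply[of "g ^^ (j - i)"])
  then have y: "y \<in> F" using ij iter[OF xB, of i]
    by (auto simp: F_def y_def intro!: exI[of _ "j - i"])
  have "frozen c F"
    unfolding frozen_def
  proof
    fix v assume v: "v \<in> F"
    then obtain m where m: "0 < m" "(g ^^ m) v = v" and vB: "v \<in> B" by (auto simp: F_def)
    \<comment> \<open>\<open>u\<close> is the predecessor of \<open>v\<close> on its cycle. By
      \<open>blocker\<close>, \<open>v\<close> wants the colour of \<open>u\<close>, and the vertex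
      \<open>g v\<close> blocks it by having another one. So predecessor and successor show two
      distinct foreign colours.\<close>
    define u where "u = (g ^^ (m - 1)) v"
    have gu: "g u = v" using m by (cases m) (auto simp: u_def)
    have uB: "u \<in> B" unfolding u_def by (rule iter[OF vB])
    have "(g ^^ m) u = u"
      unfolding u_def using m(2) by (metis funpow_add comp_apply add.commute)
    then have uF: "u \<in> F" using uB m by (auto simp: F_def)
    have "(g ^^ m) (g v) = g v" using m(2) by (metis funpow_swap1)
    then have gF: "g v \<in> F" using gB[OF vB] m by (auto simp: F_def)
    have "c (g v) \<noteq> c u" using g[OF vB] gB(2)[OF uB] gu by simp
    then show "\<exists>u\<in>F. \<exists>w\<in>F. adj u v \<and> adj w v \<and> c u \<noteq> c v \<and> c w \<noteq> c v \<and> c u \<noteq> c w"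
      using uF gF g[OF vB] g[OF uB] gu adj_sym by (metis (no_types))
  qed
  moreover have "F \<subseteq> K" by (auto simp: F_def B_def)
  ultimately have "S y \<approx> [c y]" using S y by (auto simp: rsystem_def system_def)
  moreover have "reduced (S y)" "1 < length (S y)" using S y by (auto simp: rsystem_def F_def B_def)
  ultimately show False by (auto simp: homot_def nf_reduced nf_Cons)
qed

end

section \<open>The greedy procedure and the candidate walks\<close>

context recol_graph
begin

lemma walk_map: "hom c \<Longrightarrow> successively adj xs \<Longrightarrow> walk (map c xs)"
  unfolding walk_def successively_map
  by (rule successively_mono[of adj]) (auto simp: hom_def)

lemma walk_rev: "walk xs \<Longrightarrow> walk (rev xs)"
  unfolding walk_def successively_rev
  by (auto elim!: successively_mono intro: E_sym)

lemma walk_append: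
  "walk (xs @ ys) \<longleftrightarrow> walk xs \<and> walk ys \<and> (xs = [] \<or> ys = [] \<or> (last xs, hd ys) \<in> E)"
  by (auto simp: walk_def successively_append_iff)

lemma walk_wpow:
  assumes "walk w" "(last w, hd w) \<in> E"
  shows "walk (wpow w k)"
proof (induction k)
  case (Suc k)
  then show ?case using assms by (cases "k = 0"; cases "w = []") (auto simp: wpow_Suc walk_append hd_wpow)
qed (simp add: walk_def)

lemma walk_take: "walk w \<Longrightarrow> walk (take i w)"
  by (metis append_take_drop_id walk_append)

lemma successively_adj_rev: "successively adj xs \<Longrightarrow> successively adj (rev xs)"
  unfolding successively_rev by (auto elim!: successively_mono intro: adj_sym)

end

text \<open>\<open>up v\<close> leads from \<open>v\<close> to the root inside \<open>K\<close> and
  has exactly \<open>n\<close> vertices; a shorter path is padded by staying at the root, which has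
  a loop. The uniform length lets the program handle all paths by the same loops.\<close>

locale rooted_graph = recol_graph +
  fixes q :: nat and K :: "nat set" and up :: "nat \<Rightarrow> nat list"
  assumes K: "closed K" and q: "q \<in> K"
    and up_walk: "v \<in> K \<Longrightarrow> successively adj (up v)" and up_set: "v \<in> K \<Longrightarrow> set (up v) \<subseteq> K"
    and up_length: "v \<in> K \<Longrightarrow> length (up v) = n"
    and up_hd: "v \<in> K \<Longrightarrow> hd (up v) = v" and up_last: "v \<in> K \<Longrightarrow> last (up v) = q"
    and up_q: "set (up q) \<subseteq> {q}"
begin

lemma q_less: "q < n" using q K by (auto simp: closed_def)

lemma up_ne: "v \<in> K \<Longrightarrow> up v \<noteq> []"
  using up_length[of v] q_less by auto

lemma finite_K: "finite K"
  using K finite_subset[of K "{..<n}"] by (auto simp: closed_def)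

definition word :: "(nat \<Rightarrow> nat) \<Rightarrow> (nat \<Rightarrow> nat) \<Rightarrow> nat list \<Rightarrow> nat \<Rightarrow> nat list" where
  "word c d Q v = nf (map c (up v) @ Q @ rev (map d (up v)))"

definition good :: "(nat \<Rightarrow> nat) \<Rightarrow> (nat \<Rightarrow> nat) \<Rightarrow> nat list \<Rightarrow> bool" where
  "good c d Q \<longleftrightarrow> (\<exists>S. rsystem K c d S \<and> S q = nf Q)"

text \<open>The list \<open>Q\<close> is the part of the walk of the root that is still ahead; it determines the walks of
  all other vertices.\<close>

definition greedy_step ::
  "(nat \<Rightarrow> nat) \<Rightarrow> nat \<Rightarrow> (nat \<Rightarrow> nat) \<times> nat list \<Rightarrow> (nat \<Rightarrow> nat) \<times> nat list" where
  "greedy_step d v = (\<lambda>(c, Q). let W = word c d Q v in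
     if 1 < length W \<and> can_move c v (W ! 1) then (c(v := W ! 1), if v = q then tl Q else Q) else (c, Q))"

lemma word_eq:
  assumes "rsystem K c d S" "v \<in> K"
  shows "word c d (S q) v = S v"
proof -
  have "S v \<approx> map c (up v) @ S q @ rev (map d (up v))"
    using system_walk[of K c d S "up v"] assms up_ne up_set up_walk up_hd up_last
    by (simp add: rsystem_def)
  then show ?thesis using assms by (simp add: word_def homot_def rsystem_def nf_reduced)
qed

definition pot :: "(nat \<Rightarrow> nat list) \<Rightarrow> nat" where "pot S = (\<Sum>v\<in>K. length (S v))"

definition movable :: "(nat \<Rightarrow> nat) \<Rightarrow> (nat \<Rightarrow> nat list) \<Rightarrow> nat \<Rightarrow> bool" where
  "movable c S v \<longleftrightarrow> v \<in> K \<and> 1 < length (S v) \<and> (\<forall>u. adj u v \<longrightarrow> c u = c v \<or> c u = S v ! 1)"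

lemma greedy_step_unchanged:
  assumes "rsystem K c d S" "v \<in> K" "\<not> movable c S v"
  shows "greedy_step d v (c, S q) = (c, S q)"
  using assms by (auto simp: greedy_step_def word_eq movable_def can_move_def Let_def)

lemma greedy_step_movable:
  assumes S: "rsystem K c d S" and v: "movable c S v"
  shows "\<exists>S'. rsystem K (fst (greedy_step d v (c, S q))) d S' \<and>
    S' q = snd (greedy_step d v (c, S q)) \<and> pot S' < pot S"
proof -
  have vK: "v \<in> K" "1 < length (S v)" and nb: "\<And>u. adj u v \<Longrightarrow> c u = c v \<or> c u = S v ! 1"
    using v by (auto simp: movable_def)
  note * = rsystem_step[OF K S vK nb]
  have "greedy_step d v (c, S q) = (c(v := S v ! 1), (S(v := tl (S v))) q)"
    using *(1) vK by (simp add: greedy_step_def word_eq[OF S])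
  moreover have "pot (S(v := tl (S v))) < pot S"
    unfolding pot_def by (rule sum_strict_mono_ex1) (use finite_K vK in auto)
  ultimately show ?thesis using *(2) by (intro exI[of _ "S(v := tl (S v))"]) auto
qed

text \<open>A vertex that is movable at the start is either reached in the unchanged state or
  preceded by another move; in both cases the potential drops.\<close>

lemma sweep:
  assumes "rsystem K c d S" "set vs \<subseteq> K"
  shows "\<exists>S'. rsystem K (fst (fold (greedy_step d) vs (c, S q))) d S' \<and>
    S' q = snd (fold (greedy_step d) vs (c, S q)) \<and> pot S' \<le> pot S \<and>
    ((\<exists>v\<in>set vs. movable c S v) \<longrightarrow> pot S' < pot S)"
  using assms
proof (induction vs arbitrary: c S)
  case (Cons v vs)
  show ?case
  proof (cases "movable c S v")
    case True
    from greedy_step_movable[OF Cons.prems(1) this] obtain S1 where S1: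
      "rsystem K (fst (greedy_step d v (c, S q))) d S1" "S1 q = snd (greedy_step d v (c, S q))" "pot S1 < pot S"
      by blast
    then have "greedy_step d v (c, S q) = (fst (greedy_step d v (c, S q)), S1 q)" by simp
    with Cons.IH[OF S1(1)] Cons.prems(2) S1(3) show ?thesis by (fastforce intro: le_less_trans)
  next
    case False
    then have "greedy_step d v (c, S q) = (c, S q)"
      using greedy_step_unchanged Cons.prems by auto
    with Cons.IH[OF Cons.prems(1)] Cons.prems(2) False show ?thesis by auto
  qed
qed auto

lemma sweeps:
  assumes "rsystem K c d S" "set vs = K" "pot S \<le> R"
  shows "\<forall>v\<in>K. fst ((fold (greedy_step d) vs ^^ R) (c, S q)) v = d v"
  using assms
proof (induction "R" arbitrary: c S)
  case 0
  \<comment> \<open>The walks of a system are non-empty, so potential zero is contradictory.\<close>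
  have "length (S q) = 0" using 0 finite_K q by (simp add: pot_def)
  then show ?case using 0 q by (auto simp: rsystem_def system_def)
next
  case (Suc R)
  obtain S' where S': "rsystem K (fst (fold (greedy_step d) vs (c, S q))) d S'"
    "S' q = snd (fold (greedy_step d) vs (c, S q))" "pot S' \<le> pot S"
    "(\<exists>v\<in>set vs. movable c S v) \<longrightarrow> pot S' < pot S"
    using sweep[of c d S vs] Suc.prems by auto
  have eq: "fold (greedy_step d) vs (c, S q) = (fst (fold (greedy_step d) vs (c, S q)), S' q)"
    using S'(2) by simp
  show ?case
  proof (cases "\<exists>v\<in>K. movable c S v")
    case True
    then have "pot S' \<le> R" using S'(4) Suc.prems by auto
    from Suc.IH[OF S'(1) Suc.prems(2) this] show ?thesis
      using eq by (simp add: funpow_swap1)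
  next
    case False
    \<comment> \<open>By \<open>progress\<close>, without a movable vertex no walk has a step left:
      the target is reached, and further sweeps change nothing.\<close>
    then have "length (S v) \<le> 1" if "v \<in> K" for v
      using progress[OF K Suc.prems(1) that] that by (force simp: movable_def not_le)
    then have eqd: "c v = d v" if "v \<in> K" for v
      using that Suc.prems(1) by (cases "S v") (force simp: rsystem_def system_def)+
    have "fold (greedy_step d) us (c, S q) = (c, S q)" if "set us \<subseteq> K" for us
      using that False greedy_step_unchanged[OF Suc.prems(1)] by (induction us) auto
    then have fix1: "fold (greedy_step d) vs (c, S q) = (c, S q)" using Suc.prems by simp
    have iter: "(fold (greedy_step d) vs ^^ m) (c, S q) = (c, S q)" for m
      by (induction m) (use fix1 in auto)
    show ?thesis unfolding iter using eqd by simp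
  qed
qed

text \<open>Two tree paths and \<open>Q\<close> bound every walk by \<open>2 * n + length Q\<close>
  vertices. This bounds the potential, and each sweep lowers the potential until the target is
  reached.\<close>

theorem greedy_correct:
  assumes "good c d Q" "set vs = K" "n * (2 * n + length Q) \<le> R"
  shows "\<forall>v\<in>K. fst ((fold (greedy_step d) vs ^^ R) (c, nf Q)) v = d v"
proof -
  obtain S where S: "rsystem K c d S" "S q = nf Q" using assms(1) by (auto simp: good_def)
  have "length (S v) \<le> 2 * n + length Q" if "v \<in> K" for v
  proof -
    have "S v = nf (map c (up v) @ S q @ rev (map d (up v)))"
      using word_eq[OF S(1) that] by (simp add: word_def)
    then have "length (S v) \<le> length (map c (up v) @ S q @ rev (map d (up v)))"
      by (metis length_nf_le)
    then show ?thesis using up_length[OF that] S(2) length_nf_le[of Q] by simp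
  qed
  then have "pot S \<le> card K * (2 * n + length Q)"
    unfolding pot_def using sum_bounded_above[of K "\<lambda>v. length (S v)"] by simp
  also have "card K \<le> n"
    using K card_mono[of "{..<n}" K] by (auto simp: closed_def)
  finally have "pot S \<le> R" using assms(3) by (meson le_trans mult_le_mono1)
  from sweeps[OF S(1) assms(2) this] show ?thesis using S(2) by simp
qed

lemma good_frozen:
  assumes "move\<^sup>*\<^sup>* c d" "frozen c F" "q \<in> F" "F \<subseteq> K"
  shows "good c d [c q]"
proof -
  obtain S0 where "system {..<n} c d S0" using system_of_moves[OF assms(1)] by blast
  then have S: "system K c d S0" using K by (auto simp: closed_def intro: system_mono)
  then have "S0 q \<approx> [c q]" using assms by (auto simp: system_def)
  then show ?thesis
    unfolding good_def using rsystem_nf[OF K S] by (intro exI[of _ "\<lambda>v. nf (S0 v)"]) (simp add: homot_def)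
qed

text \<open>The fundamental cycle of the edge \<open>u v\<close> at the root; the edge itself is the
  joint of the two lists.\<close>

definition cyc :: "nat \<Rightarrow> nat \<Rightarrow> nat list" where "cyc u v = rev (up u) @ up v"

lemma cyc:
  assumes "u \<in> K" "v \<in> K" "adj u v"
  shows "successively adj (cyc u v)" "cyc u v \<noteq> []" "hd (cyc u v) = q" "last (cyc u v) = q"
    "length (cyc u v) = 2 * n" "set (cyc u v) \<subseteq> K"
  using assms up_ne[of u] up_ne[of v] up_hd up_last up_set up_length up_walk[of v]
    successively_adj_rev[OF up_walk[of u]]
  by (auto simp: cyc_def successively_append_iff hd_append hd_rev last_rev)

text \<open>If the walk of every vertex is defined through its path to the root, then the condition
  along an edge is the equation of its fundamental cycle, transported along the paths. By
  \<open>nofrozen\<close> the clause of \<open>system\<close> on frozen sets imposes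
  nothing.\<close>

lemma good_conj:
  assumes c: "hom c" and d: "hom d" and nofrozen: "\<And>F. F \<subseteq> K \<Longrightarrow> frozen c F \<Longrightarrow> F = {}"
    and Q: "Q \<noteq> []" "hd Q = c q" "last Q = d q" "walk Q"
    and conj: "\<And>u v. u \<in> K \<Longrightarrow> v \<in> K \<Longrightarrow> adj u v \<Longrightarrow> map c (cyc u v) @ Q \<approx> Q @ map d (cyc u v)"
  shows "good c d Q"
proof -
  define S where "S v = map c (up v) @ Q @ rev (map d (up v))" for v
  have refl_q: "(c q, c q) \<in> E" "(d q, d q) \<in> E"
    using c d adj_refl[OF q_less] by (auto simp: hom_def)
  have edge: "S u \<approx> c u # S v @ [d u]" if uv: "adj u v" "v \<in> K" for u v
  proof -
    have u: "u \<in> K" using uv K by (auto simp: closed_def)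
    note ne = up_ne[OF u] up_ne[OF uv(2)]
    have "c u # S v @ [d u] = [c u] @ (map c (up v) @ Q @ rev (map d (up v))) @ [d u]"
      by (simp add: S_def)
    also have "\<dots> \<approx> (map c (up u) @ map c (rev (up u)) @ map c (up v)) @ (Q @ rev (map d (up v)) @ [d u])"
    proof -
      have "[c u] \<approx> map c (up u) @ map c (rev (up u))"
        using homot_append_rev[of "map c (up u)"] ne up_hd[OF u]
        by (simp add: rev_map hd_map homot_sym)
      then show ?thesis using homot_append_right by fastforce
    qed
    also have "\<dots> = map c (up u) @ (map c (cyc u v) @ Q) @ rev (map d (up v)) @ [d u]"
      by (simp add: cyc_def)
    also have "\<dots> \<approx> map c (up u) @ (Q @ map d (cyc u v)) @ rev (map d (up v)) @ [d u]"
      by (intro homot_append_left homot_append_right conj u uv)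
    also have "\<dots> = (map c (up u) @ Q @ rev (map d (up u))) @ map d (up v) @ rev (map d (up v)) @ [d u]"
      by (simp add: cyc_def rev_map)
    also have "\<dots> \<approx> (map c (up u) @ Q @ rev (map d (up u))) @ [d v] @ [d u]"
    proof -
      have "map d (up v) @ rev (map d (up v)) \<approx> [d v]"
        using homot_append_rev[of "map d (up v)"] ne up_hd[OF uv(2)] by (simp add: hd_map)
      from homot_append_left[OF homot_append_right[OF this, of "[d u]"],
          of "map c (up u) @ Q @ rev (map d (up u))"] show ?thesis by simp
    qed
    also have "\<dots> \<approx> S u"
    proof -
      obtain t where t: "up u = u # t" using ne up_hd[OF u] by (metis list.collapse)
      show ?thesis
        using homot_backtrack_append[of "map c (up u) @ Q @ rev (map d t)" "d u" "d v" "[]"]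
        by (simp add: S_def t)
    qed
    finally show ?thesis by (rule homot_sym)
  qed
  have "system K c d S"
    unfolding system_def
  proof (intro conjI ballI)
    fix v assume v: "v \<in> K"
    note ne = up_ne[OF v]
    show "S v \<noteq> []" "hd (S v) = c v" "last (S v) = d v"
      using ne Q up_hd[OF v] by (auto simp: S_def hd_append hd_map last_append last_rev)
    have "walk (map c (up v))" "walk (rev (map d (up v)))"
      using c d up_walk[OF v] by (auto intro: walk_map walk_rev)
    then show "walk (S v)"
      using Q ne refl_q up_last[OF v] by (simp add: S_def walk_append last_map hd_append hd_rev)
    show "\<forall>u. adj u v \<longrightarrow> S u \<approx> c u # S v @ [d u]" using edge v by blast
  qed (use nofrozen in blast)
  then have "rsystem K c d (\<lambda>v. nf (S v))" using K by (rule rsystem_nf[rotated])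
  moreover have "nf (S q) = nf Q"
  proof -
    have rep: "map f (up q) \<approx> [f q]" for f :: "nat \<Rightarrow> nat"
    proof -
      have "map f xs \<approx> [f q]" if "set xs \<subseteq> {q}" "xs \<noteq> []" for xs
        using that
      proof (induction xs)
        case (Cons x xs)
        show ?case
        proof (cases "xs = []")
          case False
          then have "f x # map f xs \<approx> f x # [f q]" using Cons by (intro homot_Cons) auto
          also have "\<dots> \<approx> [f q]" using Cons homot_stutter[of "f q" "[]"] by simp
          finally show ?thesis by simp
        qed (use Cons in simp)
      qed simp
      then show ?thesis using up_q up_ne[OF q] by blast
    qed
    have "S q \<approx> [c q] @ Q @ rev [d q]"
      unfolding S_def by (intro homot_append homot_rev rep homot_refl)
    also have "\<dots> \<approx> Q"
      using homot_hd_Cons[of "Q @ [d q]" "c q"] homot_last_snoc[of Q "d q"] Q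
      by (auto intro: homot_trans)
    finally show ?thesis by (simp add: homot_def)
  qed
  ultimately show ?thesis by (auto simp: good_def)
qed

definition cand :: "(nat \<Rightarrow> nat) \<Rightarrow> (nat \<Rightarrow> nat) \<Rightarrow> nat list \<Rightarrow> nat \<Rightarrow> nat \<Rightarrow> nat \<Rightarrow> nat \<Rightarrow> nat list" where
  "cand c d xs k l i j = wpow (map c xs) k @ map c (take i xs) @ rev (map d (take j xs)) @ wpow (rev (map d xs)) l"

text \<open>The first alternative covers the case that all fundamental cycles have trivial images.
  Otherwise a recolouring supplies a solution \<open>Q0\<close>, which
  \<open>simultaneous_conjugacy\<close> turns into a candidate; the bounds are those for
  \<open>L = 2 * n\<close>.\<close>

theorem good_candidate:
  assumes moves: "move\<^sup>*\<^sup>* c d" and c: "hom c"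
    and nofrozen: "\<And>F. F \<subseteq> K \<Longrightarrow> frozen c F \<Longrightarrow> F = {}"
  shows "(\<forall>Q. Q \<noteq> [] \<and> hd Q = c q \<and> last Q = d q \<and> walk Q \<longrightarrow> good c d Q) \<or>
    (\<exists>u\<in>K. \<exists>v\<in>K. \<exists>k l i j. adj u v \<and> k \<le> 16 * n + 4 \<and> l \<le> 16 * n + 4 \<and> i \<le> 2 * n \<and> j \<le> 2 * n \<and>
       good c d (cand c d (cyc u v) k l i j))"
proof -
  have d: "hom d" using moves_hom[OF moves c] .
  obtain S0 where "system {..<n} c d S0" using system_of_moves[OF moves] by blast
  then have S: "system K c d S0" using K by (auto simp: closed_def intro: system_mono)
  define Q0 where "Q0 = S0 q"
  have Q0: "Q0 \<noteq> []" "hd Q0 = c q" "last Q0 = d q" "walk Q0"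
    using S q by (auto simp: Q0_def system_def)
  have loops: "loop_at (f q) (map f (cyc u v))" "length (map f (cyc u v)) \<le> 2 * n"
    if "u \<in> K" "v \<in> K" "adj u v" for f :: "nat \<Rightarrow> nat" and u v
    using cyc[OF that] by (auto simp: loop_at_def hd_map last_map)
  have sol: "map c (cyc u v) @ Q0 \<approx> Q0 @ map d (cyc u v)" if uv: "u \<in> K" "v \<in> K" "adj u v" for u v
  proof -
    note C = cyc[OF uv]
    have "Q0 \<approx> map c (cyc u v) @ Q0 @ rev (map d (cyc u v))"
      using system_walk[OF S C(6,1,2)] C by (simp add: Q0_def)
    then have "Q0 @ map d (cyc u v) \<approx> (map c (cyc u v) @ Q0 @ rev (map d (cyc u v))) @ map d (cyc u v)"
      by (rule homot_append_right)
    also have "\<dots> = (map c (cyc u v) @ Q0) @ rev (map d (cyc u v)) @ rev (rev (map d (cyc u v))) @ []"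
      by simp
    also have "\<dots> \<approx> (map c (cyc u v) @ Q0) @ []"
      using Q0 C by (intro homot_cancel_mid) (auto simp: hd_rev last_map)
    finally show ?thesis by (simp add: homot_sym)
  qed
  show ?thesis
  proof (cases "\<exists>u\<in>K. \<exists>v\<in>K. adj u v \<and> nf (map c (cyc u v)) \<noteq> [c q]")
    case False
    \<comment> \<open>Being conjugate by \<open>Q0\<close>, the image under \<open>d\<close> is
      trivial along with the image under \<open>c\<close>.\<close>
    have triv: "map c (cyc u v) \<approx> [c q]" "map d (cyc u v) \<approx> [d q]"
      if uv: "u \<in> K" "v \<in> K" "adj u v" for u v
    proof -
      show 1: "map c (cyc u v) \<approx> [c q]" using False uv by (auto simp: homot_def nf_Cons)
      have "Q0 @ map d (cyc u v) \<approx> map c (cyc u v) @ Q0" by (rule homot_sym[OF sol[OF uv]])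
      also have "\<dots> \<approx> [c q] @ Q0" using 1 by (rule homot_append_right)
      also have "\<dots> \<approx> Q0" using Q0 homot_hd_Cons by auto
      also have "\<dots> \<approx> Q0 @ [d q]" using Q0 homot_last_snoc homot_sym by metis
      finally show "map d (cyc u v) \<approx> [d q]"
        by (rule homot_cancel_left) (use Q0 cyc[OF uv] in \<open>auto simp: hd_map\<close>)
    qed
    have "good c d Q" if Q: "Q \<noteq> []" "hd Q = c q" "last Q = d q" "walk Q" for Q
    proof (rule good_conj[OF c d nofrozen Q])
      fix u v assume uv: "u \<in> K" "v \<in> K" "adj u v"
      have "map c (cyc u v) @ Q \<approx> [c q] @ Q" using triv(1)[OF uv] by (rule homot_append_right)
      also have "\<dots> \<approx> Q" using Q homot_hd_Cons by auto
      also have "\<dots> \<approx> Q @ [d q]" using Q homot_last_snoc homot_sym by metis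
      also have "\<dots> \<approx> Q @ map d (cyc u v)" by (rule homot_append_left, rule homot_sym, rule triv(2)[OF uv])
      finally show "map c (cyc u v) @ Q \<approx> Q @ map d (cyc u v)" .
    qed
    then show ?thesis by blast
  next
    case True
    then obtain u v where uv: "u \<in> K" "v \<in> K" "adj u v" and nt: "nf (map c (cyc u v)) \<noteq> [c q]" by blast
    define w w' where "w = map c (cyc u v)" and "w' = map d (cyc u v)"
    define X where "X = {(map c (cyc u v), map d (cyc u v)) |u v. u \<in> K \<and> v \<in> K \<and> adj u v}"
    have "\<exists>k l i j. k \<le> 8 * (2 * n) + 4 \<and> l \<le> 8 * (2 * n) + 4 \<and> 0 < i \<and> i \<le> length w \<and> 0 < j \<and> j \<le> length w' \<and>
      last (take i w) = last (take j w') \<and>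
      (let Q' = wpow w k @ take i w @ rev (take j w') @ wpow (rev w') l
       in hd Q' = c q \<and> last Q' = d q \<and> (\<forall>(g, h)\<in>X. g @ Q' \<approx> Q' @ h))"
      by (rule simultaneous_conjugacy[where Q = Q0])
         (use loops uv nt Q0 sol in \<open>auto simp: X_def w_def w'_def\<close>)
    then obtain k l i j where *: "k \<le> 8 * (2 * n) + 4" "l \<le> 8 * (2 * n) + 4" "0 < i" "i \<le> length w"
      "0 < j" "j \<le> length w'" "last (take i w) = last (take j w')"
      and Q': "let Q' = wpow w k @ take i w @ rev (take j w') @ wpow (rev w') l
       in hd Q' = c q \<and> last Q' = d q \<and> (\<forall>(g, h)\<in>X. g @ Q' \<approx> Q' @ h)"
      by blast
    have eq: "cand c d (cyc u v) k l i j = wpow w k @ take i w @ rev (take j w') @ wpow (rev w') l"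
      by (simp add: cand_def w_def w'_def take_map)
    note C = cyc[OF uv]
    have ne: "w \<noteq> []" "w' \<noteq> []" using C by (auto simp: w_def w'_def)
    have hl: "hd w = c q" "last w = c q" "hd w' = d q" "last w' = d q"
      using C by (auto simp: w_def w'_def hd_map last_map)
    have refl_q: "(c q, c q) \<in> E" "(d q, d q) \<in> E"
      using c d adj_refl[OF q_less] by (auto simp: hom_def)
    have ww: "walk w" "walk w'" unfolding w_def w'_def using C c d by (auto intro: walk_map)
    \<comment> \<open>Both pieces end at the same vertex, so the candidate passes this vertex twice
      and uses its loop in \<open>E\<close>.\<close>
    have mid: "(last (take j w'), last (take j w')) \<in> E"
    proof -
      have "last (take j w') \<in> set w'" using * ne in_set_takeD[OF last_in_set[of "take j w'"]] by auto
      then obtain x where "x \<in> K" "last (take j w') = d x" using C by (auto simp: w'_def)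
      then show ?thesis using d adj_refl K by (auto simp: hom_def closed_def)
    qed
    have "walk (cand c d (cyc u v) k l i j)"
      unfolding eq
      using ww refl_q hl * ne mid
      by (cases "k = 0"; cases "l = 0")
        (auto simp: walk_append walk_wpow walk_take walk_rev hd_append hd_rev last_rev hd_wpow last_wpow
          last_append)
    then have "good c d (cand c d (cyc u v) k l i j)"
      using Q' * ne unfolding eq Let_def
      by (intro good_conj[OF c d nofrozen]) (auto simp: X_def)
    moreover have "k \<le> 16 * n + 4 \<and> l \<le> 16 * n + 4 \<and> i \<le> 2 * n \<and> j \<le> 2 * n"
      using * C(5) by (simp add: w_def w'_def)
    ultimately show ?thesis using uv by blast
  qed
qed

lemma length_cand:
  assumes "u \<in> K" "v \<in> K" "adj u v" "k \<le> 16 * n + 4" "l \<le> 16 * n + 4"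
  shows "length (cand c d (cyc u v) k l i j) \<le> 64 * n * n + 20 * n"
proof -
  have "length (cand c d (cyc u v) k l i j) \<le> k * (2 * n) + (2 * n + (2 * n + l * (2 * n)))"
    using cyc[OF assms(1-3)] by (simp add: cand_def)
  also have "\<dots> \<le> (16 * n + 4) * (2 * n) + (2 * n + (2 * n + (16 * n + 4) * (2 * n)))"
    using assms by (intro add_mono mult_le_mono) auto
  also have "\<dots> = 64 * n * n + 20 * n" by (simp add: algebra_simps)
  finally show ?thesis .
qed

end

section \<open>A language of bounded loops\<close>

datatype prog =
    PSkip
  | PPut string aexp aexp
  | PSeq prog prog
  | PIf bexp prog prog
  | PFor string prog

abbreviation V :: "string \<Rightarrow> aexp" where "V x \<equiv> Get x (Const 0)"

abbreviation PSet :: "string \<Rightarrow> aexp \<Rightarrow> prog" where "PSet x \<equiv> PPut x (Const 0)"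

text \<open>The bound of every loop is the contents of the cell \<open>N\<close>, which \<open>wf_prog\<close> protects from
  assignments, so that the running time is polynomial in it by construction.\<close>

primrec compile :: "prog \<Rightarrow> com" where
  "compile PSkip = Skip"
| "compile (PPut x a b) = Put x a b"
| "compile (PSeq p q) = Seq (compile p) (compile q)"
| "compile (PIf b p q) = If b (compile p) (compile q)"
| "compile (PFor x p) = Seq (Put x (Const 0) (Const 0))
     (While (Less (V x) (V ''N'')) (Seq (compile p) (Put x (Const 0) (Add (V x) (Const 1)))))"

primrec writes :: "prog \<Rightarrow> string set" where
  "writes PSkip = {}"
| "writes (PPut x a b) = {x}"
| "writes (PSeq p q) = writes p \<union> writes q"
| "writes (PIf b p q) = writes p \<union> writes q"
| "writes (PFor x p) = insert x (writes p)"

primrec wf_prog :: "prog \<Rightarrow> bool" where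
  "wf_prog PSkip \<longleftrightarrow> True"
| "wf_prog (PPut x a b) \<longleftrightarrow> x \<noteq> ''N''"
| "wf_prog (PSeq p q) \<longleftrightarrow> wf_prog p \<and> wf_prog q"
| "wf_prog (PIf b p q) \<longleftrightarrow> wf_prog p \<and> wf_prog q"
| "wf_prog (PFor x p) \<longleftrightarrow> wf_prog p \<and> x \<noteq> ''N'' \<and> x \<notin> writes p"

definition setc :: "memory \<Rightarrow> string \<Rightarrow> nat \<Rightarrow> memory" where
  "setc s x v = s(x := (s x)(0 := v))"

text \<open>A total semantics in place of \<open>exec\<close>: the number of rounds is known when a
  loop starts, so a loop is a fold over its index values.\<close>

primrec den :: "prog \<Rightarrow> memory \<Rightarrow> memory" where
  "den PSkip s = s"
| "den (PPut x a b) s = s(x := (s x)(aval a s := aval b s))"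
| "den (PSeq p q) s = den q (den p s)"
| "den (PIf b p q) s = (if bval b s then den p s else den q s)"
| "den (PFor x p) s =
     setc (fold (\<lambda>i s. den p (setc s x i)) [0..<s ''N'' 0] s) x (s ''N'' 0)"

text \<open>A conditional is charged for both branches, which avoids a maximum of polynomials. For a
  loop, \<open>9\<close> is \<open>3\<close> for the initial assignment plus \<open>6\<close> for
  the final test; \<open>12\<close> is \<open>6\<close> for a test plus \<open>6\<close> for the
  increment.\<close>

primrec time :: "prog \<Rightarrow> nat poly" where
  "time PSkip = [:1:]"
| "time (PPut x a b) = [:acost a + acost b + 1:]"
| "time (PSeq p q) = time p + time q"
| "time (PIf b p q) = [:bcost b + 1:] + time p + time q"
| "time (PFor x p) = [:9:] + [:0, 1:] * (time p + [:12:])"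

lemma setc_same [simp]: "setc s x v x 0 = v" by (simp add: setc_def)
lemma setc_other [simp]: "y \<noteq> x \<Longrightarrow> setc s x v y = s y" by (simp add: setc_def)
lemma setc_setc [simp]: "setc (setc s x v) x w = setc s x w" by (simp add: setc_def)

lemma den_frame: "y \<notin> writes p \<Longrightarrow> den p s y = s y"
proof (induction p arbitrary: s)
  case (PFor x p)
  have "fold (\<lambda>i s. den p (setc s x i)) is t y = t y" for "is" t
    using PFor by (induction "is" arbitrary: t) auto
  then show ?case using PFor by simp
qed auto

lemma wf_not_writes: "wf_prog p \<Longrightarrow> ''N'' \<notin> writes p"
  by (induction p) auto

theorem compile_correct:
  "wf_prog p \<Longrightarrow> \<exists>t. exec (compile p) s t (den p s) \<and> t \<le> poly (time p) (s ''N'' 0)"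
proof (induction p arbitrary: s)
  case PSkip
  then show ?case using exec.Skip by auto
next
  case (PPut x a b)
  have "exec (compile (PPut x a b)) s (acost a + acost b + 1) (den (PPut x a b) s)"
    using exec.Put by (simp only: compile.simps den.simps)
  moreover have "acost a + acost b + 1 \<le> poly (time (PPut x a b)) (s ''N'' 0)" by simp
  ultimately show ?case by blast
next
  case (PSeq p q)
  then obtain t1 t2 where "exec (compile p) s t1 (den p s)" "t1 \<le> poly (time p) (s ''N'' 0)"
    "exec (compile q) (den p s) t2 (den q (den p s))" "t2 \<le> poly (time q) (den p s ''N'' 0)"
    by (metis wf_prog.simps(3))
  then show ?case
    using exec.Seq den_frame[of "''N''" p s] wf_not_writes[of p] PSeq.prems
    by (intro exI[of _ "t1 + t2"]) auto
next
  case (PIf b p q)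
  show ?case
  proof (cases "bval b s")
    case True
    from PIf obtain t where "exec (compile p) s t (den p s)" "t \<le> poly (time p) (s ''N'' 0)"
      by auto
    then show ?thesis using True exec.IfTrue[OF True]
      by (intro exI[of _ "bcost b + 1 + t"]) auto
  next
    case False
    from PIf obtain t where "exec (compile q) s t (den q s)" "t \<le> poly (time q) (s ''N'' 0)"
      by auto
    then show ?thesis using False exec.IfFalse[OF False]
      by (intro exI[of _ "bcost b + 1 + t"]) auto
  qed
next
  case (PFor x p)
  define N where "N = s ''N'' 0"
  define F where "F i s = den p (setc s x i)" for i s
  define T where "T = poly (time p) N"
  define b where "b = Less (V x) (V ''N'')"
  define inc where "inc = Put x (Const 0) (Add (V x) (Const 1))"
  have wf: "wf_prog p" "x \<noteq> ''N''" "x \<notin> writes p" "''N'' \<notin> writes p"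
    using PFor.prems wf_not_writes[of p] by auto
  have loop: "\<exists>t. exec (While b (Seq (compile p) inc)) (setc s x i) t
      (setc (fold F [i..<N] s) x N) \<and> t \<le> 6 + (N - i) * (T + 12)"
    if "i \<le> N" "s ''N'' 0 = N" for i s
    using that
  proof (induction "N - i" arbitrary: i s)
    case 0
    then show ?case using exec.WhileFalse[of b "setc s x i" "Seq (compile p) inc"] wf
      by (intro exI[of _ "bcost b + 1"]) (auto simp: b_def)
  next
    case (Suc m)
    then have lt: "i < N" by simp
    from PFor.IH[OF wf(1), of "setc s x i"] obtain t1
      where t1: "exec (compile p) (setc s x i) t1 (F i s)" "t1 \<le> T"
      using wf Suc.prems by (auto simp: F_def T_def)
    have x: "F i s x 0 = i" "F i s ''N'' 0 = N"
      using den_frame wf Suc.prems by (auto simp: F_def)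
    have "exec inc (F i s) 6 (setc (F i s) x (Suc i))"
      using exec.Put[of x "Const 0" "Add (V x) (Const 1)" "F i s"] x
      by (simp add: inc_def setc_def eval_nat_numeral)
    then have body: "exec (Seq (compile p) inc) (setc s x i) (t1 + 6) (setc (F i s) x (Suc i))"
      by (rule exec.Seq[OF t1(1)])
    have "m = N - Suc i" "Suc i \<le> N" using Suc.hyps(2) lt by auto
    from Suc.hyps(1)[of "Suc i" "F i s", OF this x(2)] obtain t2 where
      t2: "exec (While b (Seq (compile p) inc)) (setc (F i s) x (Suc i)) t2
        (setc (fold F [Suc i..<N] (F i s)) x N)" "t2 \<le> 6 + (N - Suc i) * (T + 12)"
      by blast
    have b: "bval b (setc s x i)" using lt Suc.prems wf by (simp add: b_def)
    have "exec (While b (Seq (compile p) inc)) (setc s x i) (bcost b + 1 + (t1 + 6) + t2)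
        (setc (fold F [i..<N] s) x N)"
      using exec.WhileTrue[OF b body t2(1)] lt by (simp add: upt_conv_Cons)
    moreover have "bcost b + 1 + (t1 + 6) + t2 \<le> 6 + (N - i) * (T + 12)"
    proof -
      have "N - i = Suc (N - Suc i)" using lt by simp
      then show ?thesis using t1(2) t2(2) by (simp add: b_def)
    qed
    ultimately show ?case by blast
  qed
  have init: "exec (Put x (Const 0) (Const 0)) s 3 (setc s x 0)"
    using exec.Put[of x "Const 0" "Const 0" s] by (simp add: setc_def eval_nat_numeral)
  have "s ''N'' 0 = N" by (simp add: N_def)
  from loop[of 0 s, OF le0 this] obtain t where
    t: "exec (While b (Seq (compile p) inc)) (setc s x 0) t (setc (fold F [0..<N] s) x N)"
      "t \<le> 6 + N * (T + 12)"
    by auto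
  have "den (PFor x p) s = setc (fold F [0..<N] s) x N"
    by (simp only: den.simps F_def[abs_def] N_def)
  moreover have "compile (PFor x p) = Seq (Put x (Const 0) (Const 0)) (While b (Seq (compile p) inc))"
    by (simp only: compile.simps b_def inc_def)
  ultimately have "exec (compile (PFor x p)) s (3 + t) (den (PFor x p) s)"
    using exec.Seq[OF init t(1)] by (simp only:)
  moreover have "3 + t \<le> poly (time (PFor x p)) (s ''N'' 0)"
    using t(2) by (simp add: T_def N_def)
  ultimately show ?case by blast
qed

section \<open>Loop invariants and exhaustive search\<close>

lemma fold_upt_invariant:
  assumes "I 0 s" "\<And>i t. i < N \<Longrightarrow> I i t \<Longrightarrow> I (Suc i) (f i t)"
  shows "I N (fold f [0..<N] s)"
  using assms(2)
proof (induction N)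
  case (Suc N)
  then have "I N (fold f [0..<N] s)" by simp
  then show ?case using Suc.prems by simp
qed (use assms(1) in simp)

text \<open>The loop rule for all correctness proofs below: besides the invariant, each round may
  rely on the unchanged contents of every array that the loop does not write.\<close>

lemma den_for:
  assumes "s ''N'' 0 = N" and "I 0 s"
    and "\<And>i t. i < N \<Longrightarrow> I i t \<Longrightarrow> (\<And>y. y \<notin> writes (PFor x p) \<Longrightarrow> t y = s y) \<Longrightarrow>
      I (Suc i) (den p (setc t x i))"
  shows "\<exists>t. den (PFor x p) s = setc t x N \<and> I N t \<and> (\<forall>y. y \<notin> writes (PFor x p) \<longrightarrow> t y = s y)"
proof -
  define J where "J i t \<longleftrightarrow> I i t \<and> (\<forall>y. y \<notin> writes (PFor x p) \<longrightarrow> t y = s y)" for i t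
  have "J N (fold (\<lambda>i t. den p (setc t x i)) [0..<N] s)"
  proof (rule fold_upt_invariant[where I = J])
    show "J 0 s" using assms by (simp add: J_def)
    fix i t assume "i < N" "J i t"
    then show "J (Suc i) (den p (setc t x i))"
      using assms(3)[of i t] den_frame[of _ p "setc t x i"] by (auto simp: J_def)
  qed
  then show ?thesis using assms(1) by (auto simp: J_def)
qed

primrec fors :: "string list \<Rightarrow> prog \<Rightarrow> prog" where
  "fors [] p = p"
| "fors (x # xs) p = PFor x (fors xs p)"

lemma writes_fors: "writes (fors xs p) = set xs \<union> writes p"
  by (induction xs) auto

lemma wf_fors:
  "wf_prog (fors xs p) \<longleftrightarrow> wf_prog p \<and> distinct xs \<and> set xs \<inter> insert ''N'' (writes p) = {}"
  by (induction xs) (auto simp: writes_fors)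

lemma fors_preserve:
  assumes "\<And>s. I s \<Longrightarrow> I (den p s)" "\<And>s x v. x \<in> set xs \<Longrightarrow> I s \<Longrightarrow> I (setc s x v)"
  shows "I s \<Longrightarrow> I (den (fors xs p) s)"
  using assms(2)
proof (induction xs arbitrary: s)
  case (Cons x xs)
  have "I (fold (\<lambda>i t. den (fors xs p) (setc t x i)) is t)" if "I t" for "is" t
    using that by (induction "is" arbitrary: t) (use Cons in auto)
  then show ?case using Cons.prems by simp
qed (use assms(1) in simp)

text \<open>Nested loops visit every tuple of indices below \<open>N\<close>, hence also the tuple
  \<open>val\<close>. From that moment on \<open>D\<close> holds, and no later round destroys it;
  \<open>I\<close> keeps all rounds comparable.\<close>

lemma fors_search:
  assumes "I s" "distinct xs" "set xs \<inter> writes p = {}" "\<And>x. x \<in> set xs \<Longrightarrow> val x < N"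
    and N: "\<And>s. I s \<Longrightarrow> s ''N'' 0 = N"
    and I: "\<And>s. I s \<Longrightarrow> I (den p s)" "\<And>s x v. x \<in> set xs \<Longrightarrow> I s \<Longrightarrow> I (setc s x v)"
    and D: "\<And>s. I s \<Longrightarrow> D s \<Longrightarrow> D (den p s)" "\<And>s x v. x \<in> set xs \<Longrightarrow> D s \<Longrightarrow> D (setc s x v)"
    and hit: "\<And>s. I s \<Longrightarrow> (\<forall>x\<in>set xs. s x 0 = val x) \<Longrightarrow> D (den p s)"
  shows "D (den (fors xs p) s)"
  using assms
proof (induction xs arbitrary: s I)
  case Nil
  then show ?case by simp
next
  case (Cons x xs)
  note prems = Cons.prems
  let ?f = "\<lambda>i t. den (fors xs p) (setc t x i)"
  have ID: "I (?f i t)" "D t \<Longrightarrow> D (?f i t)" if "I t" for i t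
  proof -
    show "I (?f i t)"
      by (rule fors_preserve[of I p xs]) (use prems(6,7) that in auto)
    assume "D t"
    have "I (?f i t) \<and> D (?f i t)"
      by (rule fors_preserve[of "\<lambda>s. I s \<and> D s" p xs]) (use prems(6-9) that \<open>D t\<close> in auto)
    then show "D (?f i t)" by simp
  qed
  \<comment> \<open>For the inner loops the invariant also fixes the outer index at
    \<open>val x\<close>, so that the tuple is complete when the innermost body runs.\<close>
  have hitx: "D (?f (val x) t)" if "I t" for t
  proof (rule Cons.IH[of "\<lambda>s. I s \<and> s x 0 = val x"])
    show "I (setc t x (val x)) \<and> setc t x (val x) x 0 = val x" using prems that by auto
    fix s assume "I s \<and> s x 0 = val x"
    then show "I (den p s) \<and> den p s x 0 = val x" using prems den_frame[of x p s] by auto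
  next
    fix s y v assume "y \<in> set xs" "I s \<and> s x 0 = val x"
    then show "I (setc s y v) \<and> setc s y v x 0 = val x" using prems(2,7) by (cases "y = x") auto
  qed (use prems in auto)
  have "I (fold ?f [0..<m] s) \<and> (val x < m \<longrightarrow> D (fold ?f [0..<m] s))" for m
  proof (induction m)
    case (Suc m)
    then show ?case using ID[of "fold ?f [0..<m] s" m] hitx[of "fold ?f [0..<m] s"]
      by (cases "val x = m") auto
  qed (use prems in auto)
  then show ?case using prems by simp
qed

section \<open>Computing the next move\<close>

abbreviation Ne :: aexp where "Ne \<equiv> Get ''in'' (Const 0)"

text \<open>Without multiplication the beginning of a row of the adjacency matrix cannot be computed
  on the spot; it is looked up in the table \<open>row\<close>, which \<open>p_rows\<close>
  prepares.\<close>

abbreviation adjx :: "aexp \<Rightarrow> aexp \<Rightarrow> bexp" where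
  "adjx a b \<equiv> Equal (Get ''in'' (Add (Get ''row'' a) b)) (Const 1)"

text \<open>\<open>H\<close> is fixed, so its edge relation is unrolled into a constant expression,
  a disjunction written with \<open>Not\<close> and \<open>And\<close>.\<close>

primrec edgex :: "(nat \<times> nat) list \<Rightarrow> aexp \<Rightarrow> aexp \<Rightarrow> bexp" where
  "edgex [] a b = Less (Const 0) (Const 0)"
| "edgex (e # es) a b = Not (And (Not (And (Equal a (Const (fst e))) (Equal b (Const (snd e)))))
     (Not (edgex es a b)))"

lemma bval_edgex: "bval (edgex es a b) s \<longleftrightarrow> (aval a s, aval b s) \<in> set es"
  by (induction es) auto

definition push :: "string \<Rightarrow> string \<Rightarrow> aexp \<Rightarrow> prog" where
  "push arr len e =
     PIf (And (Less (Const 0) (V len)) (Equal (Get arr (Sub (V len) (Const 1))) e)) PSkip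
      (PIf (And (Less (Const 1) (V len)) (Equal (Get arr (Sub (V len) (Const 2))) e))
        (PSet len (Sub (V len) (Const 1)))
        (PSeq (PPut arr (V len) e) (PSet len (Add (V len) (Const 1)))))"

definition stack :: "string \<Rightarrow> string \<Rightarrow> memory \<Rightarrow> nat list" where
  "stack arr len s = map (s arr) [0..<s len 0]"

lemma writes_push [simp]: "writes (push arr len e) = {arr, len}"
  by (auto simp: push_def)

lemma wf_push [simp]: "wf_prog (push arr len e) \<longleftrightarrow> arr \<noteq> ''N'' \<and> len \<noteq> ''N''"
  by (auto simp: push_def)

lemma stack_push:
  assumes "arr \<noteq> len"
  shows "stack arr len (den (push arr len e) s) = pushr (stack arr len s) (aval e s)"
proof (cases "s len 0")
  case 0
  then show ?thesis using assms by (simp add: push_def stack_def pushr_def)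
next
  case (Suc m)
  have last: "last (stack arr len s) = s arr m" "stack arr len s \<noteq> []" using Suc by (auto simp: stack_def)
  have len: "length (stack arr len s) = Suc m" using Suc by (simp add: stack_def)
  have nth: "stack arr len s ! (m - 1) = s arr (m - 1)" if "0 < m" using that Suc by (simp add: stack_def nth_append)
  have butlast: "butlast (stack arr len s) = map (s arr) [0..<m]" using Suc by (simp add: stack_def)
  show ?thesis
    unfolding pushr_def
    using assms Suc last len nth butlast
    by (auto simp: push_def stack_def)
qed

text \<open>A loop of pushes is a \<open>foldl pushr\<close>; with \<open>foldl_pushr_Nil\<close>
  this is how the program computes normal forms.\<close>

lemma push_for:
  assumes N: "s ''N'' 0 = N" and dist: "arr \<noteq> len" "x \<noteq> arr" "x \<noteq> len"
    and C: "\<And>i t. i < N \<Longrightarrow> (\<And>y. y \<notin> {x, arr, len} \<Longrightarrow> t y = s y) \<Longrightarrow> t x 0 = i \<Longrightarrow> bval c t \<longleftrightarrow> C i"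
    and f: "\<And>i t. i < N \<Longrightarrow> (\<And>y. y \<notin> {x, arr, len} \<Longrightarrow> t y = s y) \<Longrightarrow> t x 0 = i \<Longrightarrow> C i \<Longrightarrow> aval e t = f i"
  shows "stack arr len (den (PFor x (PIf c (push arr len e) PSkip)) s) =
    foldl pushr (stack arr len s) (map f (filter C [0..<N]))"
proof -
  define I where "I i t \<longleftrightarrow>
     stack arr len t = foldl pushr (stack arr len s) (map f (filter C [0..<i]))" for i t
  let ?p = "PIf c (push arr len e) PSkip"
  have "\<exists>t. den (PFor x ?p) s = setc t x N \<and> I N t \<and> (\<forall>y. y \<notin> writes (PFor x ?p) \<longrightarrow> t y = s y)"
  proof (rule den_for[where I = I and s = s and N = N, OF N])
    fix i t assume i: "i < N" and I: "I i t"
      and fr: "\<And>y. y \<notin> writes (PFor x (PIf c (push arr len e) PSkip)) \<Longrightarrow> t y = s y"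
    have fr': "setc t x i y = s y" if "y \<notin> {x, arr, len}" for y using fr that by simp
    have st: "stack arr len (setc t x i) = stack arr len t" using dist by (simp add: stack_def)
    have "bval c (setc t x i) \<longleftrightarrow> C i" by (rule C[OF i fr']) simp_all
    moreover have "aval e (setc t x i) = f i" if "C i" by (rule f[OF i fr' _ that]) simp_all
    ultimately show "I (Suc i) (den (PIf c (push arr len e) PSkip) (setc t x i))"
      using I st stack_push[OF dist(1), of e "setc t x i"] by (simp add: I_def)
  qed (simp add: I_def)
  then obtain t where t: "den (PFor x ?p) s = setc t x N" "I N t" by blast
  have "stack arr len (setc t x N) = stack arr len t" using dist by (simp add: stack_def)
  then show ?thesis using t by (simp add: I_def)
qed

lemma filter_upt: "b \<le> N \<Longrightarrow> filter (\<lambda>i. a \<le> i \<and> i < b) [0..<N] = [a..<b]"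
proof (cases "a \<le> b")
  case True
  assume "b \<le> N"
  then have "[0..<N] = [0..<a] @ [a..<b] @ [b..<N]"
    using True upt_add_eq_append[of 0 a "N - a"] upt_add_eq_append[of a b "N - b"] by simp
  moreover have "filter (\<lambda>i. a \<le> i \<and> i < b) [a..<b] = [a..<b]" by (rule filter_True) auto
  ultimately show ?thesis by (auto simp: filter_empty_conv)
qed (auto simp: filter_empty_conv)

lemma filter_upt_less: "b \<le> N \<Longrightarrow> filter (\<lambda>i. i < b) [0..<N] = [0..<b]"
  using filter_upt[of b N 0] by simp

lemma foldl_pushr_Nil: "foldl pushr [] ys = nf ys"
  using foldl_pushr[of "[]" ys] by simp

section \<open>Tree paths and the remaining walk of a vertex\<close>

definition p_path :: "string \<Rightarrow> aexp \<Rightarrow> prog" where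
  "p_path arr e = PSeq (PSet ''t'' e) (PFor ''a'' (PIf (Less (V ''a'') Ne)
     (PSeq (PPut arr (V ''a'') (V ''t'')) (PSet ''t'' (Get ''par'' (V ''t'')))) PSkip))"

text \<open>The parent pointer is followed a fixed number of times. As the root will be its own
  parent, this produces the padded paths of \<open>rooted_graph\<close>.\<close>

definition up_path :: "memory \<Rightarrow> nat \<Rightarrow> nat list" where
  "up_path s v = map (\<lambda>j. (s ''par'' ^^ j) v) [0..<s ''in'' 0]"

lemma writes_path [simp]: "writes (p_path arr e) = {''t'', ''a'', arr}"
  by (auto simp: p_path_def)

lemma wf_path [simp]: "wf_prog (p_path arr e) \<longleftrightarrow> arr \<noteq> ''N'' \<and> arr \<noteq> ''a''"
  by (auto simp: p_path_def)

lemma den_path: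
  assumes n: "s ''in'' 0 = n" "s ''N'' 0 = N" "n \<le> N" and arr: "arr \<notin> {''t'', ''a'', ''par'', ''in'', ''N''}"
    and j: "j < n"
  shows "den (p_path arr e) s arr j = (s ''par'' ^^ j) (aval e s)"
proof -
  define s0 where "s0 = den (PSet ''t'' e) s"
  \<comment> \<open>Every loop runs \<open>N\<close> times, but only the first \<open>n\<close>
    rounds act, hence \<open>min i n\<close>.\<close>
  define I where "I i t \<longleftrightarrow> t ''t'' 0 = (s ''par'' ^^ min i n) (aval e s) \<and>
     (\<forall>j<min i n. t arr j = (s ''par'' ^^ j) (aval e s))" for i t
  let ?p = "PIf (Less (V ''a'') Ne) (PSeq (PPut arr (V ''a'') (V ''t'')) (PSet ''t'' (Get ''par'' (V ''t'')))) PSkip"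
  have s0: "s0 ''N'' 0 = N" "s0 ''in'' = s ''in''" "s0 ''par'' = s ''par''" "s0 ''t'' 0 = aval e s"
    using n by (auto simp: s0_def)
  have "\<exists>t. den (PFor ''a'' ?p) s0 = setc t ''a'' N \<and> I N t \<and> (\<forall>y. y \<notin> writes (PFor ''a'' ?p) \<longrightarrow> t y = s0 y)"
  proof (rule den_for[where I = I and s = s0 and N = N, OF s0(1)])
    show "I 0 s0" using s0 by (simp add: I_def)
    fix i t assume i: "i < N" and I: "I i t" and fr: "\<And>y. y \<notin> writes (PFor ''a'' ?p) \<Longrightarrow> t y = s0 y"
    have *: "t ''in'' = s ''in''" "t ''par'' = s ''par''" using fr[of "''in''"] fr[of "''par''"] arr s0 by auto
    show "I (Suc i) (den ?p (setc t ''a'' i))"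
    proof (cases "i < n")
      case True
      then have "min i n = i" "min (Suc i) n = Suc i" by auto
      then show ?thesis using True I arr * n by (auto simp: I_def less_Suc_eq)
    next
      case False
      then have "min i n = n" "min (Suc i) n = n" by auto
      then show ?thesis using False I arr * n by (auto simp: I_def)
    qed
  qed
  then obtain t where t: "den (PFor ''a'' ?p) s0 = setc t ''a'' N" "I N t" by blast
  show ?thesis
    using t arr n j by (auto simp: p_path_def I_def s0_def)
qed

lemma map_den_path:
  assumes "s ''in'' 0 \<le> s ''N'' 0" and "arr \<notin> {''t'', ''a'', ''par'', ''in'', ''N''}"
  shows "map (den (p_path arr e) s arr) [0..<s ''in'' 0] = up_path s (aval e s)"
  unfolding up_path_def using den_path[of s "s ''in'' 0" "s ''N'' 0" arr _ e] assms by auto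

definition p_word :: prog where
  "p_word = PSeq (PSet ''wl'' (Const 0)) (PSeq (p_path ''pa'' (V ''v''))
    (PSeq (PFor ''a'' (PIf (Less (V ''a'') Ne) (push ''W'' ''wl'' (Get ''try'' (Get ''pa'' (V ''a'')))) PSkip))
    (PSeq (PFor ''a'' (PIf (And (Not (Less (V ''a'') (V ''qs''))) (Less (V ''a'') (V ''ql'')))
             (push ''W'' ''wl'' (Get ''Q'' (V ''a''))) PSkip))
          (PFor ''a'' (PIf (Less (V ''a'') Ne)
             (push ''W'' ''wl'' (Get ''psi'' (Get ''pa'' (Sub (Sub Ne (Const 1)) (V ''a''))))) PSkip)))))"

lemma writes_word [simp]: "writes p_word = {''wl'', ''W'', ''pa'', ''t'', ''a''}"
  by (auto simp: p_word_def)

lemma wf_word [simp]: "wf_prog p_word"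
  by (simp add: p_word_def)

text \<open>Dropping the first vertex of the root walk means advancing the pointer
  \<open>qs\<close>; hence the walk is a window of the array.\<close>

definition Qlist :: "memory \<Rightarrow> nat list" where
  "Qlist s = map (s ''Q'') [s ''qs'' 0..<s ''ql'' 0]"

lemma rev_upt_map: "map (\<lambda>i. f (n - 1 - i)) [0..<n] = rev (map f [0..<n])"
  by (rule nth_equalityI) (auto simp: rev_nth)

lemma stack_word:
  assumes n: "s ''in'' 0 = n" and N: "s ''N'' 0 = N" and nN: "n \<le> N" and ql: "s ''ql'' 0 \<le> N"
  shows "stack ''W'' ''wl'' (den p_word s) =
    nf (map (s ''try'') (up_path s (s ''v'' 0)) @ Qlist s @ rev (map (s ''psi'') (up_path s (s ''v'' 0))))"
proof -
  define s1 where "s1 = den (PSet ''wl'' (Const 0)) s"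
  define s2 where "s2 = den (p_path ''pa'' (V ''v'')) s1"
  define up where "up = up_path s (s ''v'' 0)"
  have fr2: "s2 y = s y" if "y \<notin> {''wl'', ''pa'', ''t'', ''a''}" for y
    using that by (simp add: s2_def s1_def den_frame)
  have pa: "map (s2 ''pa'') [0..<n] = up"
    using map_den_path[of s1 "''pa''" "V ''v''"] n N nN
    by (simp add: s2_def s1_def up_def up_path_def)
  have st2: "stack ''W'' ''wl'' s2 = []"
    using den_frame[of "''wl''" "p_path ''pa'' (V ''v'')" s1] by (simp add: s2_def s1_def stack_def)
  let ?l1 = "PFor ''a'' (PIf (Less (V ''a'') Ne) (push ''W'' ''wl'' (Get ''try'' (Get ''pa'' (V ''a'')))) PSkip)"
  let ?l2 = "PFor ''a'' (PIf (And (Not (Less (V ''a'') (V ''qs''))) (Less (V ''a'') (V ''ql'')))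
             (push ''W'' ''wl'' (Get ''Q'' (V ''a''))) PSkip)"
  let ?l3 = "PFor ''a'' (PIf (Less (V ''a'') Ne)
             (push ''W'' ''wl'' (Get ''psi'' (Get ''pa'' (Sub (Sub Ne (Const 1)) (V ''a''))))) PSkip)"
  define s3 where "s3 = den ?l1 s2"
  define s4 where "s4 = den ?l2 s3"
  have fr3: "s3 y = s2 y" if "y \<notin> {''W'', ''wl'', ''a''}" for y
    unfolding s3_def by (rule den_frame) (use that in auto)
  have fr4: "s4 y = s2 y" if "y \<notin> {''W'', ''wl'', ''a''}" for y
    unfolding s4_def using den_frame[of y ?l2 s3] fr3 that by auto
  have "stack ''W'' ''wl'' s3 = foldl pushr (stack ''W'' ''wl'' s2)
      (map (\<lambda>i. s ''try'' (s2 ''pa'' i)) (filter (\<lambda>i. i < n) [0..<N]))"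
    unfolding s3_def
    by (rule push_for) (simp_all add: n N fr2 not_less)
  then have s3: "stack ''W'' ''wl'' s3 = foldl pushr [] (map (s ''try'') up)"
    using st2 nN pa[symmetric] by (simp add: filter_upt_less comp_def)
  have "stack ''W'' ''wl'' s4 = foldl pushr (stack ''W'' ''wl'' s3)
      (map (s ''Q'') (filter (\<lambda>i. s ''qs'' 0 \<le> i \<and> i < s ''ql'' 0) [0..<N]))"
    unfolding s4_def
    by (rule push_for) (simp_all add: n N fr2 fr3 not_less)
  then have s4: "stack ''W'' ''wl'' s4 = foldl pushr [] (map (s ''try'') up @ Qlist s)"
    using s3 ql by (simp add: filter_upt Qlist_def)
  have "stack ''W'' ''wl'' (den ?l3 s4) = foldl pushr (stack ''W'' ''wl'' s4)
      (map (\<lambda>i. s ''psi'' (s2 ''pa'' (n - 1 - i))) (filter (\<lambda>i. i < n) [0..<N]))"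
    by (rule push_for) (simp_all add: n N fr2 fr4 not_less)
  also have "map (\<lambda>i. s ''psi'' (s2 ''pa'' (n - 1 - i))) (filter (\<lambda>i. i < n) [0..<N]) =
      rev (map (s ''psi'') up)"
    using nN rev_upt_map[of "\<lambda>i. s ''psi'' (s2 ''pa'' i)" n] pa[symmetric]
    by (simp add: filter_upt_less comp_def)
  finally have "stack ''W'' ''wl'' (den ?l3 s4) =
      foldl pushr [] (map (s ''try'') up @ Qlist s @ rev (map (s ''psi'') up))"
    using s4 by simp
  moreover have "den p_word s = den ?l3 s4"
    by (simp add: p_word_def s1_def s2_def s3_def s4_def)
  ultimately show ?thesis by (simp only: up_def foldl_pushr_Nil)
qed

section \<open>One greedy step on the machine\<close>

definition p_greedy :: "(nat \<times> nat) list \<Rightarrow> prog" where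
  "p_greedy es = PSeq p_word (PIf (Less (Const 1) (V ''wl''))
    (PSeq (PSet ''ok'' (Const 1))
    (PSeq (PFor ''b'' (PIf (And (Less (V ''b'') Ne) (And (adjx (V ''b'') (V ''v''))
             (And (Not (Equal (Get ''try'' (V ''b'')) (Get ''try'' (V ''v''))))
                  (Not (Equal (Get ''try'' (V ''b'')) (Get ''W'' (Const 1)))))))
           (PSet ''ok'' (Const 0)) PSkip))
     (PIf (And (Equal (V ''ok'') (Const 1)) (edgex es (Get ''try'' (V ''v'')) (Get ''W'' (Const 1))))
        (PSeq (PPut ''try'' (V ''v'') (Get ''W'' (Const 1)))
              (PIf (Equal (V ''v'') (V ''q'')) (PSet ''qs'' (Add (V ''qs'') (Const 1))) PSkip))
        PSkip))) PSkip)"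

lemma writes_greedy [simp]:
  "writes (p_greedy es) = {''wl'', ''W'', ''pa'', ''t'', ''a'', ''ok'', ''b'', ''try'', ''qs''}"
  by (auto simp: p_greedy_def)

lemma wf_greedy [simp]: "wf_prog (p_greedy es)"
  by (simp add: p_greedy_def)

lemma flag_for:
  assumes N: "s ''N'' 0 = N" and x: "x \<noteq> y"
    and C: "\<And>i t. i < N \<Longrightarrow> (\<And>z. z \<notin> {x, y} \<Longrightarrow> t z = s z) \<Longrightarrow> t x 0 = i \<Longrightarrow> bval c t \<longleftrightarrow> C i"
  shows "den (PFor x (PIf c (PSet y (Const 0)) PSkip)) s y 0 = (if \<exists>i<N. C i then 0 else s y 0)"
proof -
  define I where "I i t \<longleftrightarrow> t y 0 = (if \<exists>j<i. C j then 0 else s y 0)" for i and t :: memory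
  let ?p = "PIf c (PSet y (Const 0)) PSkip"
  have "\<exists>t. den (PFor x ?p) s = setc t x N \<and> I N t \<and> (\<forall>z. z \<notin> writes (PFor x ?p) \<longrightarrow> t z = s z)"
  proof (rule den_for[where I = I and s = s and N = N, OF N])
    fix i t assume i: "i < N" and I: "I i t"
      and fr: "\<And>z. z \<notin> writes (PFor x (PIf c (PSet y (Const 0)) PSkip)) \<Longrightarrow> t z = s z"
    have "bval c (setc t x i) \<longleftrightarrow> C i" by (rule C) (use i fr in auto)
    then show "I (Suc i) (den (PIf c (PSet y (Const 0)) PSkip) (setc t x i))"
      using I x by (auto simp: I_def less_Suc_eq)
  qed (simp add: I_def)
  then obtain t where t: "den (PFor x ?p) s = setc t x N" "I N t" by blast
  then show ?thesis using x by (simp add: I_def)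
qed

locale recol_machine = recol_graph n adj E for n adj E +
  fixes N :: nat and es :: "(nat \<times> nat) list" and d :: "nat \<Rightarrow> nat"
  assumes es: "set es = E" and nN: "n \<le> N"
begin

definition env :: "memory \<Rightarrow> bool" where
  "env s \<longleftrightarrow> s ''in'' 0 = n \<and> s ''N'' 0 = N \<and> s ''psi'' = d \<and>
     (\<forall>u<n. \<forall>v<n. s ''in'' (s ''row'' u + v) = 1 \<longleftrightarrow> adj u v)"

lemma env_cong:
  "s ''in'' = s' ''in'' \<Longrightarrow> s ''N'' = s' ''N'' \<Longrightarrow> s ''psi'' = s' ''psi'' \<Longrightarrow> s ''row'' = s' ''row'' \<Longrightarrow>
   env s \<longleftrightarrow> env s'"
  by (simp add: env_def)

lemma env_setc: "x \<notin> {''in'', ''N'', ''psi'', ''row''} \<Longrightarrow> env (setc s x v) \<longleftrightarrow> env s"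
  by (rule env_cong) auto

text \<open>\<open>p_tree\<close> gives discovered vertices a positive level, so after a complete
  search this is the component of the root.\<close>

definition root_set :: "memory \<Rightarrow> nat set" where
  "root_set s = {v. v < n \<and> 0 < s ''lev'' v}"

definition rooted :: "memory \<Rightarrow> bool" where
  "rooted s \<longleftrightarrow> rooted_graph n adj E (s ''q'' 0) (root_set s) (up_path s)"

definition pair :: "memory \<Rightarrow> (nat \<Rightarrow> nat) \<times> nat list" where
  "pair s = (s ''try'', Qlist s)"

lemma greedy_den:
  assumes env: "env s" and r: "rooted s" and v: "s ''v'' 0 \<in> root_set s" and ql: "s ''ql'' 0 \<le> N"
  shows "pair (den (p_greedy es) s) =
    rooted_graph.greedy_step n adj E (s ''q'' 0) (up_path s) d (s ''v'' 0) (pair s)"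
proof -
  interpret rooted_graph n adj E "s ''q'' 0" "root_set s" "up_path s" using r by (simp add: rooted_def)
  define v where "v = s ''v'' 0"
  have vn: "v < n" using v by (auto simp: v_def root_set_def)
  define s1 where "s1 = den p_word s"
  define W where "W = stack ''W'' ''wl'' s1"
  have W: "W = word (s ''try'') d (Qlist s) v"
    using stack_word[of s n N] env ql nN by (simp add: W_def s1_def word_def env_def v_def)
  have fr1: "s1 y = s y" if "y \<notin> {''wl'', ''W'', ''pa'', ''t'', ''a''}" for y
    using that by (simp add: s1_def den_frame)
  have lenW: "length W = s1 ''wl'' 0" by (simp add: W_def stack_def)
  have W1: "s1 ''W'' 1 = W ! 1" if "1 < length W" using that by (simp add: W_def stack_def)
  show ?thesis
  proof (cases "1 < length W")
    case False
    have "den (p_greedy es) s = s1" using False lenW by (simp add: p_greedy_def s1_def)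
    then show ?thesis using False W
      by (simp add: pair_def fr1 Qlist_def greedy_step_def v_def Let_def)
  next
    case True
    define s2 where "s2 = den (PSet ''ok'' (Const 1)) s1"
    let ?c = "And (Less (V ''b'') Ne) (And (adjx (V ''b'') (V ''v''))
             (And (Not (Equal (Get ''try'' (V ''b'')) (Get ''try'' (V ''v''))))
                  (Not (Equal (Get ''try'' (V ''b'')) (Get ''W'' (Const 1))))))"
    define s3 where "s3 = den (PFor ''b'' (PIf ?c (PSet ''ok'' (Const 0)) PSkip)) s2"
    have fr2: "s2 y = s1 y" if "y \<noteq> ''ok''" for y using that by (simp add: s2_def)
    have fr3: "s3 y = s1 y" if "y \<notin> {''ok'', ''b''}" for y
      unfolding s3_def using den_frame[of y "PFor ''b'' (PIf ?c (PSet ''ok'' (Const 0)) PSkip)" s2] that fr2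
      by auto
    have ok: "s3 ''ok'' 0 = (if \<exists>u<N. u < n \<and> adj u v \<and> s ''try'' u \<noteq> s ''try'' v \<and> s ''try'' u \<noteq> W ! 1
        then 0 else s2 ''ok'' 0)"
      unfolding s3_def
    proof (rule flag_for)
      show "s2 ''N'' 0 = N" using env fr1 fr2 by (simp add: env_def)
      fix i t assume i: "i < N" and fr: "\<And>z. z \<notin> {''b'', ''ok''} \<Longrightarrow> t z = s2 z" and b: "t ''b'' 0 = i"
      have fr': "t z = s1 z" if "z \<notin> {''b'', ''ok''}" for z using fr fr2 that by auto
      show "bval ?c t \<longleftrightarrow> i < n \<and> adj i v \<and> s ''try'' i \<noteq> s ''try'' v \<and> s ''try'' i \<noteq> W ! 1"
        using env vn W1[OF True] b fr' fr1 by (auto simp: env_def v_def)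
    qed simp
    have can: "can_move (s ''try'') v (W ! 1) \<longleftrightarrow> s3 ''ok'' 0 = 1 \<and> (s ''try'' v, W ! 1) \<in> E"
      using ok vn nN adj_less by (auto simp: can_move_def s2_def) (use less_le_trans in blast)+
    have test: "bval (And (Equal (V ''ok'') (Const 1)) (edgex es (Get ''try'' (V ''v'')) (Get ''W'' (Const 1)))) s3
        \<longleftrightarrow> can_move (s ''try'') v (W ! 1)"
      using can W1[OF True] fr3 fr1 es by (simp add: bval_edgex v_def)
    have upt: "map f [Suc a..<b] = tl (map f [a..<b])" for f :: "nat \<Rightarrow> nat" and a b
      by (cases "a < b") (simp_all add: upt_conv_Cons)
    have "den (p_greedy es) s = (if can_move (s ''try'') v (W ! 1) then
        den (PSeq (PPut ''try'' (V ''v'') (Get ''W'' (Const 1)))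
              (PIf (Equal (V ''v'') (V ''q'')) (PSet ''qs'' (Add (V ''qs'') (Const 1))) PSkip)) s3 else s3)"
      using True lenW test by (simp add: p_greedy_def s1_def s2_def s3_def)
    then show ?thesis
      using True W W1[OF True] fr3 fr1 upt
      by (auto simp: pair_def greedy_step_def Let_def Qlist_def v_def)
  qed
qed

end

section \<open>Running the greedy procedure\<close>

context rooted_graph
begin

lemma can_move_moves: "can_move c v b \<Longrightarrow> move\<^sup>*\<^sup>* c (c(v := b))"
  by (rule r_into_rtranclp) (auto simp: move_def)

lemma greedy_step_moves:
  assumes "v \<in> K"
  shows "move\<^sup>*\<^sup>* (fst st) (fst (greedy_step d v st)) \<and> (\<forall>x. x \<notin> K \<longrightarrow> fst (greedy_step d v st) x = fst st x)"
  using assms by (auto simp: greedy_step_def Let_def can_move_moves split: prod.splits)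

lemma greedy_fold_moves:
  assumes "set vs \<subseteq> K"
  shows "move\<^sup>*\<^sup>* (fst st) (fst (fold (greedy_step d) vs st)) \<and>
    (\<forall>x. x \<notin> K \<longrightarrow> fst (fold (greedy_step d) vs st) x = fst st x)"
  using assms
proof (induction vs arbitrary: st)
  case (Cons v vs)
  then have "move\<^sup>*\<^sup>* (fst (greedy_step d v st)) (fst (fold (greedy_step d) (v # vs) st))"
    "\<forall>x. x \<notin> K \<longrightarrow> fst (fold (greedy_step d) (v # vs) st) x = fst (greedy_step d v st) x"
    using Cons.IH[of "greedy_step d v st"] by simp_all
  then show ?case
    using greedy_step_moves[of v st d] Cons.prems
      rtranclp_trans[of move "fst st" "fst (greedy_step d v st)"] by auto
qed simp

text \<open>This is soundness. It holds for every starting list, good or not, because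
  \<open>greedy_step\<close> checks \<open>can_move\<close> before it recolours a vertex.\<close>

lemma greedy_funpow_moves:
  assumes "set vs \<subseteq> K"
  shows "move\<^sup>*\<^sup>* (fst st) (fst ((fold (greedy_step d) vs ^^ R) st)) \<and>
    (\<forall>x. x \<notin> K \<longrightarrow> fst ((fold (greedy_step d) vs ^^ R) st) x = fst st x)"
proof (induction R)
  case (Suc R)
  then show ?case
    using greedy_fold_moves[OF assms, of "(fold (greedy_step d) vs ^^ R) st" d]
      rtranclp_trans[of move "fst st" "fst ((fold (greedy_step d) vs ^^ R) st)"] by auto
qed simp

end

definition p_copy :: "string \<Rightarrow> string \<Rightarrow> prog" where
  "p_copy arr src = PFor ''a'' (PIf (Less (V ''a'') Ne) (PPut arr (V ''a'') (Get src (V ''a''))) PSkip)"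

lemma writes_copy [simp]: "writes (p_copy arr src) = {''a'', arr}"
  by (auto simp: p_copy_def)

lemma wf_copy [simp]: "wf_prog (p_copy arr src) \<longleftrightarrow> arr \<noteq> ''N'' \<and> arr \<noteq> ''a''"
  by (auto simp: p_copy_def)

lemma den_copy:
  assumes n: "s ''in'' 0 = n" and N: "s ''N'' 0 = N" and nN: "n \<le> N"
    and arr: "arr \<notin> {''a'', ''in'', src}" "src \<noteq> ''a''"
  shows "den (p_copy arr src) s arr = (\<lambda>i. if i < n then s src i else s arr i)"
proof -
  let ?p = "PIf (Less (V ''a'') Ne) (PPut arr (V ''a'') (Get src (V ''a''))) PSkip"
  define I where "I i t \<longleftrightarrow> t arr = (\<lambda>j. if j < n \<and> j < i then s src j else s arr j)"
    for i and t :: memory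
  have "\<exists>t. den (PFor ''a'' ?p) s = setc t ''a'' N \<and> I N t \<and> (\<forall>y. y \<notin> writes (PFor ''a'' ?p) \<longrightarrow> t y = s y)"
  proof (rule den_for[where I = I and s = s and N = N, OF N])
    fix i t assume i: "i < N" and I: "I i t" and fr: "\<And>y. y \<notin> writes (PFor ''a'' ?p) \<Longrightarrow> t y = s y"
    have *: "t ''in'' 0 = n" "t src = s src" using fr[of "''in''"] fr[of src] arr n by auto
    show "I (Suc i) (den ?p (setc t ''a'' i))"
      using I * arr by (auto simp: I_def less_Suc_eq fun_eq_iff)
  qed (simp add: I_def)
  then obtain t where t: "den (PFor ''a'' ?p) s = setc t ''a'' N" "I N t" by blast
  have "den (p_copy arr src) s arr = t arr"
    unfolding p_copy_def t(1) using arr by simp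
  then show ?thesis using t(2) nN by (auto simp: I_def fun_eq_iff)
qed

text \<open>The potential of the greedy procedure is at most \<open>N * N\<close>, hence two nested loops.\<close>

definition p_rounds :: "(nat \<times> nat) list \<Rightarrow> prog" where
  "p_rounds es = PFor ''r'' (PFor ''s'' (PFor ''v''
     (PIf (And (Less (V ''v'') Ne) (Less (Const 0) (Get ''lev'' (V ''v'')))) (p_greedy es) PSkip)))"

lemma writes_rounds [simp]:
  "writes (p_rounds es) = {''r'', ''s'', ''v'', ''wl'', ''W'', ''pa'', ''t'', ''a'', ''ok'', ''b'', ''try'', ''qs''}"
  by (auto simp: p_rounds_def)

lemma wf_rounds [simp]: "wf_prog (p_rounds es)"
  by (simp add: p_rounds_def)

text \<open>The candidate is run on the copy \<open>try\<close>. The result replaces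
  \<open>cur\<close> only if the whole component has reached its target, so a bad candidate leaves
  \<open>cur\<close> untouched.\<close>

definition p_attempt :: "(nat \<times> nat) list \<Rightarrow> prog" where
  "p_attempt es = PSeq (p_copy ''try'' ''cur'') (PSeq (PSet ''qs'' (Const 0)) (PSeq (p_rounds es)
     (PSeq (PSet ''ok'' (Const 1))
     (PSeq (PFor ''a'' (PIf (And (Less (V ''a'') Ne) (And (Less (Const 0) (Get ''lev'' (V ''a'')))
              (Not (Equal (Get ''try'' (V ''a'')) (Get ''psi'' (V ''a'')))))) (PSet ''ok'' (Const 0)) PSkip))
       (PIf (Equal (V ''ok'') (Const 1)) (p_copy ''cur'' ''try'') PSkip)))))"

lemma writes_attempt [simp]:
  "writes (p_attempt es) = {''r'', ''s'', ''v'', ''wl'', ''W'', ''pa'', ''t'', ''a'', ''ok'', ''b'', ''try'', ''qs'', ''cur''}"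
  by (auto simp: p_attempt_def)

lemma wf_attempt [simp]: "wf_prog (p_attempt es)"
  by (simp add: p_attempt_def)

context recol_machine
begin

definition gstep :: "memory \<Rightarrow> nat \<Rightarrow> (nat \<Rightarrow> nat) \<times> nat list \<Rightarrow> (nat \<Rightarrow> nat) \<times> nat list" where
  "gstep s = rooted_graph.greedy_step n adj E (s ''q'' 0) (up_path s) d"

definition roots :: "memory \<Rightarrow> nat list" where
  "roots s = filter (\<lambda>v. v \<in> root_set s) [0..<N]"

definition same_tree :: "memory \<Rightarrow> memory \<Rightarrow> bool" where
  "same_tree s t \<longleftrightarrow> (\<forall>y\<in>{''in'', ''N'', ''psi'', ''row'', ''q'', ''lev'', ''par'', ''ql'', ''Q''}. t y = s y)"

lemma same_treeD:
  assumes "same_tree s t"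
  shows "env t = env s" "rooted t = rooted s" "root_set t = root_set s" "gstep t = gstep s"
    "t ''ql'' = s ''ql''" "t ''Q'' = s ''Q''" "t ''N'' = s ''N''" "up_path t = up_path s"
    "t ''q'' = s ''q''"
  using assms by (auto simp: same_tree_def env_def rooted_def root_set_def up_path_def[abs_def] gstep_def)

lemma sweep_den:
  assumes env: "env s" and r: "rooted s" and ql: "s ''ql'' 0 \<le> N"
  shows "pair (den (PFor ''v'' (PIf (And (Less (V ''v'') Ne) (Less (Const 0) (Get ''lev'' (V ''v'')))) (p_greedy es) PSkip)) s)
    = fold (gstep s) (roots s) (pair s)"
proof -
  let ?p = "PIf (And (Less (V ''v'') Ne) (Less (Const 0) (Get ''lev'' (V ''v'')))) (p_greedy es) PSkip"
  define I where "I i t \<longleftrightarrow> pair t = fold (gstep s) (filter (\<lambda>v. v \<in> root_set s) [0..<i]) (pair s)" for i t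
  have N: "s ''N'' 0 = N" using env by (simp add: env_def)
  have "\<exists>t. den (PFor ''v'' ?p) s = setc t ''v'' N \<and> I N t \<and> (\<forall>y. y \<notin> writes (PFor ''v'' ?p) \<longrightarrow> t y = s y)"
  proof (rule den_for[where I = I and s = s and N = N, OF N])
    fix i t assume i: "i < N" and I: "I i t" and fr: "\<And>y. y \<notin> writes (PFor ''v'' ?p) \<Longrightarrow> t y = s y"
    define t' where "t' = setc t ''v'' i"
    have st: "same_tree s t'" using fr by (auto simp: same_tree_def t'_def)
    note D = same_treeD[OF st]
    have p: "pair t' = pair t" by (simp add: t'_def pair_def Qlist_def)
    have g: "pair (den (p_greedy es) t') = gstep s i (pair t)" if "i \<in> root_set s"
      using greedy_den[of t'] D env r ql that p by (simp add: gstep_def t'_def)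
    have b: "bval (And (Less (V ''v'') Ne) (Less (Const 0) (Get ''lev'' (V ''v'')))) t' \<longleftrightarrow> i \<in> root_set s"
      using env fr[of "''in''"] fr[of "''lev''"] by (simp add: t'_def env_def root_set_def)
    show "I (Suc i) (den ?p (setc t ''v'' i))"
      unfolding t'_def[symmetric] using g b I p by (auto simp: I_def)
  qed (simp add: I_def)
  then obtain t where "den (PFor ''v'' ?p) s = setc t ''v'' N" "I N t" by blast
  then show ?thesis by (simp add: I_def pair_def Qlist_def roots_def)
qed

lemma iterate_den:
  assumes N: "s ''N'' 0 = N" and x: "x \<notin> {''try'', ''Q'', ''qs'', ''ql''}"
    and p: "\<And>t. (\<And>y. y \<notin> insert x (writes p) \<Longrightarrow> t y = s y) \<Longrightarrow> pair (den p t) = f (pair t)"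
  shows "pair (den (PFor x p) s) = (f ^^ N) (pair s)"
proof -
  define I where "I i t \<longleftrightarrow> pair t = (f ^^ i) (pair s)" for i t
  have pc: "pair (setc t x i) = pair t" for t i
  proof -
    have "''try'' \<noteq> x" "''Q'' \<noteq> x" "''qs'' \<noteq> x" "''ql'' \<noteq> x" using x by auto
    then show ?thesis by (simp add: pair_def Qlist_def)
  qed
  have "\<exists>t. den (PFor x p) s = setc t x N \<and> I N t \<and> (\<forall>y. y \<notin> writes (PFor x p) \<longrightarrow> t y = s y)"
  proof (rule den_for[where I = I and s = s and N = N, OF N])
    fix i t assume i: "i < N" and I: "I i t" and fr: "\<And>y. y \<notin> writes (PFor x p) \<Longrightarrow> t y = s y"
    have "pair (den p (setc t x i)) = f (pair (setc t x i))" by (rule p) (use fr in auto)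
    then show "I (Suc i) (den p (setc t x i))" using I pc by (simp add: I_def)
  qed (simp add: I_def)
  then obtain t where "den (PFor x p) s = setc t x N" "I N t" by blast
  then show ?thesis using pc by (simp add: I_def)
qed

lemma rounds_den:
  assumes env: "env s" and r: "rooted s" and ql: "s ''ql'' 0 \<le> N"
  shows "pair (den (p_rounds es) s) = (fold (gstep s) (roots s) ^^ (N * N)) (pair s)"
proof -
  let ?p = "PFor ''v'' (PIf (And (Less (V ''v'') Ne) (Less (Const 0) (Get ''lev'' (V ''v'')))) (p_greedy es) PSkip)"
  let ?f = "fold (gstep s) (roots s)"
  have sweep: "pair (den ?p t) = ?f (pair t)" if "same_tree s t" for t
    using sweep_den[of t] same_treeD[OF that] env r ql by (simp add: roots_def)
  have N: "t ''N'' 0 = N" if "same_tree s t" for t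
    using same_treeD[OF that] env by (simp add: env_def)
  have inner: "pair (den (PFor ''s'' ?p) t) = (?f ^^ N) (pair t)" if st: "same_tree s t" for t
  proof (rule iterate_den)
    fix t' assume "\<And>y. y \<notin> insert ''s'' (writes ?p) \<Longrightarrow> t' y = t y"
    then have "same_tree s t'" using st by (simp add: same_tree_def)
    then show "pair (den ?p t') = ?f (pair t')" by (rule sweep)
  qed (use N[OF st] in simp_all)
  have "same_tree s s" by (simp add: same_tree_def)
  have "pair (den (PFor ''r'' (PFor ''s'' ?p)) s) = ((?f ^^ N) ^^ N) (pair s)"
  proof (rule iterate_den)
    fix t' assume "\<And>y. y \<notin> insert ''r'' (writes (PFor ''s'' ?p)) \<Longrightarrow> t' y = s y"
    then have "same_tree s t'" by (simp add: same_tree_def)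
    then show "pair (den (PFor ''s'' ?p) t') = (?f ^^ N) (pair t')" by (rule inner)
  qed (use N[OF \<open>same_tree s s\<close>] in simp_all)
  then show ?thesis unfolding p_rounds_def by (simp only: funpow_mult)
qed

text \<open>The program copies and compares only the first \<open>n\<close> cells. With zeros beyond
  them, equality of arrays is equality of colourings.\<close>

definition bounded :: "memory \<Rightarrow> bool" where
  "bounded s \<longleftrightarrow> (\<forall>i\<ge>n. s ''cur'' i = 0 \<and> s ''try'' i = 0)"

text \<open>The second claim is soundness and holds for any contents of the stack; the third is
  completeness for good candidates.\<close>

theorem attempt_den:
  assumes env: "env s" and r: "rooted s" and ql: "s ''ql'' 0 \<le> N" and bd: "bounded s"
  defines "s' \<equiv> den (p_attempt es) s"
  shows "bounded s'"
    and "s' ''cur'' = s ''cur'' \<or> (move\<^sup>*\<^sup>* (s ''cur'') (s' ''cur'') \<and>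
      (\<forall>v\<in>root_set s. s' ''cur'' v = d v) \<and> (\<forall>v. v \<notin> root_set s \<longrightarrow> s' ''cur'' v = s ''cur'' v))"
    and "rooted_graph.good adj E (s ''q'' 0) (root_set s) (s ''cur'') d Q \<Longrightarrow>
      stack ''Q'' ''ql'' s = nf Q \<Longrightarrow> n * (2 * n + length Q) \<le> N * N \<Longrightarrow>
      \<forall>v\<in>root_set s. s' ''cur'' v = d v"
proof -
  interpret rooted_graph n adj E "s ''q'' 0" "root_set s" "up_path s" using r by (simp add: rooted_def)
  have nin: "s ''in'' 0 = n" and N: "s ''N'' 0 = N" and psi: "s ''psi'' = d" using env by (auto simp: env_def)
  define s1 where "s1 = den (PSet ''qs'' (Const 0)) (den (p_copy ''try'' ''cur'') s)"
  have fr1: "s1 y = s y" if "y \<notin> {''a'', ''try'', ''qs''}" for y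
    using that by (simp add: s1_def den_frame)
  have try1: "s1 ''try'' = s ''cur''"
    using den_copy[of s n N "''try''" "''cur''"] nin N nN bd by (auto simp: s1_def bounded_def fun_eq_iff not_less)
  have st1: "same_tree s s1" by (simp add: same_tree_def fr1)
  note D1 = same_treeD[OF st1]
  have pair1: "pair s1 = (s ''cur'', stack ''Q'' ''ql'' s)"
    using try1 fr1 by (simp add: pair_def Qlist_def stack_def) (simp add: s1_def)
  define s2 where "s2 = den (p_rounds es) s1"
  have fr2: "s2 y = s y" if "y \<notin> {''r'', ''s'', ''v'', ''wl'', ''W'', ''pa'', ''t'', ''a'', ''ok'', ''b'', ''try'', ''qs''}" for y
    using that fr1 by (simp add: s2_def den_frame)
  define c' where "c' = s2 ''try''"
  have set_roots: "set (roots s) = root_set s"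
    using nN by (auto simp: roots_def root_set_def)
  have "pair s2 = (fold (gstep s) (roots s) ^^ (N * N)) (s ''cur'', stack ''Q'' ''ql'' s)"
    using rounds_den[of s1] D1 env r ql pair1 by (simp add: s2_def roots_def)
  then have c': "c' = fst ((fold (greedy_step d) (roots s) ^^ (N * N)) (s ''cur'', stack ''Q'' ''ql'' s))"
    by (simp add: c'_def pair_def gstep_def) (metis fst_conv)
  have moves: "move\<^sup>*\<^sup>* (s ''cur'') c'" and out: "\<And>v. v \<notin> root_set s \<Longrightarrow> c' v = s ''cur'' v"
    using greedy_funpow_moves[where vs = "roots s" and st = "(s ''cur'', stack ''Q'' ''ql'' s)" and d = d
        and R = "N * N"] set_roots c'
    by auto
  let ?c = "And (Less (V ''a'') Ne) (And (Less (Const 0) (Get ''lev'' (V ''a'')))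
              (Not (Equal (Get ''try'' (V ''a'')) (Get ''psi'' (V ''a'')))))"
  define s3 where "s3 = den (PFor ''a'' (PIf ?c (PSet ''ok'' (Const 0)) PSkip)) (den (PSet ''ok'' (Const 1)) s2)"
  have fr3: "s3 y = s2 y" if "y \<notin> {''a'', ''ok''}" for y
  proof -
    have "s3 y = den (PSet ''ok'' (Const 1)) s2 y" unfolding s3_def by (rule den_frame) (use that in auto)
    then show ?thesis using that by simp
  qed
  have "s3 ''ok'' 0 = (if \<exists>i<N. i < n \<and> 0 < s ''lev'' i \<and> c' i \<noteq> d i then 0 else den (PSet ''ok'' (Const 1)) s2 ''ok'' 0)"
    unfolding s3_def by (rule flag_for) (simp_all add: fr2 nin N psi c'_def)
  then have ok: "s3 ''ok'' 0 = 1 \<longleftrightarrow> (\<forall>v\<in>root_set s. c' v = d v)"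
    using nN by (auto simp: root_set_def)
  have s': "s' = (if \<forall>v\<in>root_set s. c' v = d v then den (p_copy ''cur'' ''try'') s3 else s3)"
    unfolding ok[symmetric] by (simp add: s'_def p_attempt_def s1_def s2_def s3_def)
  have try3: "s3 ''try'' = c'" and cur3: "s3 ''cur'' = s ''cur''" using fr3 fr2 by (auto simp: c'_def)
  have out': "c' i = 0" if "n \<le> i" for i
    using out[of i] bd that by (simp add: bounded_def root_set_def)
  have copy: "den (p_copy ''cur'' ''try'') s3 ''cur'' = c'"
    using den_copy[of s3 n N "''cur''" "''try''"] fr3 fr2 nin N nN try3 cur3 out' bd
    by (auto simp: fun_eq_iff bounded_def)
  have try': "s' ''try'' = c'" using s' try3 by (simp add: den_frame)
  show "bounded s'"
    using s' copy cur3 try' out' bd by (auto simp: bounded_def)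
  show "s' ''cur'' = s ''cur'' \<or> (move\<^sup>*\<^sup>* (s ''cur'') (s' ''cur'') \<and>
      (\<forall>v\<in>root_set s. s' ''cur'' v = d v) \<and> (\<forall>v. v \<notin> root_set s \<longrightarrow> s' ''cur'' v = s ''cur'' v))"
    using s' copy cur3 moves out by auto
  assume "good (s ''cur'') d Q" "stack ''Q'' ''ql'' s = nf Q" "n * (2 * n + length Q) \<le> N * N"
  then have "\<forall>v\<in>root_set s. c' v = d v"
    using greedy_correct[of "s ''cur''" d Q "roots s" "N * N"] set_roots c' by simp
  then show "\<forall>v\<in>root_set s. s' ''cur'' v = d v" using s' copy by simp
qed

end

section \<open>Searching through the candidates\<close>

primrec p_pushes :: "nat list \<Rightarrow> prog" where
  "p_pushes [] = PSkip"
| "p_pushes (x # xs) = PSeq (push ''Q'' ''ql'' (Const x)) (p_pushes xs)"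

lemma writes_pushes: "writes (p_pushes xs) \<subseteq> {''Q'', ''ql''}"
  by (induction xs) auto

lemma wf_pushes [simp]: "wf_prog (p_pushes xs)"
  by (induction xs) auto

lemma stack_pushes: "stack ''Q'' ''ql'' (den (p_pushes xs) s) = foldl pushr (stack ''Q'' ''ql'' s) xs"
  by (induction xs arbitrary: s) (simp_all add: stack_push)

text \<open>The loops of \<open>p_word\<close> reach only \<open>N\<close> cells of the stack, so
  longer lists are not tried. Reduction never lengthens a word, hence no candidate shorter than
  \<open>N\<close> is lost.\<close>

definition p_try :: "(nat \<times> nat) list \<Rightarrow> prog" where
  "p_try es = PIf (Less (V ''ql'') (V ''N'')) (p_attempt es) PSkip"

lemma writes_try [simp]: "writes (p_try es) = writes (p_attempt es)"
  by (simp add: p_try_def)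

lemma wf_try [simp]: "wf_prog (p_try es)"
  by (simp add: p_try_def)

primrec p_words :: "(nat \<times> nat) list \<Rightarrow> nat list list \<Rightarrow> prog" where
  "p_words es [] = PSkip"
| "p_words es (w # ws) = PSeq (PSeq (PSet ''ql'' (Const 0)) (p_pushes w)) (PSeq (p_try es) (p_words es ws))"

lemma wf_words [simp]: "wf_prog (p_words es ws)"
  by (induction ws) auto

lemma writes_words: "writes (p_words es ws) \<subseteq> {''Q'', ''ql''} \<union> writes (p_attempt es)"
proof (induction ws)
  case (Cons w ws)
  then show ?case using writes_pushes[of w] by (auto simp del: writes_attempt)
qed simp

section \<open>Building a candidate from a fundamental cycle\<close>

definition p_cyc :: prog where
  "p_cyc = PSeq (p_path ''pa'' (V ''u'')) (PSeq (p_path ''pb'' (V ''w''))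
     (PFor ''a'' (PIf (Less (V ''a'') Ne)
        (PSeq (PPut ''cy'' (V ''a'') (Get ''pa'' (Sub (Sub Ne (Const 1)) (V ''a''))))
              (PPut ''cy'' (Add Ne (V ''a'')) (Get ''pb'' (V ''a'')))) PSkip)))"

lemma writes_cyc [simp]: "writes p_cyc = {''pa'', ''pb'', ''t'', ''a'', ''cy''}"
  by (auto simp: p_cyc_def)

lemma wf_cyc [simp]: "wf_prog p_cyc"
  by (simp add: p_cyc_def)

lemma cyc_den:
  assumes n: "s ''in'' 0 = n" and N: "s ''N'' 0 = N" and nN: "n \<le> N"
  shows "map (den p_cyc s ''cy'') [0..<2 * n] = rev (up_path s (s ''u'' 0)) @ up_path s (s ''w'' 0)"
proof -
  define s1 where "s1 = den (p_path ''pa'' (V ''u'')) s"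
  define s2 where "s2 = den (p_path ''pb'' (V ''w'')) s1"
  have fr1: "s1 y = s y" if "y \<notin> {''pa'', ''t'', ''a''}" for y
    using that by (simp add: s1_def den_frame)
  have fr2: "s2 y = s1 y" if "y \<notin> {''pb'', ''t'', ''a''}" for y
    using that by (simp add: s2_def den_frame)
  have pa: "map (s2 ''pa'') [0..<n] = up_path s (s ''u'' 0)"
    using map_den_path[of s "''pa''" "V ''u''"] n N nN fr2 by (simp add: s1_def)
  have pb: "map (s2 ''pb'') [0..<n] = up_path s (s ''w'' 0)"
    using map_den_path[of s1 "''pb''" "V ''w''"] n N nN fr1 by (simp add: s2_def up_path_def)
  let ?p = "PIf (Less (V ''a'') Ne)
        (PSeq (PPut ''cy'' (V ''a'') (Get ''pa'' (Sub (Sub Ne (Const 1)) (V ''a''))))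
              (PPut ''cy'' (Add Ne (V ''a'')) (Get ''pb'' (V ''a'')))) PSkip"
  define I where "I i t \<longleftrightarrow> (\<forall>j<n. j < i \<longrightarrow> t ''cy'' j = s2 ''pa'' (n - 1 - j) \<and> t ''cy'' (n + j) = s2 ''pb'' j)"
    for i and t :: memory
  have N2: "s2 ''N'' 0 = N" using N fr1 fr2 by simp
  have "\<exists>t. den (PFor ''a'' ?p) s2 = setc t ''a'' N \<and> I N t \<and> (\<forall>y. y \<notin> writes (PFor ''a'' ?p) \<longrightarrow> t y = s2 y)"
  proof (rule den_for[where I = I and s = s2 and N = N, OF N2])
    fix i t assume i: "i < N" and I: "I i t" and fr: "\<And>y. y \<notin> writes (PFor ''a'' ?p) \<Longrightarrow> t y = s2 y"
    have *: "t ''in'' 0 = n" "t ''pa'' = s2 ''pa''" "t ''pb'' = s2 ''pb''"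
      using fr[of "''in''"] fr[of "''pa''"] fr[of "''pb''"] fr1 fr2 n by auto
    show "I (Suc i) (den ?p (setc t ''a'' i))"
      using I * by (auto simp: I_def less_Suc_eq)
  qed (simp add: I_def)
  then obtain t where t: "den (PFor ''a'' ?p) s2 = setc t ''a'' N" "I N t" by blast
  have "den p_cyc s = setc t ''a'' N" by (simp only: p_cyc_def den.simps(3) s1_def[symmetric] s2_def[symmetric] t(1))
  then have cy: "den p_cyc s ''cy'' = t ''cy''" by simp
  have "map (t ''cy'') [0..<2 * n] = map (\<lambda>j. s2 ''pa'' (n - 1 - j)) [0..<n] @ map (s2 ''pb'') [0..<n]"
  proof (rule nth_equalityI)
    fix i assume i: "i < length (map (t ''cy'') [0..<2 * n])"
    show "map (t ''cy'') [0..<2 * n] ! i =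
        (map (\<lambda>j. s2 ''pa'' (n - 1 - j)) [0..<n] @ map (s2 ''pb'') [0..<n]) ! i"
    proof (cases "i < n")
      case True
      then show ?thesis using t(2) nN by (simp add: I_def nth_append)
    next
      case False
      then have "i - n < n" "n + (i - n) = i" using i by auto
      then have "t ''cy'' i = s2 ''pb'' (i - n)"
        using t(2)[unfolded I_def, rule_format, of "i - n"] nN by simp
      then show ?thesis using False i by (simp add: nth_append)
    qed
  qed simp
  then show ?thesis using cy pa pb rev_upt_map[of "s2 ''pa''" n] by simp
qed

text \<open>Because of the padding, a fundamental cycle has exactly \<open>2 * n\<close> vertices,
  so one copy is a loop whose range depends only on \<open>n\<close>.\<close>

definition p_pow :: "string \<Rightarrow> aexp \<Rightarrow> prog" where
  "p_pow y e = PFor ''c'' (PIf (Less (V ''c'') (V y))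
     (PFor ''a'' (PIf (Less (V ''a'') (Add Ne Ne)) (push ''Q'' ''ql'' e) PSkip)) PSkip)"

lemma writes_pow [simp]: "writes (p_pow y e) = {''c'', ''a'', ''Q'', ''ql''}"
  by (auto simp: p_pow_def)

lemma wf_pow [simp]: "wf_prog (p_pow y e)"
  by (simp add: p_pow_def)

lemma pow_den:
  assumes n: "s ''in'' 0 = n" and N: "s ''N'' 0 = N" and nN: "2 * n \<le> N"
    and y: "y \<notin> {''c'', ''a'', ''Q'', ''ql''}" and yN: "s y 0 \<le> N"
    and e: "\<And>i t. i < 2 * n \<Longrightarrow> (\<And>z. z \<notin> {''c'', ''a'', ''Q'', ''ql''} \<Longrightarrow> t z = s z) \<Longrightarrow> t ''a'' 0 = i \<Longrightarrow>
      aval e t = f i"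
  shows "stack ''Q'' ''ql'' (den (p_pow y e) s) =
    foldl pushr (stack ''Q'' ''ql'' s) (wpow (map f [0..<2 * n]) (s y 0))"
proof -
  let ?q = "PFor ''a'' (PIf (Less (V ''a'') (Add Ne Ne)) (push ''Q'' ''ql'' e) PSkip)"
  let ?p = "PIf (Less (V ''c'') (V y)) ?q PSkip"
  define I where "I i t \<longleftrightarrow> stack ''Q'' ''ql'' t =
    foldl pushr (stack ''Q'' ''ql'' s) (wpow (map f [0..<2 * n]) (min i (s y 0)))" for i t
  have "\<exists>t. den (PFor ''c'' ?p) s = setc t ''c'' N \<and> I N t \<and> (\<forall>y. y \<notin> writes (PFor ''c'' ?p) \<longrightarrow> t y = s y)"
  proof (rule den_for[where I = I and s = s and N = N, OF N])
    fix i t assume i: "i < N" and I: "I i t" and fr: "\<And>y. y \<notin> writes (PFor ''c'' ?p) \<Longrightarrow> t y = s y"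
    define t' where "t' = setc t ''c'' i"
    have fr': "t' z = s z" if "z \<notin> {''c'', ''a'', ''Q'', ''ql''}" for z using fr that by (auto simp: t'_def)
    have st: "stack ''Q'' ''ql'' t' = stack ''Q'' ''ql'' t" by (simp add: t'_def stack_def)
    have yy: "t' y 0 = s y 0" using fr' y by auto
    have "stack ''Q'' ''ql'' (den ?q t') = foldl pushr (stack ''Q'' ''ql'' t') (map f (filter (\<lambda>i. i < 2 * n) [0..<N]))"
    proof (rule push_for)
      show "t' ''N'' 0 = N" using fr' N by simp
      fix j t2 assume "j < N" and t2: "\<And>y. y \<notin> {''a'', ''Q'', ''ql''} \<Longrightarrow> t2 y = t' y" "t2 ''a'' 0 = j"
      have t2s: "t2 z = s z" if "z \<notin> {''c'', ''a'', ''Q'', ''ql''}" for z using t2(1) fr' that by auto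
      show "bval (Less (V ''a'') (Add Ne Ne)) t2 \<longleftrightarrow> j < 2 * n" using t2(2) t2s n by (simp add: mult_2)
      assume "j < 2 * n"
      then show "aval e t2 = f j" using e[of j t2] t2s t2(2) by blast
    qed simp_all
    then have q: "stack ''Q'' ''ql'' (den ?q t') = foldl pushr (stack ''Q'' ''ql'' t') (map f [0..<2 * n])"
      using nN by (simp add: filter_upt_less)
    have c: "t' ''c'' 0 = i" by (simp add: t'_def)
    show "I (Suc i) (den ?p (setc t ''c'' i))"
    proof (cases "i < s y 0")
      case True
      then have m: "min i (s y 0) = i" "min (Suc i) (s y 0) = Suc i" by auto
      have "den ?p t' = den ?q t'" using True c yy by simp
      then show ?thesis
        using q I st unfolding t'_def[symmetric] I_def m by (simp add: wpow_Suc_right)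
    next
      case False
      then have m: "min i (s y 0) = s y 0" "min (Suc i) (s y 0) = s y 0" by auto
      have "den ?p t' = t'" using False c yy by simp
      then show ?thesis using I st unfolding t'_def[symmetric] I_def m by simp
    qed
  qed (simp add: I_def)
  then obtain t where t: "den (PFor ''c'' ?p) s = setc t ''c'' N" "I N t" by blast
  have "stack ''Q'' ''ql'' (setc t ''c'' N) = stack ''Q'' ''ql'' t" by (simp add: stack_def)
  then show ?thesis using t yN unfolding p_pow_def t(1) by (simp add: I_def min_absorb2)
qed

definition p_build :: prog where
  "p_build = PSeq (PSet ''ql'' (Const 0)) (PSeq (p_pow ''k'' (Get ''cur'' (Get ''cy'' (V ''a''))))
    (PSeq (PFor ''a'' (PIf (Less (V ''a'') (V ''i'')) (push ''Q'' ''ql'' (Get ''cur'' (Get ''cy'' (V ''a'')))) PSkip))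
    (PSeq (PFor ''a'' (PIf (Less (V ''a'') (V ''j''))
             (push ''Q'' ''ql'' (Get ''psi'' (Get ''cy'' (Sub (Sub (V ''j'') (Const 1)) (V ''a''))))) PSkip))
       (p_pow ''l'' (Get ''psi'' (Get ''cy'' (Sub (Sub (Add Ne Ne) (Const 1)) (V ''a''))))))))"

lemma writes_build [simp]: "writes p_build = {''ql'', ''c'', ''a'', ''Q''}"
  by (auto simp: p_build_def)

lemma wf_build [simp]: "wf_prog p_build"
  by (simp add: p_build_def)

lemma build_den:
  assumes n: "s ''in'' 0 = n" and N: "s ''N'' 0 = N" and nN: "2 * n \<le> N"
    and le: "s ''k'' 0 \<le> N" "s ''l'' 0 \<le> N" "s ''i'' 0 \<le> 2 * n" "s ''j'' 0 \<le> 2 * n"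
  defines "C \<equiv> map (s ''cy'') [0..<2 * n]"
  shows "stack ''Q'' ''ql'' (den p_build s) =
    nf (wpow (map (s ''cur'') C) (s ''k'' 0) @ map (s ''cur'') (take (s ''i'' 0) C) @
        rev (map (s ''psi'') (take (s ''j'' 0) C)) @ wpow (rev (map (s ''psi'') C)) (s ''l'' 0))"
proof -
  let ?k = "p_pow ''k'' (Get ''cur'' (Get ''cy'' (V ''a'')))"
  let ?i = "PFor ''a'' (PIf (Less (V ''a'') (V ''i'')) (push ''Q'' ''ql'' (Get ''cur'' (Get ''cy'' (V ''a'')))) PSkip)"
  let ?j = "PFor ''a'' (PIf (Less (V ''a'') (V ''j''))
             (push ''Q'' ''ql'' (Get ''psi'' (Get ''cy'' (Sub (Sub (V ''j'') (Const 1)) (V ''a''))))) PSkip)"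
  let ?l = "p_pow ''l'' (Get ''psi'' (Get ''cy'' (Sub (Sub (Add Ne Ne) (Const 1)) (V ''a''))))"
  define s0 where "s0 = den (PSet ''ql'' (Const 0)) s"
  define s1 where "s1 = den ?k s0"
  define s2 where "s2 = den ?i s1"
  define s3 where "s3 = den ?j s2"
  have fr0: "s0 y = s y" if "y \<notin> {''ql'', ''c'', ''a'', ''Q''}" for y using that by (simp add: s0_def)
  have fr1: "s1 y = s y" if "y \<notin> {''ql'', ''c'', ''a'', ''Q''}" for y
    unfolding s1_def using den_frame[of y ?k s0] that fr0 by auto
  have fr2: "s2 y = s y" if "y \<notin> {''ql'', ''c'', ''a'', ''Q''}" for y
    unfolding s2_def using den_frame[of y ?i s1] that fr1 by auto
  have fr3: "s3 y = s y" if "y \<notin> {''ql'', ''c'', ''a'', ''Q''}" for y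
    unfolding s3_def using den_frame[of y ?j s2] that fr2 by auto
  have 0: "stack ''Q'' ''ql'' s0 = []" by (simp add: s0_def stack_def)
  have 1: "stack ''Q'' ''ql'' s1 = foldl pushr [] (wpow (map (s ''cur'') C) (s ''k'' 0))"
  proof -
    have "stack ''Q'' ''ql'' s1 = foldl pushr (stack ''Q'' ''ql'' s0)
        (wpow (map (\<lambda>i. s ''cur'' (s ''cy'' i)) [0..<2 * n]) (s0 ''k'' 0))"
      unfolding s1_def by (rule pow_den[where N = N]) (use nN le in \<open>simp_all add: fr0 n N\<close>)
    then show ?thesis using 0 fr0 by (simp add: C_def comp_def)
  qed
  have 2: "stack ''Q'' ''ql'' s2 = foldl pushr [] (wpow (map (s ''cur'') C) (s ''k'' 0) @
      map (s ''cur'') (take (s ''i'' 0) C))"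
  proof -
    have "stack ''Q'' ''ql'' s2 = foldl pushr (stack ''Q'' ''ql'' s1)
        (map (\<lambda>i. s ''cur'' (s ''cy'' i)) (filter (\<lambda>a. a < s ''i'' 0) [0..<N]))"
      unfolding s2_def by (rule push_for) (simp_all add: fr1 n N)
    also have "filter (\<lambda>a. a < s ''i'' 0) [0..<N] = [0..<s ''i'' 0]"
      using le nN by (simp add: filter_upt_less)
    finally show ?thesis using 1 le by (simp add: C_def comp_def take_map)
  qed
  have 3: "stack ''Q'' ''ql'' s3 = foldl pushr [] (wpow (map (s ''cur'') C) (s ''k'' 0) @
      map (s ''cur'') (take (s ''i'' 0) C) @ rev (map (s ''psi'') (take (s ''j'' 0) C)))"
  proof -
    have "stack ''Q'' ''ql'' s3 = foldl pushr (stack ''Q'' ''ql'' s2)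
        (map (\<lambda>i. s ''psi'' (s ''cy'' (s ''j'' 0 - 1 - i))) (filter (\<lambda>a. a < s ''j'' 0) [0..<N]))"
      unfolding s3_def by (rule push_for) (simp_all add: fr2 n N)
    also have "filter (\<lambda>a. a < s ''j'' 0) [0..<N] = [0..<s ''j'' 0]"
      using le nN by (simp add: filter_upt_less)
    also have "map (\<lambda>i. s ''psi'' (s ''cy'' (s ''j'' 0 - 1 - i))) [0..<s ''j'' 0] =
        rev (map (s ''psi'') (take (s ''j'' 0) C))"
      using rev_upt_map[of "\<lambda>i. s ''psi'' (s ''cy'' i)" "s ''j'' 0"] le by (simp add: C_def comp_def take_map)
    finally show ?thesis using 2 by simp
  qed
  have "stack ''Q'' ''ql'' (den ?l s3) = foldl pushr (stack ''Q'' ''ql'' s3)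
        (wpow (map (\<lambda>i. s ''psi'' (s ''cy'' (2 * n - 1 - i))) [0..<2 * n]) (s3 ''l'' 0))"
    by (rule pow_den[where N = N]) (use nN le in \<open>simp_all add: fr3 n N mult_2\<close>)
  also have "map (\<lambda>i. s ''psi'' (s ''cy'' (2 * n - 1 - i))) [0..<2 * n] = rev (map (s ''psi'') C)"
    using rev_upt_map[of "\<lambda>i. s ''psi'' (s ''cy'' i)" "2 * n"] by (simp add: C_def comp_def)
  finally have 4: "stack ''Q'' ''ql'' (den ?l s3) = foldl pushr [] (wpow (map (s ''cur'') C) (s ''k'' 0) @
      map (s ''cur'') (take (s ''i'' 0) C) @ rev (map (s ''psi'') (take (s ''j'' 0) C)) @
      wpow (rev (map (s ''psi'') C)) (s ''l'' 0))"
    using 3 fr3 by simp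
  have "den p_build s = den ?l s3"
    by (simp only: p_build_def den.simps(3) s0_def s1_def s2_def s3_def)
  then show ?thesis using 4 foldl_pushr_Nil by metis
qed

definition p_body :: "(nat \<times> nat) list \<Rightarrow> prog" where
  "p_body es = PIf (And (Less (V ''u'') Ne) (And (Less (V ''w'') Ne)
      (And (Less (Const 0) (Get ''lev'' (V ''u''))) (And (Less (Const 0) (Get ''lev'' (V ''w'')))
        (adjx (V ''u'') (V ''w''))))))
     (PSeq p_cyc (PSeq p_build (p_try es))) PSkip"

lemma writes_body [simp]: "writes (p_body es) =
    {''pa'', ''pb'', ''t'', ''a'', ''cy'', ''ql'', ''c'', ''Q''} \<union> writes (p_attempt es)"
  by (auto simp: p_body_def)

lemma wf_body [simp]: "wf_prog (p_body es)"
  by (simp add: p_body_def)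

section \<open>The search over all candidates at a fixed root\<close>

definition search_vars :: "string list" where
  "search_vars = [''u'', ''w'', ''k'', ''l'', ''i'', ''j'']"

definition p_search :: "(nat \<times> nat) list \<Rightarrow> prog" where
  "p_search es = fors search_vars (p_body es)"

lemma wf_search [simp]: "wf_prog (p_search es)"
  by (simp add: p_search_def wf_fors search_vars_def)

lemma writes_search [simp]: "writes (p_search es) = set search_vars \<union> writes (p_body es)"
  by (simp add: p_search_def writes_fors)

text \<open>The singletons in \<open>ws\<close> serve frozen roots; its walks between connected
  colours serve components in which any walk of the root will do. \<open>N_large\<close> leaves room
  for the longest candidate, with at most \<open>64 * n * n + 20 * n\<close> vertices, and for all
  indices of the search.\<close>

locale search_machine = recol_machine +
  fixes ws :: "nat list list"
  assumes N_large: "64 * n * n + 22 * n + 100 \<le> N"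
    and ws_refl: "(a, a) \<in> E \<Longrightarrow> [a] \<in> set ws"
    and ws_walk: "Q \<noteq> [] \<Longrightarrow> walk Q \<Longrightarrow> (hd Q, hd Q) \<in> E \<Longrightarrow>
      \<exists>w\<in>set ws. w \<noteq> [] \<and> walk w \<and> hd w = hd Q \<and> last w = last Q"
    and ws_length: "w \<in> set ws \<Longrightarrow> length w < N"
begin

text \<open>\<open>c\<close> is the colouring at which the turn of the root \<open>q\<close> starts.
  As long as no candidate has succeeded, \<open>cur\<close> is still \<open>c\<close>, so goodness
  with respect to \<open>c\<close> keeps its meaning. The last clause protects vertices that had
  their target colour before.\<close>

definition tinv :: "(nat \<Rightarrow> nat) \<Rightarrow> nat \<Rightarrow> nat set \<Rightarrow> (nat \<Rightarrow> nat list) \<Rightarrow> memory \<Rightarrow> bool" where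
  "tinv c q K up s \<longleftrightarrow> env s \<and> bounded s \<and> rooted s \<and> s ''q'' 0 = q \<and> root_set s = K \<and> up_path s = up \<and>
     move\<^sup>*\<^sup>* c (s ''cur'') \<and> (s ''cur'' = c \<or> (\<forall>v\<in>K. s ''cur'' v = d v)) \<and>
     (\<forall>v. s ''cur'' v = c v \<or> s ''cur'' v = d v)"

definition agrees :: "nat set \<Rightarrow> memory \<Rightarrow> bool" where
  "agrees K s \<longleftrightarrow> (\<forall>v\<in>K. s ''cur'' v = d v)"

lemma tinv_cong:
  assumes "\<And>y. y \<in> {''in'', ''N'', ''psi'', ''row'', ''q'', ''lev'', ''par'', ''cur'', ''try''} \<Longrightarrow> s y = s' y"
  shows "tinv c q K up s = tinv c q K up s'"
proof -
  have eqs: "s ''in'' = s' ''in''" "s ''N'' = s' ''N''" "s ''psi'' = s' ''psi''" "s ''row'' = s' ''row''"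
    "s ''q'' = s' ''q''" "s ''lev'' = s' ''lev''" "s ''par'' = s' ''par''" "s ''cur'' = s' ''cur''"
    "s ''try'' = s' ''try''"
    using assms by simp_all
  show ?thesis
    unfolding tinv_def env_def bounded_def rooted_def root_set_def up_path_def[abs_def] eqs by (rule refl)
qed

lemma tinv_den:
  "{''in'', ''N'', ''psi'', ''row'', ''q'', ''lev'', ''par'', ''cur'', ''try''} \<inter> writes p = {} \<Longrightarrow>
   tinv c q K up (den p s) = tinv c q K up s"
  by (rule tinv_cong) (auto intro: den_frame)

lemma tinv_setc:
  "x \<notin> {''in'', ''N'', ''psi'', ''row'', ''q'', ''lev'', ''par'', ''cur'', ''try''} \<Longrightarrow>
   tinv c q K up (setc s x v) = tinv c q K up s"
  by (rule tinv_cong) auto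

lemma agrees_den: "''cur'' \<notin> writes p \<Longrightarrow> agrees K (den p s) = agrees K s"
  by (simp add: agrees_def den_frame)

lemma agrees_setc: "x \<noteq> ''cur'' \<Longrightarrow> agrees K (setc s x v) = agrees K s"
  by (simp add: agrees_def)

lemma bound_words: "length Q < N \<Longrightarrow> n * (2 * n + length Q) \<le> N * N"
proof -
  assume Q: "length Q < N"
  show ?thesis
  proof (cases "n = 0")
    case False
    have "n * (2 * n + length Q) \<le> n * (2 * N)"
      using Q N_large by (intro mult_le_mono) linarith+
    also have "\<dots> = (2 * n) * N" by simp
    also have "\<dots> \<le> N * N" using N_large by (intro mult_le_mono) auto
    finally show ?thesis .
  qed simp
qed

lemma try_den:
  assumes t: "tinv c q K up s"
  defines "s' \<equiv> den (p_try es) s"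
  shows "tinv c q K up s'" "agrees K s \<Longrightarrow> agrees K s'"
    and "rooted_graph.good adj E q K c d Q \<Longrightarrow> stack ''Q'' ''ql'' s = nf Q \<Longrightarrow> length Q < N \<Longrightarrow>
      agrees K s'"
proof -
  have env: "env s" and r: "rooted s" and bd: "bounded s" and q: "s ''q'' 0 = q" and K: "root_set s = K"
    and up: "up_path s = up" and mv: "move\<^sup>*\<^sup>* c (s ''cur'')"
    and alt: "s ''cur'' = c \<or> (\<forall>v\<in>K. s ''cur'' v = d v)" "\<forall>v. s ''cur'' v = c v \<or> s ''cur'' v = d v"
    using t by (auto simp: tinv_def)
  have N: "s ''N'' 0 = N" using env by (simp add: env_def)
  have "tinv c q K up s' \<and> (agrees K s \<longrightarrow> agrees K s') \<and>
    (rooted_graph.good adj E q K c d Q \<longrightarrow> stack ''Q'' ''ql'' s = nf Q \<longrightarrow> length Q < N \<longrightarrow> agrees K s')"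
  proof (cases "s ''ql'' 0 < N")
    case False
    have "length Q \<ge> s ''ql'' 0" if "stack ''Q'' ''ql'' s = nf Q"
      using length_nf_le[of Q] that[symmetric] by (simp add: stack_def)
    then show ?thesis using False N t by (auto simp: s'_def p_try_def)
  next
    case True
    then have s': "s' = den (p_attempt es) s" by (simp add: s'_def p_try_def N)
    note A = attempt_den[OF env r less_imp_le[OF True] bd, folded s', unfolded q K]
    have fr: "s' y = s y" if "y \<notin> writes (p_attempt es)" for y
      unfolding s' by (rule den_frame[OF that])
    have e': "env s' = env s" by (rule env_cong) (simp_all add: fr)
    have r': "rooted s' = rooted s" "root_set s' = root_set s" "up_path s' = up_path s"
      by (simp_all add: fr rooted_def root_set_def up_path_def[abs_def])
    have "tinv c q K up s'"
      unfolding tinv_def e' r'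
    proof (intro conjI)
      show "s' ''q'' 0 = q" using fr q by simp
      show "move\<^sup>*\<^sup>* c (s' ''cur'')" using A(2) mv by (metis rtranclp_trans)
      show "s' ''cur'' = c \<or> (\<forall>v\<in>K. s' ''cur'' v = d v)" using A(2) alt(1) by metis
      show "\<forall>v. s' ''cur'' v = c v \<or> s' ''cur'' v = d v" using A(2) alt(2) by metis
    qed (use env r A(1) K up in auto)
    moreover have "agrees K s \<longrightarrow> agrees K s'" using A(2) by (auto simp: agrees_def)
    moreover have "agrees K s'" if "rooted_graph.good adj E q K c d Q" "stack ''Q'' ''ql'' s = nf Q" "length Q < N"
    \<comment> \<open>\<open>good\<close> speaks of the initial colouring \<open>c\<close>. If
      \<open>cur\<close> differs from it, an earlier candidate has already succeeded.\<close>
    proof (cases "s ''cur'' = c")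
      case True
      then show ?thesis using A(3)[of Q] that bound_words[OF that(3)] by (auto simp: agrees_def)
    next
      case False
      then have "agrees K s" using alt by (auto simp: agrees_def)
      then show ?thesis using A(2) by (auto simp: agrees_def)
    qed
    ultimately show ?thesis by blast
  qed
  then show "tinv c q K up s'" "agrees K s \<Longrightarrow> agrees K s'"
    "rooted_graph.good adj E q K c d Q \<Longrightarrow> stack ''Q'' ''ql'' s = nf Q \<Longrightarrow> length Q < N \<Longrightarrow> agrees K s'"
    by blast+
qed

lemma words_den:
  assumes "tinv c q K up s" "set vs \<subseteq> set ws"
  shows "tinv c q K up (den (p_words es vs) s) \<and> (agrees K s \<longrightarrow> agrees K (den (p_words es vs) s)) \<and>
    ((\<exists>w\<in>set vs. rooted_graph.good adj E q K c d w) \<longrightarrow> agrees K (den (p_words es vs) s))"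
  using assms
proof (induction vs arbitrary: s)
  case (Cons w vs)
  let ?p = "PSeq (PSet ''ql'' (Const 0)) (p_pushes w)"
  define s1 where "s1 = den ?p s"
  define s2 where "s2 = den (p_try es) s1"
  have wr: "writes ?p \<subseteq> {''Q'', ''ql''}" using writes_pushes by auto
  have t1: "tinv c q K up s1" unfolding s1_def using Cons.prems wr by (subst tinv_den) auto
  have a1: "agrees K s1 = agrees K s" unfolding s1_def by (rule agrees_den) (use wr in auto)
  have "stack ''Q'' ''ql'' (den (PSet ''ql'' (Const 0)) s) = []" by (simp add: stack_def)
  then have q1: "stack ''Q'' ''ql'' s1 = nf w"
    unfolding s1_def by (simp only: den.simps(3) stack_pushes foldl_pushr_Nil)
  have lw: "length w < N" using ws_length Cons.prems by simp
  note T = try_den[OF t1, folded s2_def]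
  have eq: "den (p_words es (w # vs)) s = den (p_words es vs) s2"
    by (simp only: p_words.simps den.simps(3) s1_def s2_def)
  show ?case
    unfolding eq using Cons.IH[OF T(1)] Cons.prems(2) T(2) T(3)[OF _ q1 lw] a1 by auto
qed simp

lemma body_den:
  assumes t: "tinv c q K up s"
  defines "s' \<equiv> den (p_body es) s"
  shows "tinv c q K up s'" "agrees K s \<Longrightarrow> agrees K s'"
    and "s ''u'' 0 \<in> K \<Longrightarrow> s ''w'' 0 \<in> K \<Longrightarrow> adj (s ''u'' 0) (s ''w'' 0) \<Longrightarrow>
      s ''k'' 0 \<le> 16 * n + 4 \<Longrightarrow> s ''l'' 0 \<le> 16 * n + 4 \<Longrightarrow> s ''i'' 0 \<le> 2 * n \<Longrightarrow> s ''j'' 0 \<le> 2 * n \<Longrightarrow>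
      rooted_graph.good adj E q K c d (rooted_graph.cand c d (rooted_graph.cyc up (s ''u'' 0) (s ''w'' 0))
         (s ''k'' 0) (s ''l'' 0) (s ''i'' 0) (s ''j'' 0)) \<Longrightarrow> agrees K s'"
proof -
  define s1 where "s1 = den p_cyc s"
  define s2 where "s2 = den p_build s1"
  define s3 where "s3 = den (p_try es) s2"
  have r: "rooted_graph n adj E q K up" and Ks: "K = root_set s" and env: "env s" and up: "up = up_path s"
    and alt: "s ''cur'' = c \<or> agrees K s"
    using t by (auto simp: tinv_def rooted_def agrees_def)
  interpret rooted_graph n adj E q K up by (rule r)
  have nin: "s ''in'' 0 = n" and N: "s ''N'' 0 = N" and psi: "s ''psi'' = d" using env by (auto simp: env_def)
  have fr1: "s1 y = s y" if "y \<notin> writes p_cyc" for y unfolding s1_def by (rule den_frame[OF that])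
  have t2: "tinv c q K up s2" unfolding s2_def s1_def using t by (simp add: tinv_den)
  have a2: "agrees K s2 = agrees K s" unfolding s2_def s1_def by (simp add: agrees_den)
  note T = try_den[OF t2, folded s3_def]
  let ?b = "And (Less (V ''u'') Ne) (And (Less (V ''w'') Ne)
      (And (Less (Const 0) (Get ''lev'' (V ''u''))) (And (Less (Const 0) (Get ''lev'' (V ''w'')))
        (adjx (V ''u'') (V ''w'')))))"
  have s': "s' = (if bval ?b s then s3 else s)"
    by (simp only: s'_def p_body_def den.simps s1_def s2_def s3_def)
  show "tinv c q K up s'" using s' t T(1) by simp
  show ag: "agrees K s'" if "agrees K s" using s' a2 that T(2) by simp
  assume uw: "s ''u'' 0 \<in> K" "s ''w'' 0 \<in> K" "adj (s ''u'' 0) (s ''w'' 0)"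
    and kl: "s ''k'' 0 \<le> 16 * n + 4" "s ''l'' 0 \<le> 16 * n + 4" and ij: "s ''i'' 0 \<le> 2 * n" "s ''j'' 0 \<le> 2 * n"
    and g: "good c d (cand c d (cyc (s ''u'' 0) (s ''w'' 0)) (s ''k'' 0) (s ''l'' 0) (s ''i'' 0) (s ''j'' 0))"
  have b: "bval ?b s" using uw env unfolding Ks by (simp add: root_set_def env_def)
  show "agrees K s'"
  proof (cases "s ''cur'' = c")
    case False
    then show ?thesis using alt ag by blast
  next
    case True
    define C where "C = map (s1 ''cy'') [0..<2 * n]"
    have C: "C = cyc (s ''u'' 0) (s ''w'' 0)"
      using cyc_den[of s n N] nin N nN by (simp add: C_def s1_def cyc_def flip: up)
    let ?Q = "cand c d (cyc (s ''u'' 0) (s ''w'' 0)) (s ''k'' 0) (s ''l'' 0) (s ''i'' 0) (s ''j'' 0)"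
    have len: "length ?Q < N"
      using length_cand[OF uw kl, of c d "s ''i'' 0" "s ''j'' 0"] N_large by linarith
    have v1: "s1 ''k'' = s ''k''" "s1 ''l'' = s ''l''" "s1 ''i'' = s ''i''" "s1 ''j'' = s ''j''"
      "s1 ''in'' 0 = n" "s1 ''N'' 0 = N" "s1 ''cur'' = c" "s1 ''psi'' = d"
      using nin N True psi by (simp_all add: fr1)
    have nums: "2 * n \<le> N" "s ''k'' 0 \<le> N" "s ''l'' 0 \<le> N"
      using kl N_large by linarith+
    have "stack ''Q'' ''ql'' s2 = nf (wpow (map (s1 ''cur'') C) (s1 ''k'' 0) @
        map (s1 ''cur'') (take (s1 ''i'' 0) C) @ rev (map (s1 ''psi'') (take (s1 ''j'' 0) C)) @
        wpow (rev (map (s1 ''psi'') C)) (s1 ''l'' 0))"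
      unfolding s2_def C_def
      by (rule build_den[where N = N]) (use v1 nums ij in simp_all)
    also have "\<dots> = nf ?Q" by (simp add: v1 C cand_def)
    finally have "agrees K s3" using T(3)[OF g _ len] by simp
    then show ?thesis using s' b by simp
  qed
qed

lemma search_den:
  assumes t: "tinv c q K up s"
  shows "tinv c q K up (den (p_search es) s)" "agrees K s \<Longrightarrow> agrees K (den (p_search es) s)"
proof -
  have "tinv c q K up (den (p_search es) s)" if "tinv c q K up s" for s
    unfolding p_search_def
    by (rule fors_preserve[of "tinv c q K up"]) (use that body_den(1) tinv_setc in \<open>auto simp: search_vars_def\<close>)
  then show "tinv c q K up (den (p_search es) s)" using t .
  have "tinv c q K up (den (p_search es) s) \<and> agrees K (den (p_search es) s)" if "agrees K s"
    unfolding p_search_def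
    by (rule fors_preserve[of "\<lambda>s. tinv c q K up s \<and> agrees K s"])
       (use that t body_den(1,2) tinv_setc agrees_setc in \<open>auto simp: search_vars_def\<close>)
  then show "agrees K s \<Longrightarrow> agrees K (den (p_search es) s)" by blast
qed

lemma search_hit:
  assumes t: "tinv c q K up s"
    and uw: "u \<in> K" "w \<in> K" "adj u w" and kl: "k \<le> 16 * n + 4" "l \<le> 16 * n + 4"
    and ij: "i \<le> 2 * n" "j \<le> 2 * n"
    and g: "rooted_graph.good adj E q K c d (rooted_graph.cand c d (rooted_graph.cyc up u w) k l i j)"
  shows "agrees K (den (p_search es) s)"
proof -
  define val where "val x = (if x = ''u'' then u else if x = ''w'' then w else if x = ''k'' then k
    else if x = ''l'' then l else if x = ''i'' then i else j)" for x
  have n: "u < n" "w < n" using uw adj_less adj_less2 by auto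
  show ?thesis
    unfolding p_search_def
  proof (rule fors_search[where I = "tinv c q K up" and val = val and N = N])
    fix s assume s: "tinv c q K up s" and "\<forall>x\<in>set search_vars. s x 0 = val x"
    then have "s ''u'' 0 = u" "s ''w'' 0 = w" "s ''k'' 0 = k" "s ''l'' 0 = l" "s ''i'' 0 = i" "s ''j'' 0 = j"
      by (simp_all add: val_def search_vars_def)
    then show "agrees K (den (p_body es) s)" using body_den(3)[OF s] uw kl ij g by simp
  next
    fix s assume "tinv c q K up s"
    then show "s ''N'' 0 = N" by (simp add: tinv_def env_def)
  next
    fix x assume "x \<in> set search_vars"
    then show "val x < N" using n kl ij N_large by (auto simp: search_vars_def val_def)
  qed (use t body_den tinv_setc agrees_setc in \<open>auto simp: search_vars_def\<close>)
qed

end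

section \<open>Spanning trees and the complete search\<close>

context recol_graph
begin

definition comp :: "nat \<Rightarrow> nat set" where "comp q = {v. adj\<^sup>*\<^sup>* q v}"

text \<open>\<open>tree q r lev par\<close>: the array \<open>lev\<close> holds one plus the distance from \<open>q\<close>, as far as it has been
  discovered (\<open>0\<close> means undiscovered), and \<open>par\<close> points to the previous level.\<close>

definition tree :: "nat \<Rightarrow> nat \<Rightarrow> (nat \<Rightarrow> nat) \<Rightarrow> (nat \<Rightarrow> nat) \<Rightarrow> bool" where
  "tree q r lev par \<longleftrightarrow> lev q = 1 \<and> par q = q \<and> (\<forall>v<n. 0 < lev v \<longrightarrow> lev v \<le> Suc r \<and> (lev v = 1 \<longrightarrow> v = q) \<and>
     (1 < lev v \<longrightarrow> adj (par v) v \<and> lev v = Suc (lev (par v))))"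

definition scanned :: "nat \<Rightarrow> (nat \<Rightarrow> nat) \<Rightarrow> bool" where
  "scanned r lev \<longleftrightarrow> (\<forall>v<n. 0 < lev v \<and> lev v \<le> r \<longrightarrow> (\<forall>u. adj v u \<longrightarrow> 0 < lev u))"

lemma treeD:
  assumes "tree q r lev par"
  shows "lev q = 1" "par q = q"
    and "v < n \<Longrightarrow> 0 < lev v \<Longrightarrow> lev v \<le> Suc r"
    and "v < n \<Longrightarrow> lev v = 1 \<Longrightarrow> v = q"
    and "v < n \<Longrightarrow> 1 < lev v \<Longrightarrow> adj (par v) v"
    and "v < n \<Longrightarrow> 1 < lev v \<Longrightarrow> lev v = Suc (lev (par v))"
  using assms unfolding tree_def by (metis less_trans zero_less_one)+

lemma tree_mono: "tree q r lev par \<Longrightarrow> tree q (Suc r) lev par"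
  unfolding tree_def using le_SucI by blast

lemma tree_par:
  assumes "tree q r lev par" "v < n" "lev v = Suc m" "j \<le> m"
  shows "(par ^^ j) v < n \<and> lev ((par ^^ j) v) = Suc (m - j)"
  using assms(4)
proof (induction j)
  case (Suc j)
  then have *: "(par ^^ j) v < n" "lev ((par ^^ j) v) = Suc (m - j)" "0 < m - j" by auto
  have "adj (par ((par ^^ j) v)) ((par ^^ j) v)" "lev ((par ^^ j) v) = Suc (lev (par ((par ^^ j) v)))"
    using treeD(5,6)[OF assms(1) *(1)] *(2,3) by simp_all
  then show ?case using * adj_less by auto
qed (use assms in simp)

lemma tree_root: "tree q r lev par \<Longrightarrow> v < n \<Longrightarrow> lev v = Suc m \<Longrightarrow> m \<le> j \<Longrightarrow> (par ^^ j) v = q"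
proof (induction "j - m" arbitrary: j)
  case 0
  then have "lev ((par ^^ j) v) = 1" "(par ^^ j) v < n" using tree_par[of q r lev par v m j] by auto
  then show ?case using treeD(4)[OF 0(2)] by blast
next
  case (Suc i)
  then have "(par ^^ (j - 1)) v = q" by simp
  moreover have "j = Suc (j - 1)" using Suc by simp
  ultimately have "(par ^^ j) v = par q" by (metis comp_apply funpow.simps(2))
  then show ?case using treeD(2)[OF Suc.prems(1)] by simp
qed

text \<open>Ancestors lie on distinct levels and so are distinct vertices. Therefore
  \<open>N\<close> rounds scan every discovered vertex, and \<open>n\<close> vertices suffice for a
  path to the root.\<close>

lemma tree_level_le: "tree q r lev par \<Longrightarrow> v < n \<Longrightarrow> lev v \<le> n"
proof (cases "lev v")
  case (Suc m)
  assume t: "tree q r lev par" and v: "v < n"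
  note P = tree_par[OF t v Suc]
  have "inj_on (\<lambda>j. (par ^^ j) v) {..m}"
  proof (rule inj_onI)
    fix i j assume "i \<in> {..m}" "j \<in> {..m}" "(par ^^ i) v = (par ^^ j) v"
    then have "i \<le> m" "j \<le> m" "lev ((par ^^ i) v) = lev ((par ^^ j) v)" by auto
    then show "i = j" using P[of i] P[of j] by simp
  qed
  moreover have "(\<lambda>j. (par ^^ j) v) ` {..m} \<subseteq> {..<n}" using P by auto
  ultimately have "card {..m} \<le> card {..<n}" by (intro card_inj_on_le) auto
  then show ?thesis using Suc by simp
qed simp

lemma tree_rooted:
  assumes t: "tree q N lev par" and sc: "scanned N lev" and nN: "n \<le> N" and q: "q < n"
  defines "K \<equiv> {v. v < n \<and> 0 < lev v}"
  shows "rooted_graph n adj E q K (\<lambda>v. map (\<lambda>j. (par ^^ j) v) [0..<n])" "K = comp q"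
proof -
  have closed: "closed K"
    unfolding closed_def
  proof (intro conjI allI impI)
    fix u v assume uv: "adj u v" and v: "v \<in> K"
    have "lev v \<le> N" using tree_level_le[OF t, of v] nN v by (simp add: K_def)
    then show "u \<in> K"
      using sc[unfolded scanned_def, rule_format, of v u] v adj_sym[OF uv] adj_less[OF uv] by (simp add: K_def)
  qed (auto simp: K_def)
  have qK: "q \<in> K" using treeD(1)[OF t] q by (simp add: K_def)
  have inK: "(par ^^ j) v \<in> K" if "v \<in> K" for v j
  proof -
    obtain m where m: "lev v = Suc m" "v < n" using \<open>v \<in> K\<close> by (auto simp: K_def gr0_conv_Suc)
    show ?thesis
    proof (cases "j \<le> m")
      case True
      then show ?thesis using tree_par[OF t m(2,1)] by (simp add: K_def)
    next
      case False
      then show ?thesis using tree_root[OF t m(2,1), of j] qK by simp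
    qed
  qed
  have par_adj: "adj v (par v)" if "v \<in> K" for v
  proof (cases "lev v = 1")
    case True
    then have "v = q" using that treeD(4)[OF t] by (auto simp: K_def)
    then show ?thesis using treeD(2)[OF t] adj_refl q by simp
  next
    case False
    then have "v < n" "1 < lev v" using that by (auto simp: K_def)
    then show ?thesis using adj_sym[OF treeD(5)[OF t]] by blast
  qed
  show "rooted_graph n adj E q K (\<lambda>v. map (\<lambda>j. (par ^^ j) v) [0..<n])"
  proof
    show "closed K" "q \<in> K" by fact+
    fix v assume v: "v \<in> K"
    show "successively adj (map (\<lambda>j. (par ^^ j) v) [0..<n])"
      using par_adj[OF inK[OF v]] by (simp add: successively_conv_nth)
    show "set (map (\<lambda>j. (par ^^ j) v) [0..<n]) \<subseteq> K" using inK[OF v] by auto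
    show "length (map (\<lambda>j. (par ^^ j) v) [0..<n]) = n" by simp
    show "hd (map (\<lambda>j. (par ^^ j) v) [0..<n]) = v" using q by (simp add: hd_map)
    obtain m where m: "lev v = Suc m" "v < n" using v by (auto simp: K_def gr0_conv_Suc)
    have "m \<le> n - 1" using tree_level_le[OF t m(2)] m by simp
    from tree_root[OF t m(2,1) this] show "last (map (\<lambda>j. (par ^^ j) v) [0..<n]) = q"
      using q by (simp add: last_map)
  next
    have "(par ^^ j) q = q" for j by (induction j) (simp_all add: treeD(2)[OF t])
    then show "set (map (\<lambda>j. (par ^^ j) q) [0..<n]) \<subseteq> {q}" by auto
  qed
  show "K = comp q"
  proof
    show "K \<subseteq> comp q"
    proof
      fix v assume v: "v \<in> K"
      obtain m where m: "lev v = Suc m" "v < n" using v by (auto simp: K_def gr0_conv_Suc)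
      have "adj\<^sup>*\<^sup>* ((par ^^ j) v) v" for j
      proof (induction j)
        case (Suc j)
        then show ?case using par_adj[OF inK[OF v, of j]] adj_sym
          by (auto intro: converse_rtranclp_into_rtranclp)
      qed simp
      from this[of m] show "v \<in> comp q" using tree_root[OF t m(2,1), of m] by (simp add: comp_def)
    qed
    show "comp q \<subseteq> K"
    proof
      fix v assume "v \<in> comp q"
      then have "adj\<^sup>*\<^sup>* q v" by (simp add: comp_def)
      then show "v \<in> K"
      proof (induction rule: rtranclp_induct)
        case (step y z)
        then show ?case using closed adj_sym[OF step(2)] unfolding closed_def by blast
      qed (rule qK)
    qed
  qed
qed

end

section \<open>Breadth-first search on the machine\<close>

definition tree_cond :: bexp where
  "tree_cond = And (Less (V ''u'') Ne) (And (Less (V ''v'') Ne)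
     (And (Equal (Get ''lev'' (V ''u'')) (Add (V ''r'') (Const 1)))
     (And (Equal (Get ''lev'' (V ''v'')) (Const 0)) (adjx (V ''u'') (V ''v'')))))"

definition p_scan :: prog where
  "p_scan = PIf tree_cond (PSeq (PPut ''lev'' (V ''v'') (Add (V ''r'') (Const 2)))
                (PPut ''par'' (V ''v'') (V ''u''))) PSkip"

lemma writes_scan [simp]: "writes p_scan = {''lev'', ''par''}"
  by (auto simp: p_scan_def)

definition p_tree :: prog where
  "p_tree = PSeq (PFor ''a'' (PPut ''lev'' (V ''a'') (Const 0)))
     (PSeq (PPut ''lev'' (V ''q'') (Const 1)) (PSeq (PPut ''par'' (V ''q'') (V ''q''))
       (PFor ''r'' (PFor ''u'' (PFor ''v'' p_scan)))))"

lemma writes_tree [simp]: "writes p_tree = {''a'', ''lev'', ''par'', ''r'', ''u'', ''v''}"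
  by (auto simp: p_tree_def)

lemma wf_tree [simp]: "wf_prog p_tree"
  by (simp add: p_tree_def p_scan_def)

context recol_machine
begin

text \<open>Invariant of the three nested loops. Levels start at \<open>1\<close>, so round
  \<open>r\<close> scans level \<open>Suc r\<close>: vertices below \<open>u\<close> are finished,
  and of \<open>u\<close> itself the neighbours below \<open>v\<close>. New vertices get level
  \<open>r + 2\<close> and so do not join the level being scanned.\<close>

definition stage :: "nat \<Rightarrow> nat \<Rightarrow> nat \<Rightarrow> nat \<Rightarrow> memory \<Rightarrow> bool" where
  "stage q r u v t \<longleftrightarrow> tree q (Suc r) (t ''lev'') (t ''par'') \<and> scanned r (t ''lev'') \<and>
     (\<forall>x<n. x < u \<longrightarrow> t ''lev'' x = Suc r \<longrightarrow> (\<forall>y. adj x y \<longrightarrow> 0 < t ''lev'' y)) \<and>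
     (t ''lev'' u = Suc r \<longrightarrow> (\<forall>y<v. adj u y \<longrightarrow> 0 < t ''lev'' y))"

lemma scan_den:
  assumes st: "stage q r u v t" and env: "env t" and vars: "t ''r'' 0 = r" "t ''u'' 0 = u" "t ''v'' 0 = v"
  shows "stage q r u (Suc v) (den p_scan t)"
proof -
  have b: "bval tree_cond t \<longleftrightarrow> u < n \<and> v < n \<and> t ''lev'' u = Suc r \<and> t ''lev'' v = 0 \<and> adj u v"
    using env vars by (auto simp: env_def tree_cond_def)
  show ?thesis
  proof (cases "bval tree_cond t")
    case False
    then have "den p_scan t = t" by (simp add: p_scan_def)
    moreover have "0 < t ''lev'' v" if "t ''lev'' u = Suc r" "adj u v"
      using False that adj_less adj_less2 unfolding b by auto
    ultimately show ?thesis using st by (auto simp: stage_def less_Suc_eq)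
  next
    case True
    then have c: "u < n" "v < n" "t ''lev'' u = Suc r" "t ''lev'' v = 0" "adj u v" using b by auto
    define lev par where "lev = t ''lev''" and "par = t ''par''"
    have d: "den p_scan t ''lev'' = lev(v := r + 2)" "den p_scan t ''par'' = par(v := u)"
      using True vars by (simp_all add: p_scan_def lev_def par_def)
    have T: "tree q (Suc r) lev par" and S: "scanned r lev" using st by (auto simp: stage_def lev_def par_def)
    have uv: "u \<noteq> v" "lev u = Suc r" "lev v = 0" using c by (auto simp: lev_def)
    note D = treeD[OF T]
    have vq: "v \<noteq> q" using uv D(1) by auto
    have "tree q (Suc r) (lev(v := r + 2)) (par(v := u))"
      unfolding tree_def
    proof (intro conjI allI impI)
      show "(lev(v := r + 2)) q = 1" "(par(v := u)) q = q" using D(1,2) vq by auto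
      fix x assume x: "x < n" "0 < (lev(v := r + 2)) x"
      show "(lev(v := r + 2)) x \<le> Suc (Suc r)" using x D(3)[of x] by auto
      show "x = q" if "(lev(v := r + 2)) x = 1" using that x D(4)[of x] by (auto split: if_splits)
      show "adj ((par(v := u)) x) x" if "1 < (lev(v := r + 2)) x"
        using that x D(5)[of x] c by (auto split: if_splits)
      show "(lev(v := r + 2)) x = Suc ((lev(v := r + 2)) ((par(v := u)) x))" if "1 < (lev(v := r + 2)) x"
      proof (cases "x = v")
        case True
        then show ?thesis using uv by simp
      next
        case False
        then have e: "1 < lev x" using that by simp
        have "par x \<noteq> v" using uv e D(6)[OF x(1) e] by auto
        then show ?thesis using D(6)[OF x(1) e] False by simp
      qed
    qed
    moreover have "scanned r (lev(v := r + 2))" using S by (auto simp: scanned_def)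
    ultimately show ?thesis
      using st uv unfolding stage_def d by (auto simp: lev_def less_Suc_eq)
  qed
qed

lemma stage_setc: "x \<in> {''r'', ''u'', ''v''} \<Longrightarrow> stage q r u v (setc t x i) = stage q r u v t"
  by (auto simp: stage_def)

lemma scan_loops:
  assumes env: "env s" and T: "tree q 0 (s ''lev'') (s ''par'')" and S: "scanned 0 (s ''lev'')"
  shows "\<exists>t. den (PFor ''r'' (PFor ''u'' (PFor ''v'' p_scan))) s = t \<and>
    tree q N (t ''lev'') (t ''par'') \<and> scanned N (t ''lev'')"
proof -
  have N: "t ''N'' 0 = N" if "env t" for t using that by (simp add: env_def)
  have inner: "stage q r (Suc u) 0 (den (PFor ''v'' p_scan) t)"
    if st: "stage q r u 0 t" and e: "env t" and vars: "t ''r'' 0 = r" "t ''u'' 0 = u" for r u t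
  proof -
    have "\<exists>t'. den (PFor ''v'' p_scan) t = setc t' ''v'' N \<and> stage q r u N t' \<and>
      (\<forall>y. y \<notin> writes (PFor ''v'' p_scan) \<longrightarrow> t' y = t y)"
    proof (rule den_for[where I = "\<lambda>i. stage q r u i" and s = t and N = N])
      fix i t' assume "stage q r u i t'" and fr: "\<And>y. y \<notin> writes (PFor ''v'' p_scan) \<Longrightarrow> t' y = t y"
      moreover have "env (setc t' ''v'' i)" by (subst env_cong[of _ t]) (use fr e in auto)
      ultimately show "stage q r u (Suc i) (den p_scan (setc t' ''v'' i))"
        using vars fr[of "''r''"] fr[of "''u''"] by (intro scan_den) (auto simp: stage_setc)
    qed (use N[OF e] st in auto)
    then obtain t' where t': "den (PFor ''v'' p_scan) t = setc t' ''v'' N" "stage q r u N t'" by blast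
    have "0 < t' ''lev'' y" if "adj u y" "t' ''lev'' u = Suc r" for y
      using t'(2) that nN adj_less2[OF that(1)] by (auto simp: stage_def)
    then have "stage q r (Suc u) 0 t'" using t'(2) by (auto simp: stage_def less_Suc_eq)
    then show ?thesis using t'(1) by (simp add: stage_setc)
  qed
  have middle: "stage q r N 0 (den (PFor ''u'' (PFor ''v'' p_scan)) t)"
    if st: "stage q r 0 0 t" and e: "env t" and vars: "t ''r'' 0 = r" for r t
  proof -
    let ?p = "PFor ''v'' p_scan"
    have "\<exists>t'. den (PFor ''u'' ?p) t = setc t' ''u'' N \<and> stage q r N 0 t' \<and>
      (\<forall>y. y \<notin> writes (PFor ''u'' ?p) \<longrightarrow> t' y = t y)"
    proof (rule den_for[where I = "\<lambda>i. stage q r i 0" and s = t and N = N])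
      fix i t' assume "stage q r i 0 t'" and fr: "\<And>y. y \<notin> writes (PFor ''u'' ?p) \<Longrightarrow> t' y = t y"
      moreover have "env (setc t' ''u'' i)" by (subst env_cong[of _ t]) (use fr e in auto)
      ultimately show "stage q r (Suc i) 0 (den ?p (setc t' ''u'' i))"
        using vars fr[of "''r''"] by (intro inner) (auto simp: stage_setc)
    qed (use N[OF e] st in auto)
    then obtain t' where t': "den (PFor ''u'' ?p) t = setc t' ''u'' N" "stage q r N 0 t'" by blast
    show ?thesis unfolding t'(1) using t'(2) by (simp add: stage_setc)
  qed
  let ?p = "PFor ''u'' (PFor ''v'' p_scan)"
  define I where "I r t \<longleftrightarrow> tree q r (t ''lev'') (t ''par'') \<and> scanned r (t ''lev'')" for r and t :: memory
  have "\<exists>t. den (PFor ''r'' ?p) s = setc t ''r'' N \<and> I N t \<and>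
      (\<forall>y. y \<notin> writes (PFor ''r'' ?p) \<longrightarrow> t y = s y)"
  proof (rule den_for[where I = I and s = s and N = N])
    fix i t assume I: "I i t" and fr: "\<And>y. y \<notin> writes (PFor ''r'' ?p) \<Longrightarrow> t y = s y"
    have e: "env (setc t ''r'' i)" by (subst env_cong[of _ s]) (use fr env in auto)
    have "stage q i 0 0 (setc t ''r'' i)"
      using I treeD(3)[of q i "t ''lev''" "t ''par''"] tree_mono unfolding stage_def I_def by simp
    from middle[OF this e] have st: "stage q i N 0 (den ?p (setc t ''r'' i))" by simp
    define lev where "lev = den ?p (setc t ''r'' i) ''lev''"
    have "scanned (Suc i) lev"
      unfolding scanned_def
    proof (intro allI impI)
      fix v u assume "v < n" "0 < lev v \<and> lev v \<le> Suc i" "adj v u"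
      then show "0 < lev u"
        using st nN unfolding stage_def scanned_def lev_def[symmetric]
        by (cases "lev v = Suc i") (auto simp: le_Suc_eq)
    qed
    then show "I (Suc i) (den ?p (setc t ''r'' i))" using st by (auto simp: I_def stage_def lev_def)
  qed (use N[OF env] T S in \<open>simp_all add: I_def\<close>)
  then obtain t where t: "den (PFor ''r'' ?p) s = setc t ''r'' N" "I N t" by blast
  then show ?thesis by (intro exI[of _ "setc t ''r'' N"]) (simp add: I_def del: den.simps)
qed

lemma tree_den:
  assumes env: "env s" and q: "s ''q'' 0 < n"
  shows "rooted (den p_tree s)" "root_set (den p_tree s) = comp (s ''q'' 0)"
proof -
  let ?q = "s ''q'' 0"
  have N: "s ''N'' 0 = N" using env by (simp add: env_def)
  let ?z = "PPut ''lev'' (V ''a'') (Const 0)"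
  have "\<exists>t. den (PFor ''a'' ?z) s = setc t ''a'' N \<and> (\<forall>j<N. t ''lev'' j = 0) \<and>
      (\<forall>y. y \<notin> writes (PFor ''a'' ?z) \<longrightarrow> t y = s y)"
    by (rule den_for[where I = "\<lambda>i t. \<forall>j<i. t ''lev'' j = 0" and s = s and N = N])
       (use N in \<open>auto simp: less_Suc_eq\<close>)
  then obtain t where t: "den (PFor ''a'' ?z) s = setc t ''a'' N" "\<And>j. j < N \<Longrightarrow> t ''lev'' j = 0"
    "\<And>y. y \<notin> {''a'', ''lev''} \<Longrightarrow> t y = s y"
    by (auto simp del: den.simps)
  define s1 where "s1 = den (PSeq (PPut ''lev'' (V ''q'') (Const 1)) (PPut ''par'' (V ''q'') (V ''q''))) (setc t ''a'' N)"
  have s1: "s1 ''lev'' = (t ''lev'')(?q := 1)" "s1 ''par'' ?q = ?q"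
    "\<And>y. y \<notin> {''a'', ''lev'', ''par''} \<Longrightarrow> s1 y = s y"
    using t(3) by (simp_all add: s1_def)
  have e1: "env s1" by (subst env_cong[of _ s]) (use s1 env in auto)
  have lev1: "s1 ''lev'' v = (if v = ?q then 1 else 0)" if "v < n" for v
    using s1(1) t(2)[of v] that nN by simp
  have "tree ?q 0 (s1 ''lev'') (s1 ''par'')"
    unfolding tree_def using q s1(2) lev1 by auto
  moreover have "scanned 0 (s1 ''lev'')" by (simp add: scanned_def)
  ultimately obtain t2 where t2: "den (PFor ''r'' (PFor ''u'' (PFor ''v'' p_scan))) s1 = t2"
    "tree ?q N (t2 ''lev'') (t2 ''par'')" "scanned N (t2 ''lev'')"
    using scan_loops[OF e1] by blast
  have d: "den p_tree s = t2"
    unfolding p_tree_def den.simps(3) t(1) t2(1)[symmetric] s1_def by (rule refl)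
  have fr: "t2 ''q'' = s ''q''" "t2 ''in'' 0 = n"
    using den_frame[of _ p_tree s] env unfolding d by (auto simp: env_def)
  show "rooted (den p_tree s)" "root_set (den p_tree s) = comp ?q"
    using tree_rooted[OF t2(2,3) nN q] fr unfolding d
    by (simp_all add: rooted_def root_set_def up_path_def[abs_def])
qed

end

section \<open>All roots\<close>

definition p_root :: "(nat \<times> nat) list \<Rightarrow> nat list list \<Rightarrow> prog" where
  "p_root es ws = PIf (Less (V ''q'') Ne) (PSeq p_tree (PSeq (p_words es ws) (p_search es))) PSkip"

lemma wf_root [simp]: "wf_prog (p_root es ws)"
  by (simp add: p_root_def)

lemma writes_root: "writes (p_root es ws) \<inter> {''q'', ''in'', ''N'', ''psi'', ''row'', ''out''} = {}"
  using writes_words[of es ws] by (auto simp: p_root_def search_vars_def)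

text \<open>Since every vertex takes its turn as root, each component that has frozen vertices also
  gets a frozen root at some point, without any test for being frozen.\<close>

definition p_all :: "(nat \<times> nat) list \<Rightarrow> nat list list \<Rightarrow> prog" where
  "p_all es ws = PSeq (PFor ''q'' (p_root es ws)) (PSeq (PSet ''out'' (Const 1))
     (PFor ''a'' (PIf (And (Less (V ''a'') Ne) (Not (Equal (Get ''cur'' (V ''a'')) (Get ''psi'' (V ''a'')))))
        (PSet ''out'' (Const 0)) PSkip)))"

lemma wf_all [simp]: "wf_prog (p_all es ws)"
  using writes_root[of es ws] by (auto simp: p_all_def)

context search_machine
begin

lemma root_den:
  assumes env: "env s" and bd: "bounded s"
  defines "s' \<equiv> den (p_root es ws) s"
  shows "env s'" "bounded s'" "move\<^sup>*\<^sup>* (s ''cur'') (s' ''cur'')"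
    "\<And>v. s' ''cur'' v = s ''cur'' v \<or> s' ''cur'' v = d v"
    and "s ''q'' 0 < n \<Longrightarrow> hom (s ''cur'') \<Longrightarrow> move\<^sup>*\<^sup>* (s ''cur'') d \<Longrightarrow>
      (\<exists>F. frozen (s ''cur'') F \<and> s ''q'' 0 \<in> F \<and> F \<subseteq> comp (s ''q'' 0)) \<or>
      (\<forall>F. F \<subseteq> comp (s ''q'' 0) \<longrightarrow> frozen (s ''cur'') F \<longrightarrow> F = {}) \<Longrightarrow>
      \<forall>v\<in>comp (s ''q'' 0). s' ''cur'' v = d v"
proof -
  define q where "q = s ''q'' 0"
  define c where "c = s ''cur''"
  have "env s' \<and> bounded s' \<and> move\<^sup>*\<^sup>* c (s' ''cur'') \<and> (\<forall>v. s' ''cur'' v = c v \<or> s' ''cur'' v = d v) \<and>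
    (q < n \<longrightarrow> hom c \<longrightarrow> move\<^sup>*\<^sup>* c d \<longrightarrow> (\<exists>F. frozen c F \<and> q \<in> F \<and> F \<subseteq> comp q) \<or>
      (\<forall>F. F \<subseteq> comp q \<longrightarrow> frozen c F \<longrightarrow> F = {}) \<longrightarrow> (\<forall>v\<in>comp q. s' ''cur'' v = d v))"
  proof (cases "q < n")
    case False
    then have "s' = s" using env by (simp add: s'_def p_root_def q_def env_def)
    then show ?thesis using env bd False by (simp add: c_def)
  next
    case True
    define s1 where "s1 = den p_tree s"
    define s2 where "s2 = den (p_words es ws) s1"
    define K up where "K = comp q" and "up = up_path s1"
    have s': "s' = den (p_search es) s2"
      using True env by (simp add: s'_def p_root_def q_def env_def s1_def s2_def)
    have fr: "s1 y = s y" if "y \<notin> {''a'', ''lev'', ''par'', ''r'', ''u'', ''v''}" for y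
      unfolding s1_def by (rule den_frame) (use that in simp)
    have e1: "env s1" by (subst env_cong[of _ s]) (use fr env in auto)
    note tr = tree_den[OF env True[unfolded q_def], folded s1_def q_def]
    have t1: "tinv c q K up s1"
      using e1 tr bd fr by (auto simp: tinv_def K_def up_def c_def q_def bounded_def)
    interpret R: rooted_graph n adj E q K up
      using t1 by (auto simp: tinv_def rooted_def)
    note W = words_den[OF t1 subset_refl, folded s2_def]
    have t2: "tinv c q K up s2" using W by blast
    have t3: "tinv c q K up s'" unfolding s' using search_den(1)[OF t2] .
    have mono: "agrees K s'" if "agrees K s2" unfolding s' using search_den(2)[OF t2 that] .
    have "agrees K s'" if h: "hom c" and mv: "move\<^sup>*\<^sup>* c d"
      and alt: "(\<exists>F. frozen c F \<and> q \<in> F \<and> F \<subseteq> K) \<or> (\<forall>F. F \<subseteq> K \<longrightarrow> frozen c F \<longrightarrow> F = {})"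
      using alt
    proof
      assume "\<exists>F. frozen c F \<and> q \<in> F \<and> F \<subseteq> K"
      then have "R.good c d [c q]" using R.good_frozen[OF mv] by blast
      moreover have "[c q] \<in> set ws" using h adj_refl[OF True] ws_refl by (auto simp: hom_def)
      ultimately show ?thesis using W mono by blast
    next
      assume nof: "\<forall>F. F \<subseteq> K \<longrightarrow> frozen c F \<longrightarrow> F = {}"
      have "(\<forall>Q. Q \<noteq> [] \<and> hd Q = c q \<and> last Q = d q \<and> walk Q \<longrightarrow> R.good c d Q) \<or>
        (\<exists>u\<in>K. \<exists>v\<in>K. \<exists>k l i j. adj u v \<and> k \<le> 16 * n + 4 \<and> l \<le> 16 * n + 4 \<and> i \<le> 2 * n \<and> j \<le> 2 * n \<and>
           R.good c d (R.cand c d (R.cyc u v) k l i j))"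
        using R.good_candidate[OF mv h] nof by blast
      then show ?thesis
      proof
        assume all: "\<forall>Q. Q \<noteq> [] \<and> hd Q = c q \<and> last Q = d q \<and> walk Q \<longrightarrow> R.good c d Q"
        \<comment> \<open>Any walk with the right ends will do here. The recolouring shows that such
          a walk exists in the colour graph, and then \<open>ws\<close> contains one.\<close>
        obtain S where "system {..<n} c d S" using system_of_moves[OF mv] by blast
        then have "S q \<noteq> []" "hd (S q) = c q" "last (S q) = d q" "walk (S q)"
          using True by (auto simp: system_def)
        then obtain w where "w \<in> set ws" "w \<noteq> []" "walk w" "hd w = c q" "last w = d q"
          using ws_walk[of "S q"] h adj_refl[OF True] by (auto simp: hom_def)
        then show ?thesis using all W mono by blast
      next
        assume "\<exists>u\<in>K. \<exists>v\<in>K. \<exists>k l i j. adj u v \<and> k \<le> 16 * n + 4 \<and> l \<le> 16 * n + 4 \<and> i \<le> 2 * n \<and> j \<le> 2 * n \<and>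
           R.good c d (R.cand c d (R.cyc u v) k l i j)"
        then show ?thesis unfolding s' using search_hit[OF t2] by blast
      qed
    qed
    then show ?thesis using t3 by (auto simp: tinv_def agrees_def K_def)
  qed
  then show "env s'" "bounded s'" "move\<^sup>*\<^sup>* (s ''cur'') (s' ''cur'')"
    "\<And>v. s' ''cur'' v = s ''cur'' v \<or> s' ''cur'' v = d v"
    "s ''q'' 0 < n \<Longrightarrow> hom (s ''cur'') \<Longrightarrow> move\<^sup>*\<^sup>* (s ''cur'') d \<Longrightarrow>
      (\<exists>F. frozen (s ''cur'') F \<and> s ''q'' 0 \<in> F \<and> F \<subseteq> comp (s ''q'' 0)) \<or>
      (\<forall>F. F \<subseteq> comp (s ''q'' 0) \<longrightarrow> frozen (s ''cur'') F \<longrightarrow> F = {}) \<Longrightarrow>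
      \<forall>v\<in>comp (s ''q'' 0). s' ''cur'' v = d v"
    unfolding c_def q_def by blast+
qed

lemma roots_den:
  assumes env: "env s" and bd: "bounded s" and h: "hom (s ''cur'')"
  defines "s' \<equiv> den (PFor ''q'' (p_root es ws)) s"
  shows "env s'" "bounded s'" "move\<^sup>*\<^sup>* (s ''cur'') (s' ''cur'')"
    and "move\<^sup>*\<^sup>* (s ''cur'') d \<Longrightarrow> x < n \<Longrightarrow> s' ''cur'' x = d x"
proof -
  define c where "c = s ''cur''"
  define I where "I t \<longleftrightarrow> env t \<and> bounded t \<and> move\<^sup>*\<^sup>* c (t ''cur'')" for t
  have I0: "I s" using env bd by (simp add: I_def c_def)
  have I1: "I (den (p_root es ws) t)" if "I t" for t
    using that root_den(1-3)[of t] by (auto simp: I_def intro: rtranclp_trans)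
  have I2: "I (setc t ''q'' v)" if "I t" for t v
    using that env_setc[of "''q''" t v] by (simp add: I_def bounded_def)
  have s': "s' = den (fors [''q''] (p_root es ws)) s" by (simp only: s'_def fors.simps)
  have "I s'"
    unfolding s' by (rule fors_preserve[of I]) (use I0 I1 I2 in auto)
  then show "env s'" "bounded s'" "move\<^sup>*\<^sup>* (s ''cur'') (s' ''cur'')" by (auto simp: I_def c_def)
  assume mv: "move\<^sup>*\<^sup>* (s ''cur'') d" and x: "x < n"
  have sym: "v \<in> comp u \<Longrightarrow> u \<in> comp v" for u v
    unfolding comp_def using adj_sym by (metis mem_Collect_eq sympI sympD symp_rtranclp)
  have comp_eq: "comp v = comp u" if "v \<in> comp u" for u v
    using that sym[OF that] unfolding comp_def by (auto intro: rtranclp_trans)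
  have comp_less: "v < n" if "v \<in> comp u" "u < n" for u v
  proof -
    have "adj\<^sup>*\<^sup>* u v" using that by (simp add: comp_def)
    then show ?thesis by (induction rule: rtranclp_induct) (use that adj_less2 in auto)
  qed
  have xx: "x \<in> comp x" by (simp add: comp_def)
  \<comment> \<open>The root is taken from a frozen set if the component of \<open>x\<close> has a
    non-empty one, and is \<open>x\<close> itself otherwise; either way the last claim of
    \<open>root_den\<close> applies.\<close>
  obtain q where q: "q \<in> comp x" and alt: "(\<exists>F. frozen c F \<and> q \<in> F \<and> F \<subseteq> comp q) \<or>
      (\<forall>F. F \<subseteq> comp q \<longrightarrow> frozen c F \<longrightarrow> F = {})"
  proof (cases "\<exists>F. F \<subseteq> comp x \<and> frozen c F \<and> F \<noteq> {}")
    case True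
    then obtain F y where F: "F \<subseteq> comp x" "frozen c F" "y \<in> F" by auto
    then have "comp y = comp x" using comp_eq by blast
    then show ?thesis using that[of y] F by auto
  next
    case False
    then show ?thesis using that[of x] xx by auto
  qed
  have qn: "q < n" using comp_less[OF q x] .
  have xq: "x \<in> comp q" using sym[OF q] .
  show "s' ''cur'' x = d x"
    unfolding s'
  proof (rule fors_search[where I = I and val = "\<lambda>_. q" and N = N and D = "\<lambda>t. t ''cur'' x = d x"])
    show "I s" by (rule I0)
    show "q < N" using qn nN by simp
    fix t assume t: "I t"
    show "t ''N'' 0 = N" using t by (simp add: I_def env_def)
    show "I (den (p_root es ws) t)" using I1[OF t] .
    show "I (setc t y v)" if "y \<in> set [''q'']" for y v using I2[OF t] that by simp
    have et: "env t" "bounded t" "move\<^sup>*\<^sup>* c (t ''cur'')" using t by (auto simp: I_def)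
    show "den (p_root es ws) t ''cur'' x = d x" if "t ''cur'' x = d x"
      using root_den(4)[OF et(1,2), of x] that by auto
    assume "\<forall>y\<in>set [''q'']. t y 0 = q"
    then have tq: "t ''q'' 0 = q" by simp
    \<comment> \<open>Earlier roots may have changed the colouring, but moves preserve frozen sets
      in both directions, so \<open>q\<close> is still a suitable root.\<close>
    have fz: "frozen (t ''cur'') F \<longleftrightarrow> frozen c F" for F
      using frozen_moves[OF et(3)] frozen_moves[OF moves_sym[OF et(3)]] by blast
    have "move\<^sup>*\<^sup>* (t ''cur'') d" using moves_sym[OF et(3)] mv by (auto simp: c_def)
    then show "den (p_root es ws) t ''cur'' x = d x"
      using root_den(5)[OF et(1,2)] tq qn alt fz moves_hom[OF et(3)] h xq by (simp add: c_def)
  next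
    show "set [''q''] \<inter> writes (p_root es ws) = {}" using writes_root[of es ws] by auto
  qed auto
qed

theorem all_den:
  assumes env: "env s" and bd: "bounded s" and h: "hom (s ''cur'')" and dz: "\<And>i. n \<le> i \<Longrightarrow> d i = 0"
  shows "den (p_all es ws) s ''out'' 0 = (if move\<^sup>*\<^sup>* (s ''cur'') d then 1 else 0)"
proof -
  define s1 where "s1 = den (PFor ''q'' (p_root es ws)) s"
  note R = roots_den[OF env bd h, folded s1_def]
  let ?c = "And (Less (V ''a'') Ne) (Not (Equal (Get ''cur'' (V ''a'')) (Get ''psi'' (V ''a''))))"
  have "den (p_all es ws) s = den (PFor ''a'' (PIf ?c (PSet ''out'' (Const 0)) PSkip)) (den (PSet ''out'' (Const 1)) s1)"
    by (simp only: p_all_def den.simps(3) s1_def)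
  moreover have "den (PFor ''a'' (PIf ?c (PSet ''out'' (Const 0)) PSkip)) (den (PSet ''out'' (Const 1)) s1) ''out'' 0 =
    (if \<exists>i<N. i < n \<and> s1 ''cur'' i \<noteq> d i then 0 else den (PSet ''out'' (Const 1)) s1 ''out'' 0)"
    by (rule flag_for) (use R(1) in \<open>simp_all add: env_def\<close>)
  ultimately have out: "den (p_all es ws) s ''out'' 0 = (if \<exists>i<n. s1 ''cur'' i \<noteq> d i then 0 else 1)"
    using nN by auto
  have "(\<exists>i<n. s1 ''cur'' i \<noteq> d i) \<longleftrightarrow> \<not> move\<^sup>*\<^sup>* (s ''cur'') d"
  proof (cases "\<exists>i<n. s1 ''cur'' i \<noteq> d i")
    case False
    then have "s1 ''cur'' = d"
      using R(2) dz by (auto simp: bounded_def fun_eq_iff) (metis not_less)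
    then show ?thesis using R(3) False by simp
  qed (use R(4) in blast)
  then show ?thesis using out by simp
qed

end

section \<open>From instances to memory\<close>

lemma rtranclp_recolouring:
  fixes G :: "'v graph" and H :: "'a graph"
  defines "R \<equiv> \<lambda>\<phi> \<psi>. \<phi> \<in> colourings G H \<and> \<psi> \<in> colourings G H \<and> recolouring_step G H \<phi> \<psi>"
  assumes "\<phi> \<in> colourings G H"
  shows "(\<exists>\<phi>s. recolouring G H \<phi> \<psi> \<phi>s) \<longleftrightarrow> R\<^sup>*\<^sup>* \<phi> \<psi>"
proof
  assume "\<exists>\<phi>s. recolouring G H \<phi> \<psi> \<phi>s"
  then obtain \<phi>s where ps: "\<phi>s \<noteq> []" "hd \<phi>s = \<phi>" "last \<phi>s = \<psi>" "set \<phi>s \<subseteq> colourings G H"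
    "\<And>i. Suc i < length \<phi>s \<Longrightarrow> recolouring_step G H (\<phi>s ! i) (\<phi>s ! Suc i)"
    by (auto simp: recolouring_def)
  have "R\<^sup>*\<^sup>* \<phi> (\<phi>s ! i)" if "i < length \<phi>s" for i
    using that
  proof (induction i)
    case 0
    then show ?case using ps by (simp add: hd_conv_nth)
  next
    case (Suc i)
    then have "R (\<phi>s ! i) (\<phi>s ! Suc i)"
      using ps(4,5) nth_mem[of i \<phi>s] nth_mem[of "Suc i" \<phi>s] by (auto simp: R_def)
    then show ?case using Suc by (auto intro: rtranclp.rtrancl_into_rtrancl)
  qed
  from this[of "length \<phi>s - 1"] show "R\<^sup>*\<^sup>* \<phi> \<psi>" using ps by (simp add: last_conv_nth)
next
  assume "R\<^sup>*\<^sup>* \<phi> \<psi>"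
  then show "\<exists>\<phi>s. recolouring G H \<phi> \<psi> \<phi>s"
  proof (induction rule: rtranclp_induct)
    case base
    then show ?case using assms(2) by (intro exI[of _ "[\<phi>]"]) (simp add: recolouring_def)
  next
    case (step \<psi> \<psi>')
    then obtain \<phi>s where ps: "\<phi>s \<noteq> []" "hd \<phi>s = \<phi>" "last \<phi>s = \<psi>" "set \<phi>s \<subseteq> colourings G H"
      "\<And>i. Suc i < length \<phi>s \<Longrightarrow> recolouring_step G H (\<phi>s ! i) (\<phi>s ! Suc i)"
      by (auto simp: recolouring_def)
    have "recolouring_step G H ((\<phi>s @ [\<psi>']) ! i) ((\<phi>s @ [\<psi>']) ! Suc i)" if "i < length \<phi>s" for i
    proof (cases "Suc i < length \<phi>s")
      case True
      then show ?thesis using ps(5) by (simp add: nth_append)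
    next
      case False
      then have "i = length \<phi>s - 1" using that by simp
      then have "(\<phi>s @ [\<psi>']) ! i = \<psi>" "(\<phi>s @ [\<psi>']) ! Suc i = \<psi>'"
        using ps that by (auto simp: nth_append last_conv_nth)
      then show ?thesis using step(2) by (simp add: R_def)
    qed
    then show ?case using ps step(2)
      by (intro exI[of _ "\<phi>s @ [\<psi>']"]) (auto simp: recolouring_def R_def)
  qed
qed

locale recol_instance =
  fixes G :: "'v graph" and H :: "'a graph" and \<kappa> :: "'a \<Rightarrow> nat" and vs :: "'v list"
  assumes G: "graph G" "reflexive G" and H: "graph H" "reflexive H" "triangle_free H"
    and \<kappa>: "inj_on \<kappa> (verts H)" and vs: "distinct vs" "set vs = verts G"
begin

definition adj :: "nat \<Rightarrow> nat \<Rightarrow> bool" where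
  "adj u v \<longleftrightarrow> u < length vs \<and> v < length vs \<and> (vs ! u, vs ! v) \<in> edges G"

definition E :: "(nat \<times> nat) set" where "E = map_prod \<kappa> \<kappa> ` edges H"

text \<open>Zero outside the index range is what \<open>bounded\<close> requires.\<close>

definition code :: "('v \<Rightarrow> 'a) \<Rightarrow> nat \<Rightarrow> nat" where
  "code \<phi> = (\<lambda>i. if i < length vs then \<kappa> (\<phi> (vs ! i)) else 0)"

lemma edge_verts: "(a, b) \<in> edges H \<Longrightarrow> a \<in> verts H \<and> b \<in> verts H"
  using H by (auto simp: graph_def)

lemma edge_sym: "(a, b) \<in> edges H \<Longrightarrow> (b, a) \<in> edges H"
  using H by (auto simp: graph_def dest: symD)

lemma G_sym: "(u, v) \<in> edges G \<Longrightarrow> (v, u) \<in> edges G"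
  using G(1) unfolding graph_def by (meson symD)

lemma E_I: "(x, y) \<in> edges H \<Longrightarrow> (\<kappa> x, \<kappa> y) \<in> E"
  unfolding E_def by (rule image_eqI[of _ _ "(x, y)"]) auto

lemma E_E:
  assumes "(a, b) \<in> E"
  obtains x y where "a = \<kappa> x" "b = \<kappa> y" "(x, y) \<in> edges H"
  using assms unfolding E_def by auto

lemma nth_vs: "i < length vs \<Longrightarrow> vs ! i \<in> verts G"
  using nth_mem[of i vs] vs(2) by simp

sublocale recol_graph "length vs" adj E
proof
  show "adj u v \<Longrightarrow> adj v u" for u v using G_sym by (simp add: adj_def)
  show "v < length vs \<Longrightarrow> adj v v" for v using G nth_vs by (auto simp: adj_def reflexive_def)
  show "adj u v \<Longrightarrow> u < length vs" for u v by (simp add: adj_def)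
  show "(a, b) \<in> E \<Longrightarrow> (b, a) \<in> E" for a b by (metis E_E E_I edge_sym)
  show "(a, b) \<in> E \<Longrightarrow> (b, b) \<in> E" for a b
    using edge_verts H(2) unfolding reflexive_def by (metis E_E E_I)
qed

lemma colouring_verts: "\<phi> \<in> colourings G H \<Longrightarrow> v \<in> verts G \<Longrightarrow> \<phi> v \<in> verts H"
  by (auto simp: colourings_def)

lemma code_hom: "\<phi> \<in> colourings G H \<Longrightarrow> hom (code \<phi>)"
  unfolding hom_def adj_def code_def colourings_def by (auto intro: E_I)

lemma code_inj:
  assumes "\<phi> \<in> colourings G H" "\<psi> \<in> colourings G H" "code \<phi> = code \<psi>"
  shows "\<phi> = \<psi>"
proof (rule PiE_ext[of \<phi> "verts G" "\<lambda>_. verts H"])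
  fix v assume v: "v \<in> verts G"
  then obtain i where i: "i < length vs" "vs ! i = v" using vs by (metis in_set_conv_nth)
  have "\<kappa> (\<phi> v) = \<kappa> (\<psi> v)" using fun_cong[OF assms(3), of i] i by (simp add: code_def)
  then show "\<phi> v = \<psi> v" using \<kappa> colouring_verts assms v by (auto dest: inj_onD)
qed (use assms in \<open>auto simp: colourings_def\<close>)

text \<open>Since \<open>H\<close> is triangle-free, the neighbours of a recoloured vertex only have its old and its new
  colour.\<close>

lemma step_move:
  assumes "\<phi> \<in> colourings G H" "\<psi> \<in> colourings G H" "recolouring_step G H \<phi> \<psi>"
  shows "move (code \<phi>) (code \<psi>)"
proof -
  obtain v where v: "v \<in> verts G" "\<phi> v \<noteq> \<psi> v" "\<And>u. u \<in> verts G \<Longrightarrow> u \<noteq> v \<Longrightarrow> \<phi> u = \<psi> u"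
    "(v, v) \<in> edges G \<longrightarrow> (\<phi> v, \<psi> v) \<in> edges H"
    using assms(3) by (auto simp: recolouring_step_def)
  then have vv: "(\<phi> v, \<psi> v) \<in> edges H" using G by (auto simp: reflexive_def)
  obtain i where i: "i < length vs" "vs ! i = v" using vs v by (metis in_set_conv_nth)
  have code: "code \<psi> = (code \<phi>)(i := \<kappa> (\<psi> v))"
  proof
    fix j
    show "code \<psi> j = ((code \<phi>)(i := \<kappa> (\<psi> v))) j"
      using v(3)[of "vs ! j"] i nth_vs[of j] vs(1) by (auto simp: code_def nth_eq_iff_index_eq)
  qed
  have nb: "code \<phi> j = code \<phi> i \<or> code \<phi> j = \<kappa> (\<psi> v)" if j: "adj j i" for j
  proof (cases "j = i")
    case False
    define x where "x = vs ! j"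
    have x: "x \<in> verts G" "x \<noteq> v" "(x, v) \<in> edges G"
      using j False i nth_vs vs(1) by (auto simp: x_def adj_def nth_eq_iff_index_eq)
    have "(\<phi> x, \<phi> v) \<in> edges H" "(\<psi> x, \<psi> v) \<in> edges H"
      using assms(1,2) x(3) unfolding colourings_def by blast+
    then have "(\<phi> x, \<phi> v) \<in> edges H" "(\<phi> x, \<psi> v) \<in> edges H" using v(3)[OF x(1,2)] by auto
    then have "\<phi> x = \<phi> v \<or> \<phi> x = \<psi> v"
      using H(3) vv v(2) edge_sym unfolding triangle_free_def by blast
    then show ?thesis using i j by (auto simp: code_def x_def adj_def)
  qed simp
  have "can_move (code \<phi>) i (\<kappa> (\<psi> v))"
    unfolding can_move_def using i nb vv by (auto simp: code_def E_def)
  then show ?thesis using code by (auto simp: move_def)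
qed

text \<open>\<open>can_move\<close> also admits the idle move to the present colour, hence the
  alternative that nothing changes. The new map is again a colouring because all neighbours show one
  of two adjacent reflexive colours.\<close>

lemma move_step:
  assumes phi: "\<phi> \<in> colourings G H" and mv: "move (code \<phi>) c"
  shows "\<exists>\<psi>. \<psi> \<in> colourings G H \<and> code \<psi> = c \<and> (\<psi> = \<phi> \<or> recolouring_step G H \<phi> \<psi>)"
proof -
  obtain i b where cm: "can_move (code \<phi>) i b" and c: "c = (code \<phi>)(i := b)"
    using mv by (auto simp: move_def)
  have i: "i < length vs" using cm by (simp add: can_move_def)
  define v where "v = vs ! i"
  have v: "v \<in> verts G" using nth_vs[OF i] by (simp add: v_def)
  have "(\<kappa> (\<phi> v), b) \<in> E" using cm i by (simp add: can_move_def code_def v_def)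
  then obtain a y where ay: "\<kappa> (\<phi> v) = \<kappa> a" "b = \<kappa> y" "(a, y) \<in> edges H" by (auto simp: E_def)
  then have "a = \<phi> v" using \<kappa> colouring_verts[OF phi v] edge_verts by (auto dest: inj_onD)
  with ay have y: "(\<phi> v, y) \<in> edges H" "y \<in> verts H" "b = \<kappa> y" using edge_verts by auto
  have nb: "\<phi> u = \<phi> v \<or> \<phi> u = y" if u: "(u, v) \<in> edges G" for u
  proof -
    have uG: "u \<in> verts G" using u G by (auto simp: graph_def)
    obtain j where j: "j < length vs" "vs ! j = u" using uG vs by (metis in_set_conv_nth)
    have "adj j i" using u i j by (simp add: adj_def v_def)
    then have "code \<phi> j = code \<phi> i \<or> code \<phi> j = b" using cm by (simp add: can_move_def)
    then have "\<kappa> (\<phi> u) = \<kappa> (\<phi> v) \<or> \<kappa> (\<phi> u) = \<kappa> y" using i j y by (simp add: code_def v_def)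
    then show ?thesis using \<kappa> colouring_verts[OF phi] uG v y by (auto dest: inj_onD)
  qed
  define \<psi> where "\<psi> = \<phi>(v := y)"
  have yy: "(y, y) \<in> edges H" using y H by (auto simp: reflexive_def)
  have nby: "(\<phi> u, y) \<in> edges H" if "(u, v) \<in> edges G" for u
    using nb[OF that] y yy by auto
  have psi: "\<psi> \<in> colourings G H"
    unfolding colourings_def
  proof (intro CollectI conjI allI impI)
    show "\<psi> \<in> verts G \<rightarrow>\<^sub>E verts H"
      using phi v y by (auto simp: \<psi>_def colourings_def PiE_iff extensional_def)
    fix u w assume uw: "(u, w) \<in> edges G"
    then have wu: "(w, u) \<in> edges G" by (rule G_sym)
    have "(\<phi> u, \<phi> w) \<in> edges H" using phi uw by (auto simp: colourings_def)
    then show "(\<psi> u, \<psi> w) \<in> edges H"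
      using yy nby[of u] edge_sym[OF nby[of w]] uw wu by (auto simp: \<psi>_def)
  qed
  have "code \<psi> = c"
    unfolding c using i y vs(1) by (auto simp: code_def \<psi>_def v_def fun_eq_iff nth_eq_iff_index_eq)
  moreover have "\<psi> = \<phi> \<or> recolouring_step G H \<phi> \<psi>"
  proof (cases "y = \<phi> v")
    case False
    then have "recolouring_step G H \<phi> \<psi>"
      unfolding recolouring_step_def using v y by (intro bexI[of _ v]) (auto simp: \<psi>_def)
    then show ?thesis ..
  qed (simp add: \<psi>_def)
  ultimately show ?thesis using psi by blast
qed

theorem recol_iff_moves:
  assumes "\<phi> \<in> colourings G H" "\<psi> \<in> colourings G H"
  shows "recol H (G, \<phi>, \<psi>) \<longleftrightarrow> move\<^sup>*\<^sup>* (code \<phi>) (code \<psi>)"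
proof -
  define R where "R = (\<lambda>\<phi> \<psi>. \<phi> \<in> colourings G H \<and> \<psi> \<in> colourings G H \<and> recolouring_step G H \<phi> \<psi>)"
  have "recol H (G, \<phi>, \<psi>) \<longleftrightarrow> R\<^sup>*\<^sup>* \<phi> \<psi>"
    unfolding recol_def R_def using rtranclp_recolouring[OF assms(1), of \<psi>] by simp
  also have "\<dots> \<longleftrightarrow> move\<^sup>*\<^sup>* (code \<phi>) (code \<psi>)"
  proof
    assume "R\<^sup>*\<^sup>* \<phi> \<psi>"
    then show "move\<^sup>*\<^sup>* (code \<phi>) (code \<psi>)"
    proof (induction rule: rtranclp_induct)
      case (step y z)
      then have "move (code y) (code z)" using step_move by (simp add: R_def)
      then show ?case using step by (auto intro: rtranclp.rtrancl_into_rtrancl)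
    qed simp
  next
    assume "move\<^sup>*\<^sup>* (code \<phi>) (code \<psi>)"
    then have "\<exists>\<chi>. R\<^sup>*\<^sup>* \<phi> \<chi> \<and> \<chi> \<in> colourings G H \<and> code \<chi> = code \<psi>"
    proof (induction rule: rtranclp_induct)
      case base
      then show ?case using assms by blast
    next
      case (step y z)
      then obtain \<chi> where chi: "R\<^sup>*\<^sup>* \<phi> \<chi>" "\<chi> \<in> colourings G H" "code \<chi> = y" by blast
      then obtain \<chi>' where "\<chi>' \<in> colourings G H" "code \<chi>' = z" "\<chi>' = \<chi> \<or> recolouring_step G H \<chi> \<chi>'"
        using move_step[of \<chi> z] step by blast
      then show ?case using chi by (auto simp: R_def intro: rtranclp.rtrancl_into_rtrancl)
    qed
    then show "R\<^sup>*\<^sup>* \<phi> \<psi>" using code_inj assms by blast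
  qed
  finally show ?thesis .
qed

end

text \<open>There are finitely many pairs of colours, and one walk for each connected pair is
  enough, since only the ends of the walk matter.\<close>

lemma exists_words:
  fixes E :: "(nat \<times> nat) set"
  assumes fin: "finite E" and refl: "\<And>a b. (a, b) \<in> E \<Longrightarrow> (b, b) \<in> E"
  shows "\<exists>ws :: nat list list. (\<forall>a. (a, a) \<in> E \<longrightarrow> [a] \<in> set ws) \<and>
    (\<forall>Q. Q \<noteq> [] \<longrightarrow> successively (\<lambda>a b. (a, b) \<in> E) Q \<longrightarrow> (hd Q, hd Q) \<in> E \<longrightarrow>
      (\<exists>w\<in>set ws. w \<noteq> [] \<and> successively (\<lambda>a b. (a, b) \<in> E) w \<and> hd w = hd Q \<and> last w = last Q))"
proof -
  define A where "A = {a. (a, a) \<in> E}"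
  define good where "good a b w \<longleftrightarrow> w \<noteq> [] \<and> successively (\<lambda>a b. (a, b) \<in> E) w \<and> hd w = a \<and> last w = b"
    for a b and w :: "nat list"
  \<comment> \<open>For colours without a connecting walk the choice yields an arbitrary list. This
    is harmless: words are only candidates, and their moves are checked.\<close>
  define W where "W = (\<lambda>a. [a]) ` A \<union> (\<lambda>(a, b). SOME w. good a b w) ` (A \<times> A)"
  have "A \<subseteq> fst ` E" by (force simp: A_def)
  then have "finite A" using fin by (meson finite_imageI finite_subset)
  then have "finite W" by (simp add: W_def)
  then obtain ws where ws: "set ws = W" using finite_list by blast
  have last: "(last Q, last Q) \<in> E"
    if "Q \<noteq> []" "successively (\<lambda>a b. (a, b) \<in> E) Q" "(hd Q, hd Q) \<in> E" for Q
    using that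
  proof (induction Q)
    case (Cons x Q)
    then show ?case using refl by (cases Q) auto
  qed simp
  show ?thesis
  proof (intro exI[of _ ws] conjI allI impI)
    fix a assume "(a, a) \<in> E"
    then show "[a] \<in> set ws" by (simp add: ws W_def A_def)
  next
    fix Q assume Q: "Q \<noteq> []" "successively (\<lambda>a b. (a, b) \<in> E) Q" "(hd Q, hd Q) \<in> E"
    then have "good (hd Q) (last Q) Q" by (simp add: good_def)
    then have "good (hd Q) (last Q) (SOME w. good (hd Q) (last Q) w)" by (rule someI)
    moreover have "(SOME w. good (hd Q) (last Q) w) \<in> set ws"
      using Q last[OF Q] by (force simp: ws W_def A_def)
    ultimately show "\<exists>w\<in>set ws. w \<noteq> [] \<and> successively (\<lambda>a b. (a, b) \<in> E) w \<and> hd w = hd Q \<and> last w = last Q"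
      unfolding good_def by blast
  qed
qed

section \<open>Reading the input and fixing the loop bound\<close>

primrec times_exp :: "nat \<Rightarrow> aexp \<Rightarrow> aexp" where
  "times_exp 0 e = Const 0"
| "times_exp (Suc k) e = Add e (times_exp k e)"

lemma aval_times_exp [simp]: "aval (times_exp k e) s = k * aval e s"
  by (induction k) auto

text \<open>The square is computed by repeated addition. While this loop runs, the cell
  \<open>N\<close> still holds the number to be squared.\<close>

definition p_square :: prog where
  "p_square = PFor ''a'' (PSet ''M'' (Add (V ''M'') (V ''N'')))"

text \<open>Entry \<open>n\<close> of the table points just behind the adjacency matrix, where the
  codes of the colours begin.\<close>

definition p_rows :: prog where
  "p_rows = PSeq (PPut ''row'' (Const 0) (Const 1))
     (PFor ''a'' (PPut ''row'' (Add (V ''a'') (Const 1)) (Add (Get ''row'' (V ''a'')) Ne)))"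

definition p_read :: "string \<Rightarrow> aexp \<Rightarrow> prog" where
  "p_read arr e = PFor ''a'' (PIf (Less (V ''a'') Ne)
     (PPut arr (V ''a'') (Get ''in'' (Add e (V ''a'')))) PSkip)"

definition p_main :: "(nat \<times> nat) list \<Rightarrow> nat list list \<Rightarrow> prog" where
  "p_main es ws = PSeq p_rows (PSeq (p_read ''cur'' (Get ''row'' Ne))
     (PSeq (p_read ''psi'' (Add (Get ''row'' Ne) Ne)) (p_all es ws)))"

text \<open>\<open>N = (9 n + B)\<^sup>2\<close> exceeds the length of all candidate words of \<open>length_cand\<close>.\<close>

definition main :: "(nat \<times> nat) list \<Rightarrow> nat list list \<Rightarrow> nat \<Rightarrow> com" where
  "main es ws B = Seq (Put ''N'' (Const 0) (Add (times_exp 9 Ne) (Const B)))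
     (Seq (compile p_square) (Seq (Put ''N'' (Const 0) (V ''M'')) (compile (p_main es ws))))"

lemma wf_square [simp]: "wf_prog p_square"
  by (simp add: p_square_def)

lemma wf_main [simp]: "wf_prog (p_main es ws)"
  by (simp add: p_main_def p_rows_def p_read_def)

lemma square_den:
  assumes "s ''N'' 0 = N" "s ''M'' 0 = 0"
  shows "den p_square s ''M'' 0 = N * N"
proof -
  let ?p = "PSet ''M'' (Add (V ''M'') (V ''N''))"
  have "\<exists>t. den (PFor ''a'' ?p) s = setc t ''a'' N \<and> t ''M'' 0 = N * N \<and>
      (\<forall>y. y \<notin> writes (PFor ''a'' ?p) \<longrightarrow> t y = s y)"
  proof (rule den_for[where I = "\<lambda>i t. t ''M'' 0 = i * N" and s = s and N = N])
    fix i t assume "t ''M'' 0 = i * N" and "\<And>y. y \<notin> writes (PFor ''a'' ?p) \<Longrightarrow> t y = s y"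
    then show "den ?p (setc t ''a'' i) ''M'' 0 = Suc i * N" using assms by simp
  qed (use assms in auto)
  then obtain t where t: "den (PFor ''a'' ?p) s = setc t ''a'' N" "t ''M'' 0 = N * N" by blast
  show ?thesis unfolding p_square_def t(1) using t(2) by simp
qed

lemma rows_den:
  assumes "s ''N'' 0 = N" "s ''in'' 0 = n" "i \<le> N"
  shows "den p_rows s ''row'' i = 1 + i * n"
proof -
  let ?p = "PPut ''row'' (Add (V ''a'') (Const 1)) (Add (Get ''row'' (V ''a'')) Ne)"
  define s1 where "s1 = den (PPut ''row'' (Const 0) (Const 1)) s"
  have N1: "s1 ''N'' 0 = N" using assms by (simp add: s1_def)
  have "\<exists>t. den (PFor ''a'' ?p) s1 = setc t ''a'' N \<and> (\<forall>j\<le>N. t ''row'' j = 1 + j * n) \<and>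
      (\<forall>y. y \<notin> writes (PFor ''a'' ?p) \<longrightarrow> t y = s1 y)"
  proof (rule den_for[where I = "\<lambda>i t. \<forall>j\<le>i. t ''row'' j = 1 + j * n" and s = s1 and N = N, OF N1])
    fix i t assume I: "\<forall>j\<le>i. t ''row'' j = 1 + j * n"
      and fr: "\<And>y. y \<notin> writes (PFor ''a'' ?p) \<Longrightarrow> t y = s1 y"
    have "t ''in'' 0 = n" using fr[of "''in''"] assms by (simp add: s1_def)
    then show "\<forall>j\<le>Suc i. den ?p (setc t ''a'' i) ''row'' j = 1 + j * n"
      using I by (auto simp: le_Suc_eq)
  qed (simp add: s1_def)
  then obtain t where t: "den (PFor ''a'' ?p) s1 = setc t ''a'' N" "\<forall>j\<le>N. t ''row'' j = 1 + j * n" by blast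
  have "den p_rows s = setc t ''a'' N" by (simp only: p_rows_def den.simps(3) s1_def[symmetric] t(1))
  then show ?thesis using t(2) assms(3) by simp
qed

lemma writes_rows [simp]: "writes p_rows = {''row'', ''a''}"
  by (auto simp: p_rows_def)

lemma writes_read [simp]: "writes (p_read arr e) = {arr, ''a''}"
  by (auto simp: p_read_def)

lemma read_den:
  assumes N: "s ''N'' 0 = N" and n: "s ''in'' 0 = n" "n \<le> N" and arr: "arr \<notin> {''in'', ''a''}"
    and e: "\<And>t. (\<And>y. y \<notin> {arr, ''a''} \<Longrightarrow> t y = s y) \<Longrightarrow> aval e t = k"
  shows "den (p_read arr e) s arr = (\<lambda>i. if i < n then s ''in'' (k + i) else s arr i)"
proof -
  let ?p = "PIf (Less (V ''a'') Ne) (PPut arr (V ''a'') (Get ''in'' (Add e (V ''a'')))) PSkip"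
  define I where "I i t \<longleftrightarrow> t arr = (\<lambda>j. if j < n \<and> j < i then s ''in'' (k + j) else s arr j)"
    for i and t :: memory
  have "\<exists>t. den (PFor ''a'' ?p) s = setc t ''a'' N \<and> I N t \<and>
      (\<forall>y. y \<notin> writes (PFor ''a'' ?p) \<longrightarrow> t y = s y)"
  proof (rule den_for[where I = I and s = s and N = N, OF N])
    fix i t assume I: "I i t" and fr: "\<And>y. y \<notin> writes (PFor ''a'' ?p) \<Longrightarrow> t y = s y"
    have "aval e (setc t ''a'' i) = k" by (rule e) (use fr in auto)
    moreover have "t ''in'' = s ''in''" using fr[of "''in''"] arr by auto
    ultimately show "I (Suc i) (den ?p (setc t ''a'' i))"
      using I arr n by (auto simp: I_def less_Suc_eq fun_eq_iff)
  qed (simp add: I_def)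
  then obtain t where t: "den (PFor ''a'' ?p) s = setc t ''a'' N" "I N t" by blast
  have "den (p_read arr e) s arr = t arr" unfolding p_read_def t(1) using arr by simp
  then show ?thesis using t(2) n by (auto simp: I_def fun_eq_iff)
qed

lemma concat_nth:
  assumes "\<And>x. x \<in> set xs \<Longrightarrow> length (f x) = n" "u < length xs" "v < n"
  shows "concat (map f xs) ! (u * n + v) = f (xs ! u) ! v"
  using assms
proof (induction xs arbitrary: u)
  case (Cons x xs)
  show ?case
  proof (cases u)
    case 0
    then show ?thesis using Cons.prems by (simp add: nth_append)
  next
    case (Suc u')
    then have "concat (map f xs) ! (u' * n + v) = f (xs ! u') ! v"
      using Cons by auto
    then show ?thesis using Suc Cons.prems(1)[of x] by (simp add: nth_append add.assoc)
  qed
qed simp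

lemma length_concat_map: "(\<And>x. x \<in> set xs \<Longrightarrow> length (f x) = n) \<Longrightarrow> length (concat (map f xs)) = length xs * n"
  by (induction xs) auto

theorem theorem1p1:
  fixes H :: "'a graph" and \<kappa> :: "'a \<Rightarrow> nat"
  assumes "graph H" and "reflexive H" and "triangle_free H"
    and "inj_on \<kappa> (verts H)"
  shows "poly_time_solvable
           {(G :: 'v graph, \<phi>, \<psi>). (G, \<phi>, \<psi>) \<in> recol_instances H \<and> reflexive G}
           (recol H) (encodes \<kappa>) (\<lambda>(G, \<phi>, \<psi>). card (verts G))"
proof -
  define E where "E = map_prod \<kappa> \<kappa> ` edges H"
  have vertsH: "a \<in> verts H \<and> b \<in> verts H" if "(a, b) \<in> edges H" for a b
    using assms(1) that by (auto simp: graph_def)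
  have "finite (verts H \<times> verts H)" "edges H \<subseteq> verts H \<times> verts H"
    using assms(1) by (auto simp: graph_def)
  then have finE: "finite E" unfolding E_def by (meson finite_imageI finite_subset)
  have reflE: "(b, b) \<in> E" if "(a, b) \<in> E" for a b
  proof -
    from that obtain x y where "b = \<kappa> y" "(x, y) \<in> edges H" by (auto simp: E_def)
    then have "(y, y) \<in> edges H" using vertsH[of x y] assms(2) by (simp add: reflexive_def)
    then show ?thesis unfolding E_def using \<open>b = \<kappa> y\<close> by (intro image_eqI[of _ _ "(y, y)"]) auto
  qed
  obtain es where es: "set es = E" using finE finite_list by blast
  obtain ws :: "nat list list" where ws: "\<And>a. (a, a) \<in> E \<Longrightarrow> [a] \<in> set ws"
    "\<And>Q. Q \<noteq> [] \<Longrightarrow> successively (\<lambda>a b. (a, b) \<in> E) Q \<Longrightarrow> (hd Q, hd Q) \<in> E \<Longrightarrow>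
      (\<exists>w\<in>set ws. w \<noteq> [] \<and> successively (\<lambda>a b. (a, b) \<in> E) w \<and> hd w = hd Q \<and> last w = last Q)"
  proof -
    have ex: "\<exists>ws :: nat list list. (\<forall>a. (a, a) \<in> E \<longrightarrow> [a] \<in> set ws) \<and>
      (\<forall>Q. Q \<noteq> [] \<longrightarrow> successively (\<lambda>a b. (a, b) \<in> E) Q \<longrightarrow> (hd Q, hd Q) \<in> E \<longrightarrow>
        (\<exists>w\<in>set ws. w \<noteq> [] \<and> successively (\<lambda>a b. (a, b) \<in> E) w \<and> hd w = hd Q \<and> last w = last Q))"
      by (rule exists_words[OF finE reflE])
    show thesis by (rule exE[OF ex], rule that) blast+
  qed
  \<comment> \<open>The summand \<open>10\<close> makes the square of \<open>9 * n + B\<close>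
    exceed the bound in \<open>N_large\<close>; the sum dominates the length of every word in
    \<open>ws\<close>.\<close>
  define B where "B = 10 + sum_list (map length ws)"
  have lenB: "length w < B" if "w \<in> set ws" for w
    using member_le_sum_list[of "length w" "map length ws"] that by (simp add: B_def)
  define pM pN :: "nat poly" where "pM = [:B, 9:]" and "pN = [:B, 9:] * [:B, 9:]"
  \<comment> \<open>\<open>p_square\<close> runs while \<open>N\<close> holds
    \<open>9 * n + B\<close>, the main part while it holds the square; hence the compositions with
    \<open>pM\<close> and \<open>pN\<close>. The constant \<open>4\<close> is the cost of storing
    the square in \<open>N\<close>.\<close>
  define p where "p = [:acost (Add (times_exp 9 Ne) (Const B)) + 2:] + pcompose (time p_square) pM +
    [:4:] + pcompose (time (p_main es ws)) pN"
  show ?thesis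
    unfolding poly_time_solvable_def
  proof (intro exI[of _ "main es ws B"] exI[of _ p] ballI allI impI)
    fix I :: "('v, 'a) recol_inst" and w
    assume I: "I \<in> {(G, \<phi>, \<psi>). (G, \<phi>, \<psi>) \<in> recol_instances H \<and> reflexive G}" and w: "encodes \<kappa> I w"
    obtain G \<phi> \<psi> where I_eq: "I = (G, \<phi>, \<psi>)" by (cases I) auto
    have G: "graph G" "reflexive G" and col: "\<phi> \<in> colourings G H" "\<psi> \<in> colourings G H"
      using I by (auto simp: I_eq recol_instances_def)
    obtain vs where vs: "distinct vs" "set vs = verts G" and w_eq: "w = length vs #
         concat (map (\<lambda>u. map (\<lambda>v. if (u, v) \<in> edges G then 1 else 0) vs) vs) @
         map (\<lambda>v. \<kappa> (\<phi> v)) vs @ map (\<lambda>v. \<kappa> (\<psi> v)) vs"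
      using w by (auto simp: I_eq encodes_def)
    interpret R: recol_instance G H \<kappa> vs
      using G assms vs by unfold_locales
    define n where "n = length vs"
    define M where "M = 9 * n + B"
    define N where "N = M * M"
    have RE: "R.E = E" by (simp add: R.E_def E_def)
    have "10 \<le> B" by (simp add: B_def)
    have N_large: "64 * n * n + 22 * n + 100 \<le> N"
    proof -
      have "(9 * n + 10) * (9 * n + 10) \<le> N"
        unfolding N_def M_def using \<open>10 \<le> B\<close> by (intro mult_le_mono) auto
      moreover have "(9 * n + 10) * (9 * n + 10) = 81 * n * n + 180 * n + 100" by (simp add: algebra_simps)
      ultimately show ?thesis by linarith
    qed
    have nN: "n \<le> N" using N_large by linarith
    have BN: "B \<le> N" unfolding N_def M_def using \<open>10 \<le> B\<close>
      by (metis add_leD2 le_square le_trans order_refl)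
    interpret S: search_machine n R.adj R.E N es "R.code \<psi>" ws
    proof -
      interpret recol_graph n R.adj R.E unfolding n_def by unfold_locales
      show "search_machine n R.adj R.E N es ws"
      proof
        show "set es = R.E" using es RE by simp
        show "n \<le> N" by fact
        show "64 * n * n + 22 * n + 100 \<le> N" by fact
        show "(a, a) \<in> R.E \<Longrightarrow> [a] \<in> set ws" for a using ws(1) RE by simp
        show "Q \<noteq> [] \<Longrightarrow> R.walk Q \<Longrightarrow> (hd Q, hd Q) \<in> R.E \<Longrightarrow>
            \<exists>w\<in>set ws. w \<noteq> [] \<and> R.walk w \<and> hd w = hd Q \<and> last w = last Q" for Q
          unfolding R.walk_def unfolding RE by (rule ws(2))
        show "w \<in> set ws \<Longrightarrow> length w < N" for w using lenB[of w] BN by simp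
      qed
    qed
    define s0 where "s0 = initial w"
    define s1 where "s1 = s0(''N'' := (s0 ''N'')(0 := M))"
    define s2 where "s2 = den p_square s1"
    define s3 where "s3 = s2(''N'' := (s2 ''N'')(0 := N))"
    define s4 where "s4 = den p_rows s3"
    define s5 where "s5 = den (p_read ''cur'' (Get ''row'' Ne)) s4"
    define s6 where "s6 = den (p_read ''psi'' (Add (Get ''row'' Ne) Ne)) s5"
    define rows where "rows = concat (map (\<lambda>u. map (\<lambda>v. if (u, v) \<in> edges G then 1 else 0 :: nat) vs) vs)"
    have lenr: "length rows = n * n"
      unfolding rows_def n_def by (rule length_concat_map) simp
    have w_rows: "w = n # rows @ map (\<lambda>v. \<kappa> (\<phi> v)) vs @ map (\<lambda>v. \<kappa> (\<psi> v)) vs"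
      unfolding w_eq rows_def n_def by (rule refl)
    have lw: "length w = 1 + n * n + n + n"
      unfolding w_rows using lenr by (simp add: n_def)
    have in0: "s0 ''in'' i = w ! i" if "i < length w" for i using that by (simp add: s0_def initial_def)
    have zero: "s0 y i = 0" if "y \<noteq> ''in''" for y i using that by (simp add: s0_def initial_def)
    have s0n: "s0 ''in'' 0 = n" using in0[of 0] lw by (simp add: w_rows)
    have wadj: "w ! (1 + u * n + v) = (if R.adj u v then 1 else 0)" if uv: "u < n" "v < n" for u v
    proof -
      have "u * n + v < n * n"
      proof -
        have "u * n + v < Suc u * n" using uv by simp
        also have "\<dots> \<le> n * n" using uv by (intro mult_le_mono1) simp
        finally show ?thesis .
      qed
      then have "w ! (1 + u * n + v) = rows ! (u * n + v)"
        unfolding w_rows using lenr by (simp add: nth_append)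
      also have "\<dots> = (map (\<lambda>v'. if (vs ! u, v') \<in> edges G then 1 else 0) vs) ! v"
        unfolding rows_def by (rule concat_nth) (use uv in \<open>auto simp: n_def\<close>)
      finally show ?thesis using uv by (simp add: R.adj_def n_def)
    qed
    have wphi: "w ! (1 + n * n + i) = R.code \<phi> i" and wpsi: "w ! (1 + n * n + n + i) = R.code \<psi> i"
      if "i < n" for i
      unfolding w_rows using lenr that by (simp_all add: nth_append n_def R.code_def)
    have fr2: "s2 y = s0 y" if "y \<notin> {''a'', ''M'', ''N''}" for y
      using that den_frame[of y p_square s1] by (simp add: s2_def s1_def p_square_def)
    have s2M: "s2 ''M'' 0 = N" "s1 ''N'' 0 = M"
      using square_den[of s1 M] zero by (simp_all add: s2_def s1_def N_def)
    have fr3: "s3 y = s0 y" if "y \<notin> {''a'', ''M'', ''N''}" for y using that fr2 by (simp add: s3_def)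
    have s3N: "s3 ''N'' 0 = N" by (simp add: s3_def)
    have fr4: "s4 y = s3 y" if "y \<notin> {''a'', ''row''}" for y
      unfolding s4_def by (rule den_frame) (use that in auto)
    have row: "s4 ''row'' i = 1 + i * n" if "i \<le> N" for i
      unfolding s4_def by (rule rows_den) (use s3N fr3 s0n that in auto)
    have fr5: "s5 y = s4 y" if "y \<notin> {''a'', ''cur''}" for y
      unfolding s5_def by (rule den_frame) (use that in auto)
    have fr6: "s6 y = s5 y" if "y \<notin> {''a'', ''psi''}" for y
      unfolding s6_def by (rule den_frame) (use that in auto)
    have in4: "s4 ''in'' = s0 ''in''" "s5 ''in'' = s0 ''in''" "s6 ''in'' = s0 ''in''"
      by (simp_all add: fr3 fr4 fr5 fr6)
    have cur: "s6 ''cur'' = R.code \<phi>"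
    proof -
      have "s5 ''cur'' = (\<lambda>i. if i < n then s4 ''in'' (1 + n * n + i) else s4 ''cur'' i)"
        unfolding s5_def
        by (rule read_den) (use s3N fr4 fr3 s0n in4 row nN in \<open>simp_all\<close>)
      also have "\<dots> = R.code \<phi>"
        using wphi in4 in0 lw zero fr4 fr3 by (auto simp: fun_eq_iff R.code_def n_def)
      finally show ?thesis by (simp add: fr6)
    qed
    have psi: "s6 ''psi'' = R.code \<psi>"
    proof -
      have "s6 ''psi'' = (\<lambda>i. if i < n then s5 ''in'' ((1 + n * n + n) + i) else s5 ''psi'' i)"
        unfolding s6_def
        by (rule read_den) (use s3N fr5 fr4 fr3 s0n in4 row nN in \<open>simp_all\<close>)
      also have "\<dots> = R.code \<psi>"
        using wpsi in4 in0 lw zero fr5 fr4 fr3 by (auto simp: fun_eq_iff R.code_def n_def)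
      finally show ?thesis .
    qed
    have env: "S.env s6"
      unfolding S.env_def
    proof (intro conjI allI impI)
      show "s6 ''in'' 0 = n" using in4 s0n by simp
      show "s6 ''N'' 0 = N" using fr4 fr5 fr6 s3N by simp
      show "s6 ''psi'' = R.code \<psi>" by (rule psi)
      fix u v assume uv: "u < n" "v < n"
      have lt: "1 + u * n + v < length w"
      proof -
        have "u * n + v < Suc u * n" using uv by simp
        also have "\<dots> \<le> n * n" using uv by (intro mult_le_mono1) simp
        finally show ?thesis by (simp add: lw)
      qed
      have "s6 ''row'' u = 1 + u * n" using row[of u] uv nN fr5 fr6 by simp
      then show "s6 ''in'' (s6 ''row'' u + v) = 1 \<longleftrightarrow> R.adj u v"
        using in4 in0[OF lt] wadj[OF uv] by simp
    qed
    have bd: "S.bounded s6"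
      unfolding S.bounded_def cur using zero fr3 fr4 fr5 fr6 by (simp add: R.code_def n_def)
    have "den (p_all es ws) s6 ''out'' 0 = (if R.move\<^sup>*\<^sup>* (R.code \<phi>) (R.code \<psi>) then 1 else 0)"
      using S.all_den[OF env bd] R.code_hom[OF col(1)] unfolding cur by (simp add: R.code_def n_def)
    then have out: "den (p_main es ws) s3 ''out'' 0 = (if recol H I then 1 else 0)"
      by (simp only: p_main_def den.simps(3) s4_def s5_def s6_def I_eq R.recol_iff_moves[OF col])
    obtain t1 where t1: "exec (compile p_square) s1 t1 s2" "t1 \<le> poly (time p_square) M"
      using compile_correct[OF wf_square, of s1] s2M by (auto simp: s2_def)
    obtain t2 where t2: "exec (compile (p_main es ws)) s3 t2 (den (p_main es ws) s3)"
      "t2 \<le> poly (time (p_main es ws)) N"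
      using compile_correct[of "p_main es ws" s3] s3N by auto
    have e1: "exec (Put ''N'' (Const 0) (Add (times_exp 9 Ne) (Const B))) s0
        (acost (Const 0) + acost (Add (times_exp 9 Ne) (Const B)) + 1) s1"
      using exec.Put[of "''N''" "Const 0" "Add (times_exp 9 Ne) (Const B)" s0] s0n
      by (simp add: s1_def M_def)
    have e2: "exec (Put ''N'' (Const 0) (V ''M'')) s2 (acost (Const 0) + acost (V ''M'') + 1) s3"
      using exec.Put[of "''N''" "Const 0" "V ''M''" s2] s2M by (simp add: s3_def)
    have sz: "(case I of (G, \<phi>, \<psi>) \<Rightarrow> card (verts G)) = n"
      using distinct_card[OF vs(1)] vs(2) by (simp add: I_eq n_def)
    have ex: "exec (main es ws B) s0 ((acost (Const 0) + acost (Add (times_exp 9 Ne) (Const B)) + 1) +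
        (t1 + ((acost (Const 0) + acost (V ''M'') + 1) + t2))) (den (p_main es ws) s3)"
      unfolding main_def by (rule exec.Seq[OF e1 exec.Seq[OF t1(1) exec.Seq[OF e2 t2(1)]]])
    have le: "(acost (Const 0) + acost (Add (times_exp 9 Ne) (Const B)) + 1) +
        (t1 + ((acost (Const 0) + acost (V ''M'') + 1) + t2)) \<le> poly p n"
    proof -
      have "poly pM n = M" by (simp add: pM_def M_def mult.commute)
      moreover from this have "poly pN n = N" by (simp only: pN_def poly_mult N_def flip: pM_def)
      ultimately have "poly p n = (acost (Add (times_exp 9 Ne) (Const B)) + 2) + poly (time p_square) M +
          4 + poly (time (p_main es ws)) N"
        by (simp only: p_def poly_add poly_pcompose) simp
      then show ?thesis using t1(2) t2(2) by simp
    qed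
    show "\<exists>t s'. exec (main es ws B) (initial w) t s' \<and>
        t \<le> poly p (case I of (G, \<phi>, \<psi>) \<Rightarrow> card (verts G)) \<and> s' ''out'' 0 = (if recol H I then 1 else 0)"
      unfolding sz using ex le out unfolding s0_def by blast
  qed
qed

end
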